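(* Let $X_1,X_2,U_1,U_2$ be Hilbert spaces, let $(G_1,L_1,K_1)$ and $(G_2,L_2,K_2)$ be impedance passive boundary nodes on $(U_1,X_1,U_1)$ and $(U_2,X_2,U_2)$, respectively, let $J\in\mathcal{B}(U_1,U_2)$ and let $Q\in\mathcal{B}(U_2)$ be a self-adjoint operator such that $Q\ge0$. Let $A_0$ denote the restriction of $L_1$ to $\operatorname{Ker}(G_1+J^*QJK_1)$ and let $H_0\colon\rho(A_0)\to\mathcal{B}(U_1,X_1)$ be the ($H$-type) transfer function of the boundary node $(G_1+J^*QJK_1,L_1,K_1)$. Let $A_2$ denote the restriction of $L_2$ to $\operatorname{Ker}G_2$ and let $P_2\colon\rho(A_2)\to\mathcal{B}(U_2)$ be the ($P$-type) transfer function of $(G_2,L_2,K_2)$. Suppose there exists a non-empty set $E\subseteq\{s\in\mathbb{R}: is\in\rho(A_0)\cap\rho(A_2)\}$, and let $N_0,M_0,M_2\colon E\to[r,\infty)$, for some $r>0$, be such that $\|H_0(is)\|\le N_0(s)$ for $s\in E$ and $$\|(is-A_j)^{-1}\|\le M_j(s),\qquad s\in E,$$ for $j=0,2$. Suppose furthermore that there exists a function $\eta\colon E\to(0,\infty)$ such that $\operatorname{Re}P_2(is)\ge\eta(s)I$ for all $s\in E$. Let $X=X_1\times X_2$ and let $A\colon D(A)\subseteq X\to X$ be defined by $A=\operatorname{diag}(L_1,L_2)$ with domain $$D(A)=\{(x_1,x_2)^\top\in D(L_1)\times D(L_2): G_1x_1=J^*K_2x_2,\ G_2x_2=-JK_1x_1\}.$$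 Then $A$ generates a contraction semigroup on $X$, $iE\subseteq\rho(A)$, and there is a constant $C>0$ independent of $s$ such that $$\|(is-A)^{-1}\|\le C\left(M_0(s)+N_0(s)^2M_2(s)^2\frac{\mu(s)}{\eta(s)}\right),\qquad s\in E,$$ where $\mu(s)=1+\|P_2(1+is)\|^2$ for $s\in\mathbb{R}$.
   Context: All spaces are complex; $\mathcal{B}(X,Y)$ denotes the bounded linear operators from $X$ to $Y$, $\mathcal{B}(X)=\mathcal{B}(X,X)$, and $\rho(\cdot)$ is the resolvent set. Domains of linear operators carry the graph norm. For a bounded operator $T$ on a Hilbert space, $\operatorname{Re}T=\frac12(T+T^* )$, and for self-adjoint bounded $S,T$ we write $T\ge S$ if $\langle Tx-Sx,x\rangle\ge0$ for all $x$. Let $X,U$ be Hilbert spaces and let $L\colon D(L)\subseteq X\to X$ and $G,K\colon D(L)\subseteq X\to U$ be linear. The triple $(G,L,K)$ is a boundary node on $(U,X,U)$ if (i) $G,K\in\mathcal{B}(D(L),U)$; (ii) the restriction $A$ of $L$ to $\operatorname{Ker}G$ generates a $C_0$-semigroup on $X$; (iii) there exists $G^r\in\mathcal{B}(U,D(L))$ with $GG^r=I$. It is impedance passive if $\operatorname{Re}\langle Lx,x\rangle_X\le\operatorname{Re}\langle Gx,Kx\rangle_U$ for all $x\in D(L)$; in this case the semigroup generated by the restriction of $L$ to $\operatorname{Ker}G$ is contractive. With $A$ the restriction of $L$ to $\operatorname{Ker}G$, the transfer functions $H\colon\rho(A)\to\mathcal{B}(U,X)$ and $P\colon\rho(A)\to\mathcal{B}(U)$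 of a boundary node $(G,L,K)$ are defined by $H(\lambda)u=x$ and $P(\lambda)u=Kx$, where $x\in D(L)$ is the unique solution of $(\lambda-L)x=0$, $Gx=u$. For $Q=Q^*\ge0$ the triple $(G_1+J^*QJK_1,L_1,K_1)$ is an impedance passive boundary node on $(U_1,X_1,U_1)$.
   Formalization: The Hilbert space U_2 is assumed to be nonzero; for U_2 = {0} the condition Re P_2(is) ≥ η(s)I is vacuous, so η may be arbitrarily large and the resolvent estimate can fail. *)

theory Defs
  imports "HOL-Analysis.Analysis"
begin

section \<open>Complex Hilbert spaces\<close>

text \<open>
  The inner product is linear in its first argument. The norm, and hence the real scalar
  multiplication, are those of the library class \<^class>\<open>real_normed_vector\<close>.
\<close>

class complex_inner = real_normed_vector +
  fixes scaleC :: "complex \<Rightarrow> 'a \<Rightarrow> 'a" (infixr "*\<^sub>C" 75)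
    and cinner :: "'a \<Rightarrow> 'a \<Rightarrow> complex"
  assumes scaleC_add_right: "c *\<^sub>C (x + y) = c *\<^sub>C x + c *\<^sub>C y"
    and scaleC_add_left: "(c + d) *\<^sub>C x = c *\<^sub>C x + d *\<^sub>C x"
    and scaleC_scaleC: "c *\<^sub>C d *\<^sub>C x = (c * d) *\<^sub>C x"
    and scaleR_scaleC: "r *\<^sub>R x = complex_of_real r *\<^sub>C x"
    and cinner_commute: "cinner x y = cnj (cinner y x)"
    and cinner_add_left: "cinner (x + y) z = cinner x z + cinner y z"
    and cinner_scaleC_left: "cinner (c *\<^sub>C x) y = c * cinner x y"
    and cinner_self: "cinner x x = complex_of_real ((norm x)\<^sup>2)"

class chilbert_space = complex_inner + complete_space

instantiation prod :: (complex_inner, complex_inner) complex_inner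
begin

definition scaleC_prod :: "complex \<Rightarrow> 'a \<times> 'b \<Rightarrow> 'a \<times> 'b" where
  "scaleC_prod c z = (c *\<^sub>C fst z, c *\<^sub>C snd z)"

definition cinner_prod :: "'a \<times> 'b \<Rightarrow> 'a \<times> 'b \<Rightarrow> complex" where
  "cinner_prod z w = cinner (fst z) (fst w) + cinner (snd z) (snd w)"

instance
proof
  fix c d :: complex and r :: real and x y z :: "'a \<times> 'b"
  show "c *\<^sub>C (x + y) = c *\<^sub>C x + c *\<^sub>C y"
    by (simp add: scaleC_prod_def scaleC_add_right)
  show "(c + d) *\<^sub>C x = c *\<^sub>C x + d *\<^sub>C x"
    by (simp add: scaleC_prod_def scaleC_add_left)
  show "c *\<^sub>C d *\<^sub>C x = (c * d) *\<^sub>C x"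
    by (simp add: scaleC_prod_def scaleC_scaleC)
  show "r *\<^sub>R x = complex_of_real r *\<^sub>C x"
    by (simp add: scaleC_prod_def scaleR_prod_def scaleR_scaleC)
  have "cinner (fst x) (fst y) = cnj (cinner (fst y) (fst x))"
    "cinner (snd x) (snd y) = cnj (cinner (snd y) (snd x))"
    by (rule cinner_commute)+
  then show "cinner x y = cnj (cinner y x)"
    by (simp add: cinner_prod_def)
  show "cinner (x + y) z = cinner x z + cinner y z"
    by (simp add: cinner_prod_def cinner_add_left)
  show "cinner (c *\<^sub>C x) y = c * cinner x y"
    by (simp add: cinner_prod_def scaleC_prod_def cinner_scaleC_left distrib_left)
  show "cinner x x = complex_of_real ((norm x)\<^sup>2)"
    by (simp add: cinner_prod_def cinner_self norm_prod_def)
qed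

end

instance prod :: (chilbert_space, chilbert_space) chilbert_space ..


section \<open>Bounded operators\<close>

definition bounded_clinear :: "('a::complex_inner \<Rightarrow> 'b::complex_inner) \<Rightarrow> bool" where
  "bounded_clinear T \<longleftrightarrow> bounded_linear T \<and> (\<forall>c x. T (c *\<^sub>C x) = c *\<^sub>C T x)"

definition cadjoint ::
    "('a::complex_inner \<Rightarrow> 'b::complex_inner) \<Rightarrow> 'b \<Rightarrow> 'a" where
  "cadjoint T = (THE S. \<forall>x y. cinner (T x) y = cinner x (S y))"

definition Re_op :: "('a::complex_inner \<Rightarrow> 'a) \<Rightarrow> 'a \<Rightarrow> 'a" where
  "Re_op T = (\<lambda>x. (1 / 2) *\<^sub>C (T x + cadjoint T x))"

definition op_ge ::
    "('a::complex_inner \<Rightarrow> 'a) \<Rightarrow> ('a \<Rightarrow> 'a) \<Rightarrow> bool" where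
  "op_ge T S \<longleftrightarrow> (\<forall>x. cinner (T x - S x) x \<in> \<real>\<^sub>\<ge>\<^sub>0)"


section \<open>Unbounded operators and semigroups\<close>

text \<open>
  An operator \<open>A : D \<subseteq> X \<rightarrow> Y\<close> is represented by its domain \<open>D\<close> together with a total function
  \<open>A\<close> whose values outside \<open>D\<close> are irrelevant. Thus restricting an operator means replacing
  the domain.
\<close>

definition clinear_on ::
    "'a::complex_inner set \<Rightarrow> ('a \<Rightarrow> 'b::complex_inner) \<Rightarrow> bool" where
  "clinear_on D A \<longleftrightarrow>
     0 \<in> D \<and> (\<forall>x\<in>D. \<forall>y\<in>D. x + y \<in> D) \<and> (\<forall>c. \<forall>x\<in>D. c *\<^sub>C x \<in> D) \<and>
     (\<forall>x\<in>D. \<forall>y\<in>D. A (x + y) = A x + A y) \<and> (\<forall>c. \<forall>x\<in>D. A (c *\<^sub>C x) = c *\<^sub>C A x)"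

definition graph_norm ::
    "('a::complex_inner \<Rightarrow> 'b::complex_inner) \<Rightarrow> 'a \<Rightarrow> real" where
  "graph_norm A x = sqrt ((norm x)\<^sup>2 + (norm (A x))\<^sup>2)"

definition Ker_on :: "'a set \<Rightarrow> ('a \<Rightarrow> 'b::zero) \<Rightarrow> 'a set" where
  "Ker_on D G = {x \<in> D. G x = 0}"

definition resolvent ::
    "'a::complex_inner set \<Rightarrow> ('a \<Rightarrow> 'a) \<Rightarrow> complex \<Rightarrow> 'a \<Rightarrow> 'a" where
  "resolvent D A z = inv_into D (\<lambda>x. z *\<^sub>C x - A x)"

definition resolvent_set ::
    "'a::complex_inner set \<Rightarrow> ('a \<Rightarrow> 'a) \<Rightarrow> complex set" where
  "resolvent_set D A =
     {z. bij_betw (\<lambda>x. z *\<^sub>C x - A x) D UNIV \<and> bounded_clinear (resolvent D A z)}"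

definition C0_semigroup :: "(real \<Rightarrow> 'a::complex_inner \<Rightarrow> 'a) \<Rightarrow> bool" where
  "C0_semigroup T \<longleftrightarrow>
     (\<forall>t\<ge>0. bounded_clinear (T t)) \<and> T 0 = id \<and>
     (\<forall>s\<ge>0. \<forall>t\<ge>0. T (s + t) = T s \<circ> T t) \<and>
     (\<forall>x. ((\<lambda>t. T t x) \<longlongrightarrow> x) (at_right 0))"

definition is_generator ::
    "(real \<Rightarrow> 'a::complex_inner \<Rightarrow> 'a) \<Rightarrow> 'a set \<Rightarrow> ('a \<Rightarrow> 'a) \<Rightarrow> bool" where
  "is_generator T D A \<longleftrightarrow>
     D = {x. \<exists>y. ((\<lambda>t. (T t x - x) /\<^sub>R t) \<longlongrightarrow> y) (at_right 0)} \<and>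
     (\<forall>x\<in>D. ((\<lambda>t. (T t x - x) /\<^sub>R t) \<longlongrightarrow> A x) (at_right 0))"

definition generates_C0_semigroup ::
    "'a::complex_inner set \<Rightarrow> ('a \<Rightarrow> 'a) \<Rightarrow> bool" where
  "generates_C0_semigroup D A \<longleftrightarrow> (\<exists>T. C0_semigroup T \<and> is_generator T D A)"

definition generates_contraction_semigroup ::
    "'a::complex_inner set \<Rightarrow> ('a \<Rightarrow> 'a) \<Rightarrow> bool" where
  "generates_contraction_semigroup D A \<longleftrightarrow>
     (\<exists>T. C0_semigroup T \<and> is_generator T D A \<and> (\<forall>t\<ge>0. onorm (T t) \<le> 1))"


section \<open>Boundary nodes\<close>

text \<open>
  The triple \<open>(G, L, K)\<close> with common domain \<open>D = D(L)\<close>; boundedness of \<open>G\<close>, \<open>K\<close> and of the right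
  inverse of \<open>G\<close> is with respect to the graph norm of \<open>L\<close> on \<open>D\<close>.
\<close>

definition boundary_node ::
    "'x::chilbert_space set \<Rightarrow> ('x \<Rightarrow> 'u::chilbert_space) \<Rightarrow> ('x \<Rightarrow> 'x) \<Rightarrow> ('x \<Rightarrow> 'u) \<Rightarrow> bool" where
  "boundary_node D G L K \<longleftrightarrow>
     clinear_on D L \<and> clinear_on D G \<and> clinear_on D K \<and>
     (\<exists>c. \<forall>x\<in>D. norm (G x) \<le> c * graph_norm L x) \<and>
     (\<exists>c. \<forall>x\<in>D. norm (K x) \<le> c * graph_norm L x) \<and>
     generates_C0_semigroup (Ker_on D G) L \<and>
     (\<exists>Gr. clinear_on UNIV Gr \<and> range Gr \<subseteq> D \<and>
        (\<exists>c. \<forall>u. graph_norm L (Gr u) \<le> c * norm u) \<and> (\<forall>u. G (Gr u) = u))"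

definition impedance_passive ::
    "'x::chilbert_space set \<Rightarrow> ('x \<Rightarrow> 'u::chilbert_space) \<Rightarrow> ('x \<Rightarrow> 'x) \<Rightarrow> ('x \<Rightarrow> 'u) \<Rightarrow> bool" where
  "impedance_passive D G L K \<longleftrightarrow>
     (\<forall>x\<in>D. Re (cinner (L x) x) \<le> Re (cinner (G x) (K x)))"

text \<open>
  The transfer functions are meaningful only for \<open>z\<close> in the resolvent set of the restriction of
  \<open>L\<close> to \<open>Ker_on D G\<close>, where the solution below exists and is unique.
\<close>

definition transfer_H ::
    "'x::chilbert_space set \<Rightarrow> ('x \<Rightarrow> 'u::chilbert_space) \<Rightarrow> ('x \<Rightarrow> 'x) \<Rightarrow> complex \<Rightarrow> 'u \<Rightarrow> 'x" where
  "transfer_H D G L z u = (THE x. x \<in> D \<and> z *\<^sub>C x - L x = 0 \<and> G x = u)"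

definition transfer_P ::
    "'x::chilbert_space set \<Rightarrow> ('x \<Rightarrow> 'u::chilbert_space) \<Rightarrow> ('x \<Rightarrow> 'x) \<Rightarrow> ('x \<Rightarrow> 'u) \<Rightarrow>
     complex \<Rightarrow> 'u \<Rightarrow> 'u" where
  "transfer_P D G L K z u = K (transfer_H D G L z u)"

end

theory Submission
  imports Defs
begin

text \<open>
  Let \<open>(is - A)(x\<^sub>1, x\<^sub>2) = (y\<^sub>1, y\<^sub>2)\<close> and \<open>u = G\<^sub>2 x\<^sub>2\<close>. Adding the feedback \<open>J\<^sup>*QJK\<^sub>1 x\<^sub>1\<close> to
  both sides of the first boundary condition gives
  \<open>G\<^sub>0 x\<^sub>1 = J\<^sup>*(K\<^sub>2 x\<^sub>2 - Q u)\<close>, so \<open>x\<^sub>1\<close> is controlled through \<open>H\<^sub>0\<close> and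
  \<open>(is - A\<^sub>0)\<^sup>-\<^sup>1\<close> once \<open>u\<close> is. Pairing \<open>y\<^sub>1\<close> with \<open>x\<^sub>1\<close>, passivity and the
  coercivity of \<open>P\<^sub>2(is)\<close> give
  \<open>\<eta> \<parallel>u\<parallel>\<^sup>2 \<le> \<parallel>x\<^sub>1\<parallel> \<parallel>y\<^sub>1\<parallel> + \<parallel>K\<^sub>2 (is - A\<^sub>2)\<^sup>-\<^sup>1 y\<^sub>2\<parallel> \<parallel>u\<parallel>\<close>. Passivity at \<open>1 + is\<close>
  bounds \<open>H\<^sub>2(1 + is)\<close> and \<open>K\<^sub>2 (1 + is - A\<^sub>2)\<^sup>-\<^sup>1\<close> by the square root of \<open>\<parallel>P\<^sub>2(1 + is)\<parallel>\<close>, and the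
  resolvent identity carries these bounds over to \<open>is\<close>, at the price of a factor \<open>M\<^sub>2\<close>.
  Solving the resulting quadratic inequality gives the resolvent bound.

  Generation is the Lumer--Phillips theorem: in the open right half-plane \<open>P\<^sub>1\<close> and \<open>P\<^sub>2\<close> are
  coercive, so the boundary coupling can be solved by the Lax--Milgram lemma. The semigroup itself is
  the limit of backward Euler steps of dyadic length. The points of \<open>iE\<close>, which lie on the
  boundary of the half-plane, are reached from the right using the a priori bound.
\<close>

section \<open>Complex Hilbert spaces\<close>

text \<open>Two obstacles shape the proof. Since \<open>J\<close> is arbitrary, the loop operator J
  P1 J^* in the boundary equation is in general only accretive. Coercivity must therefore come from
  the other factor \<open>P2\<close>, which is why solvability is stated for \<open>1 + S P\<close>
  with \<open>S\<close> accretive and \<open>P\<close> coercive. The same statement with S = J^*QJ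
  and \<open>P = P1\<close> yields a right inverse of \<open>G0\<close>, without which
  \<open>H0\<close> would have no meaning. The second obstacle is circularity: the bound for x1
  contains the norm of u, and the bound for the squared norm of u contains x1. The loop closes
  because x1 enters the latter only linearly, so that u is controlled by a square root and a small
  multiple of the norm of x1 can be absorbed. This absorption produces the squares of N0 and M2 and
  the factor 1/eta. The lower bound \<open>r\<close> supplies missing factors of N0 and M2, so that
  all remaining terms fit the single quantity alpha = N0 M2 p with p = 1 + norm of P2(1 + is). The
  constants depend only on \<open>r\<close> and the norms of \<open>cadjoint J\<close> and
  \<open>Q\<close>, hence not on s.\<close>

instance chilbert_space \<subseteq> banach ..

lemma scaleC_one [simp]: "1 *\<^sub>C x = (x :: 'a::complex_inner)"
  using scaleR_scaleC[of 1 x] by simp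

lemma scaleC_zero_left [simp]: "0 *\<^sub>C x = (0 :: 'a::complex_inner)"
  using scaleR_scaleC[of 0 x] by simp

lemma scaleC_zero_right [simp]: "c *\<^sub>C (0 :: 'a::complex_inner) = 0"
  using scaleC_add_right[of c "0::'a" 0] by simp

lemma scaleC_minus_right: "c *\<^sub>C (- x) = - (c *\<^sub>C (x :: 'a::complex_inner))"
  using scaleC_add_right[of c x "- x"] by (simp add: eq_neg_iff_add_eq_0 add.commute)

lemma scaleC_minus_left: "(- c) *\<^sub>C x = - (c *\<^sub>C (x :: 'a::complex_inner))"
  using scaleC_add_left[of c "- c" x] by (simp add: eq_neg_iff_add_eq_0 add.commute)

lemma scaleC_diff_right: "c *\<^sub>C (x - y) = c *\<^sub>C x - c *\<^sub>C (y :: 'a::complex_inner)"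
  using scaleC_add_right[of c x "- y"] by (simp add: scaleC_minus_right)

lemma scaleC_diff_left: "(c - d) *\<^sub>C x = c *\<^sub>C x - d *\<^sub>C (x :: 'a::complex_inner)"
  using scaleC_add_left[of c "- d" x] by (simp add: scaleC_minus_left)

lemma cinner_add_right: "cinner x (y + z) = cinner x y + cinner x z"
  by (metis cinner_commute cinner_add_left complex_cnj_add)

lemma cinner_scaleC_right: "cinner x (c *\<^sub>C y) = cnj c * cinner x y"
  by (metis cinner_commute cinner_scaleC_left complex_cnj_mult)

lemma cinner_zero_left [simp]: "cinner 0 y = 0"
  by (metis cinner_scaleC_left mult_zero_left scaleC_zero_left)

lemma cinner_zero_right [simp]: "cinner x 0 = 0"
  by (metis cinner_commute cinner_zero_left complex_cnj_zero)

lemma cinner_minus_left: "cinner (- x) y = - cinner x y"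
  using cinner_add_left[of x "- x" y] by (simp add: eq_neg_iff_add_eq_0 add.commute)

lemma cinner_minus_right: "cinner x (- y) = - cinner x y"
  using cinner_add_right[of x y "- y"] by (simp add: eq_neg_iff_add_eq_0 add.commute)

lemma cinner_diff_left: "cinner (x - y) z = cinner x z - cinner y z"
  using cinner_add_left[of x "- y" z] by (simp add: cinner_minus_left)

lemma cinner_diff_right: "cinner x (y - z) = cinner x y - cinner x z"
  using cinner_add_right[of x y "- z"] by (simp add: cinner_minus_right)

lemma cinner_scaleR_left: "cinner (r *\<^sub>R x) y = complex_of_real r * cinner x y"
  by (simp add: scaleR_scaleC cinner_scaleC_left)

lemma cinner_scaleR_right: "cinner x (r *\<^sub>R y) = complex_of_real r * cinner x y"
  by (simp add: scaleR_scaleC cinner_scaleC_right)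

lemma Re_cinner_self: "Re (cinner x x) = (norm x)\<^sup>2"
  by (simp add: cinner_self)

lemma Re_cinner_commute: "Re (cinner x y) = Re (cinner y x)"
  by (metis cinner_commute complex_cnj(1) complex.collapse complex.sel(1))

lemma norm_add_sq: "(norm (x + y))\<^sup>2 = (norm x)\<^sup>2 + 2 * Re (cinner x y) + (norm y)\<^sup>2"
proof -
  have "(norm (x + y))\<^sup>2 = Re (cinner (x + y) (x + y))"
    by (simp add: Re_cinner_self)
  also have "\<dots> = (norm x)\<^sup>2 + 2 * Re (cinner x y) + (norm y)\<^sup>2"
    unfolding cinner_add_left cinner_add_right
    by (simp add: Re_cinner_self Re_cinner_commute[of y x])
  finally show ?thesis .
qed

lemma norm_diff_sq: "(norm (x - y))\<^sup>2 = (norm x)\<^sup>2 - 2 * Re (cinner x y) + (norm y)\<^sup>2"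
  using norm_add_sq[of x "- y"] by (simp add: cinner_minus_right)

lemma norm_scaleC: "norm (c *\<^sub>C x) = cmod c * norm x"
proof -
  have "cinner (c *\<^sub>C x) (c *\<^sub>C x) = (c * cnj c) * cinner x x"
    by (simp add: cinner_scaleC_left cinner_scaleC_right)
  then have "complex_of_real ((norm (c *\<^sub>C x))\<^sup>2) = complex_of_real ((cmod c * norm x)\<^sup>2)"
    unfolding cinner_self by (simp add: complex_norm_square[symmetric] power_mult_distrib)
  then have "(norm (c *\<^sub>C x))\<^sup>2 = (cmod c * norm x)\<^sup>2"
    using of_real_eq_iff by blast
  then show ?thesis
    by (simp add: power2_eq_iff_nonneg)
qed

text \<open>Pythagoras for the projection of \<open>x\<close> onto the line through
  \<open>y\<close>. Nonnegativity of the left side is Cauchy-Schwarz; in the nearest-point argument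
  the formula measures how much closer a correction along \<open>y\<close> gets.\<close>

lemma norm_diff_projection_sq:
  assumes "y \<noteq> 0"
  shows "(norm (x - (cinner x y / complex_of_real ((norm y)\<^sup>2)) *\<^sub>C y))\<^sup>2
    = (norm x)\<^sup>2 - (cmod (cinner x y))\<^sup>2 / (norm y)\<^sup>2"
proof -
  define c where "c = cinner x y / complex_of_real ((norm y)\<^sup>2)"
  have "Re (cinner x (c *\<^sub>C y)) = (cmod (cinner x y))\<^sup>2 / (norm y)\<^sup>2"
  proof -
    have "cinner x (c *\<^sub>C y) = complex_of_real ((cmod (cinner x y))\<^sup>2 / (norm y)\<^sup>2)"
      unfolding cinner_scaleC_right c_def complex_cnj_divide complex_cnj_complex_of_real
        of_real_divide complex_norm_square
      by (simp add: mult.commute)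
    then show ?thesis by simp
  qed
  moreover have "(norm (c *\<^sub>C y))\<^sup>2 = (cmod (cinner x y))\<^sup>2 / (norm y)\<^sup>2"
    using assms by (simp add: norm_scaleC c_def norm_divide norm_mult power_mult_distrib power_divide
        power2_eq_square)
  ultimately show ?thesis
    unfolding c_def[symmetric] by (simp add: norm_diff_sq)
qed

lemma cinner_Cauchy_Schwarz: "cmod (cinner x y) \<le> norm x * norm y"
proof (cases "y = 0")
  case False
  have "0 \<le> (norm x)\<^sup>2 - (cmod (cinner x y))\<^sup>2 / (norm y)\<^sup>2"
    by (metis norm_diff_projection_sq[OF False] zero_le_power2)
  with False have "(cmod (cinner x y))\<^sup>2 \<le> (norm x * norm y)\<^sup>2"
    by (simp add: field_simps power_mult_distrib)
  then show ?thesis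
    by (rule power2_le_imp_le) simp
qed simp

lemma Re_cinner_le: "Re (cinner x y) \<le> norm x * norm y"
  using complex_Re_le_cmod cinner_Cauchy_Schwarz order_trans by blast

lemma bounded_bilinear_cinner: "bounded_bilinear (cinner :: 'a::complex_inner \<Rightarrow> 'a \<Rightarrow> complex)"
proof
  show "\<exists>K. \<forall>a b :: 'a. norm (cinner a b) \<le> norm a * norm b * K"
    using cinner_Cauchy_Schwarz by (intro exI[of _ 1]) auto
qed (auto simp: cinner_add_left cinner_add_right cinner_scaleR_left cinner_scaleR_right
      scaleR_conv_of_real)

lemma bounded_clinearI:
  fixes T :: "'a::complex_inner \<Rightarrow> 'b::complex_inner"
  assumes "\<And>x y. T (x + y) = T x + T y" and "\<And>c x. T (c *\<^sub>C x) = c *\<^sub>C T x"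
    and "\<And>x. norm (T x) \<le> b * norm x"
  shows "bounded_clinear T"
  unfolding bounded_clinear_def
proof
  show "bounded_linear T"
    by (rule bounded_linear_intro[of _ b])
      (use assms in \<open>auto simp: scaleR_scaleC mult.commute\<close>)
qed (use assms in auto)

lemma
  assumes "bounded_clinear T"
  shows bounded_clinear_bounded_linear: "bounded_linear T"
    and bounded_clinear_scaleC: "T (c *\<^sub>C x) = c *\<^sub>C T x"
    and bounded_clinear_add: "T (x + y) = T x + T y"
    and bounded_clinear_diff: "T (x - y) = T x - T y"
    and bounded_clinear_minus: "T (- x) = - T x"
    and bounded_clinear_0: "T 0 = 0"
    and bounded_clinear_onorm: "norm (T x) \<le> onorm T * norm x"
    and bounded_clinear_onorm_nonneg: "0 \<le> onorm T"
proof -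
  show bl: "bounded_linear T"
    using assms by (simp add: bounded_clinear_def)
  interpret bounded_linear T by fact
  show "T (x + y) = T x + T y" "T (x - y) = T x - T y" "T (- x) = - T x" "T 0 = 0"
    by (simp_all add: add diff neg zero)
  show "norm (T x) \<le> onorm T * norm x" "0 \<le> onorm T"
    using onorm[OF bl] onorm_pos_le[OF bl] by auto
  show "T (c *\<^sub>C x) = c *\<^sub>C T x"
    using assms by (simp add: bounded_clinear_def)
qed

lemma bounded_clinear_norm_le:
  assumes "bounded_clinear T" "onorm T \<le> b"
  shows "norm (T x) \<le> b * norm x"
  using bounded_clinear_onorm[OF assms(1), of x] mult_right_mono[OF assms(2), of "norm x"] by simp

lemma bounded_clinear_scaleC_id: "bounded_clinear (\<lambda>x. c *\<^sub>C x)"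
  by (rule bounded_clinearI[of _ "cmod c"])
    (simp_all add: scaleC_add_right scaleC_scaleC mult.commute norm_scaleC)

lemma bounded_clinear_compose:
  assumes S: "bounded_clinear S" and T: "bounded_clinear T"
  shows "bounded_clinear (\<lambda>x. S (T x))"
  using assms bounded_linear_compose[of S T] unfolding bounded_clinear_def by auto

lemma bounded_clinear_sum:
  assumes "bounded_clinear S" "bounded_clinear T"
  shows "bounded_clinear (\<lambda>x. S x + T x)"
  using assms bounded_linear_add[of S T] unfolding bounded_clinear_def
  by (auto simp: scaleC_add_right)

lemma bounded_clinear_id: "bounded_clinear (\<lambda>x. x)"
  by (rule bounded_clinearI[of _ 1]) auto

section \<open>Orthogonality, adjoints and coercive operators\<close>

definition csubspace :: "'a::complex_inner set \<Rightarrow> bool" where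
  "csubspace M \<longleftrightarrow> 0 \<in> M \<and> (\<forall>x\<in>M. \<forall>y\<in>M. x + y \<in> M) \<and> (\<forall>c. \<forall>x\<in>M. c *\<^sub>C x \<in> M)"

text \<open>The near-minimisers \<open>S n\<close> form a nested sequence of nonempty closed sets.
  Midpoints stay in \<open>M\<close>, so the parallelogram law bounds the squared diameter of
  \<open>S n\<close> by \<open>4 * q^2 - 4 * d^2\<close> with \<open>q = d + 1 / Suc n\<close>; this
  tends to 0, and completeness gives a common point.\<close>

lemma csubspace_nearest_point:
  fixes M :: "'a::chilbert_space set"
  assumes M: "csubspace M" and closed: "closed M"
  obtains m where "m \<in> M" "\<And>v. v \<in> M \<Longrightarrow> norm (x - m) \<le> norm (x - v)"
proof -
  define d where "d = infdist x M"
  have ne: "M \<noteq> {}"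
    using M by (auto simp: csubspace_def)
  have d0: "0 \<le> d"
    by (simp add: d_def infdist_nonneg)
  have dle: "d \<le> norm (x - v)" if "v \<in> M" for v
    using infdist_le[OF that, of x] by (simp add: d_def dist_norm)
  define S where "S n = {m \<in> M. norm (x - m) \<le> d + 1 / Suc n}" for n
  obtain m where m: "\<And>n. m \<in> S n"
  proof (rule decreasing_closed_nest[of S])
    show "closed (S n)" for n
    proof -
      have "closed {m. norm (x - m) \<le> d + 1 / Suc n}"
        by (intro closed_Collect_le continuous_intros)
      with closed show ?thesis
        by (auto simp: S_def Collect_conj_eq)
    qed
    show "S n \<noteq> {}" for n
    proof -
      have "infdist x M < d + 1 / Suc n"
        by (simp add: d_def)
      then obtain a where "a \<in> M" "dist x a < d + 1 / Suc n"
        using ne by (auto simp: infdist_notempty cINF_less_iff)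
      then show ?thesis
        by (auto simp: S_def dist_norm intro: less_imp_le)
    qed
    show "S n \<subseteq> S k" if "k \<le> n" for k n
    proof -
      have "1 / real (Suc n) \<le> 1 / Suc k"
        using that by (simp add: field_simps)
      then show ?thesis
        by (auto simp: S_def)
    qed
    show "\<exists>n. \<forall>a\<in>S n. \<forall>b\<in>S n. dist a b < e" if "e > 0" for e
    proof -
      have "(\<lambda>n. 4 * (d + 1 / real (Suc n))\<^sup>2 - 4 * d\<^sup>2) \<longlonglongrightarrow> 4 * (d + 0)\<^sup>2 - 4 * d\<^sup>2"
        by (intro tendsto_intros LIMSEQ_inverse_real_of_nat[unfolded inverse_eq_divide])
      moreover have "4 * (d + 0)\<^sup>2 - 4 * d\<^sup>2 < e\<^sup>2"
        using that by simp
      ultimately have "\<forall>\<^sub>F n in sequentially. 4 * (d + 1 / real (Suc n))\<^sup>2 - 4 * d\<^sup>2 < e\<^sup>2"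
        by (rule order_tendstoD)
      then obtain n where n: "4 * (d + 1 / real (Suc n))\<^sup>2 - 4 * d\<^sup>2 < e\<^sup>2"
        by (auto simp: eventually_sequentially)
      have "dist a b < e" if a: "a \<in> S n" and b: "b \<in> S n" for a b
      proof -
        define q where "q = d + 1 / real (Suc n)"
        have "(1/2) *\<^sub>R (a + b) \<in> M"
          using M a b by (auto simp: csubspace_def S_def scaleR_scaleC)
        then have "d \<le> norm (x - (1/2) *\<^sub>R (a + b))"
          by (rule dle)
        then have "2 * d \<le> 2 * norm (x - (1/2) *\<^sub>R (a + b))"
          by simp
        also have "\<dots> = norm (2 *\<^sub>R (x - (1/2) *\<^sub>R (a + b)))"
          by simp
        also have "2 *\<^sub>R (x - (1/2) *\<^sub>R (a + b)) = (x - a) + (x - b)"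
          by (simp add: algebra_simps scaleR_2)
        finally have "(2 * d)\<^sup>2 \<le> (norm ((x - a) + (x - b)))\<^sup>2"
          using d0 by (intro power_mono) auto
        moreover have "(norm (x - a))\<^sup>2 \<le> q\<^sup>2" "(norm (x - b))\<^sup>2 \<le> q\<^sup>2"
          using a b by (auto simp: S_def q_def intro!: power_mono)
        moreover have "(norm ((x - b) - (x - a)))\<^sup>2 = 2 * (norm (x - a))\<^sup>2 + 2 * (norm (x - b))\<^sup>2
            - (norm ((x - a) + (x - b)))\<^sup>2"
          using norm_diff_sq[of "x - b" "x - a"] norm_add_sq[of "x - a" "x - b"]
            Re_cinner_commute[of "x - a" "x - b"] by simp
        ultimately have "(norm ((x - b) - (x - a)))\<^sup>2 \<le> 4 * q\<^sup>2 - 4 * d\<^sup>2"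
          by (simp add: power_mult_distrib)
        with n have "(norm (a - b))\<^sup>2 < e\<^sup>2"
          by (simp add: q_def)
        then show "dist a b < e"
          using \<open>e > 0\<close> by (simp add: dist_norm power_less_imp_less_base)
      qed
      then show ?thesis by blast
    qed
  qed blast
  have "norm (x - m) \<le> d"
  proof (rule LIMSEQ_le_const)
    show "(\<lambda>n. d + 1 / real (Suc n)) \<longlonglongrightarrow> d"
      using tendsto_add[OF tendsto_const[of d]
          LIMSEQ_inverse_real_of_nat[unfolded inverse_eq_divide]] by simp
    show "\<exists>N. \<forall>n\<ge>N. norm (x - m) \<le> d + 1 / real (Suc n)"
      using m by (auto simp: S_def)
  qed
  with m[of 0] dle show thesis
    by (intro that[of m]) (auto simp: S_def intro: order_trans)
qed

text \<open>The residual \<open>x - m\<close> at a nearest point is orthogonal to \<open>M\<close>: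
  a nonzero inner product with some \<open>v\<close> would allow a multiple of \<open>v\<close> to
  be added to \<open>m\<close> that comes closer to \<open>x\<close>.\<close>

lemma csubspace_orthogonal_vector:
  fixes M :: "'a::chilbert_space set"
  assumes M: "csubspace M" and closed: "closed M" and ne: "M \<noteq> UNIV"
  obtains z where "z \<noteq> 0" "\<And>m. m \<in> M \<Longrightarrow> cinner m z = 0"
proof -
  obtain x where x: "x \<notin> M"
    using ne by auto
  obtain m where m: "m \<in> M" "\<And>v. v \<in> M \<Longrightarrow> norm (x - m) \<le> norm (x - v)"
    using csubspace_nearest_point[OF M closed, where x = x] by blast
  have "cinner v (x - m) = 0" if v: "v \<in> M" for v
  proof (cases "v = 0")
    case False
    define c where "c = cinner (x - m) v / complex_of_real ((norm v)\<^sup>2)"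
    have "m + c *\<^sub>C v \<in> M"
      using M m(1) v by (simp add: csubspace_def)
    from m(2)[OF this] have "(norm (x - m))\<^sup>2 \<le> (norm (x - m - c *\<^sub>C v))\<^sup>2"
      by (intro power_mono) (simp_all add: algebra_simps)
    also have "\<dots> = (norm (x - m))\<^sup>2 - (cmod (cinner (x - m) v))\<^sup>2 / (norm v)\<^sup>2"
      unfolding c_def by (rule norm_diff_projection_sq[OF False])
    finally have "(cmod (cinner (x - m) v))\<^sup>2 / (norm v)\<^sup>2 \<le> 0"
      by simp
    with False have "cinner (x - m) v = 0"
      by (simp add: divide_le_0_iff)
    then show ?thesis
      by (metis cinner_commute complex_cnj_zero)
  qed simp
  with x m(1) show thesis
    by (intro that[of "x - m"]) auto
qed

lemma Riesz_representation:
  fixes f :: "'a::chilbert_space \<Rightarrow> complex"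
  assumes f: "bounded_linear f" and fc: "\<And>c x. f (c *\<^sub>C x) = c * f x"
  obtains y where "\<And>x. f x = cinner x y"
proof (cases "\<forall>x. f x = 0")
  case True
  then show thesis by (intro that[of 0]) simp
next
  case False
  interpret f: bounded_linear f by fact
  have "csubspace (f -` {0})"
    by (auto simp: csubspace_def f.zero f.add fc)
  moreover have "closed (f -` {0})"
    by (intro closed_vimage linear_continuous_on f closed_singleton)
  moreover have "f -` {0} \<noteq> UNIV"
    using False by auto
  ultimately obtain z where z: "z \<noteq> 0" "\<And>m. m \<in> f -` {0} \<Longrightarrow> cinner m z = 0"
    by (rule csubspace_orthogonal_vector) blast
  show thesis
  proof (rule that)
    fix x
    \<comment> \<open>For every \<open>x\<close> this combination lies in the kernel of
      \<open>f\<close>, hence is orthogonal to \<open>z\<close>; solving the orthogonality relation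
      for \<open>f x\<close> gives the representing vector.\<close>
    have "f (f z *\<^sub>C x - f x *\<^sub>C z) = 0"
      by (simp add: f.diff fc)
    then have "cinner (f z *\<^sub>C x - f x *\<^sub>C z) z = 0"
      by (intro z) simp
    then have "f z * cinner x z = f x * complex_of_real ((norm z)\<^sup>2)"
      by (simp add: cinner_diff_left cinner_scaleC_left cinner_self)
    with z(1) show "f x = cinner x (cnj (f z / complex_of_real ((norm z)\<^sup>2)) *\<^sub>C z)"
      by (simp add: cinner_scaleC_right field_simps)
  qed
qed

lemma cinner_ext:
  assumes "\<And>x. cinner x y = cinner x z"
  shows "y = z"
proof -
  have "cinner (y - z) (y - z) = 0"
    using assms by (simp add: cinner_diff_right)
  then have "(norm (y - z))\<^sup>2 = 0"
    by (metis Re_cinner_self zero_complex.sel(1))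
  then show ?thesis by simp
qed

text \<open>The description in \<open>cadjoint\<close> is meaningful because Riesz gives a
  representing vector for each \<open>y\<close>, and nondegeneracy of the inner product makes the
  resulting map unique.\<close>

lemma cinner_cadjoint:
  fixes T :: "'a::chilbert_space \<Rightarrow> 'b::complex_inner"
  assumes T: "bounded_clinear T"
  shows "cinner (T x) y = cinner x (cadjoint T y)"
proof -
  have "\<exists>z. \<forall>x. cinner (T x) y = cinner x z" for y
  proof -
    have "bounded_linear (\<lambda>x. cinner (T x) y)"
      using bounded_bilinear.bounded_linear_left[OF bounded_bilinear_cinner]
        bounded_clinear_bounded_linear[OF T] by (rule bounded_linear_compose)
    then obtain z where "\<And>x. cinner (T x) y = cinner x z"
      by (rule Riesz_representation)
        (simp_all add: bounded_clinear_scaleC[OF T] cinner_scaleC_left)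
    then show ?thesis by blast
  qed
  then obtain S where S: "\<And>x y. cinner (T x) y = cinner x (S y)"
    by metis
  have "cadjoint T = S"
    unfolding cadjoint_def
  proof (rule the_equality)
    show "\<forall>x y. cinner (T x) y = cinner x (S y)"
      using S by blast
    show "S' = S" if "\<forall>x y. cinner (T x) y = cinner x (S' y)" for S'
      using that S by (intro ext cinner_ext) metis
  qed
  with S show ?thesis by simp
qed

lemma bounded_clinear_cadjoint:
  fixes T :: "'a::chilbert_space \<Rightarrow> 'b::complex_inner"
  assumes T: "bounded_clinear T"
  shows "bounded_clinear (cadjoint T)"
proof (rule bounded_clinearI)
  note adj = cinner_cadjoint[OF T, symmetric]
  show "cadjoint T (x + y) = cadjoint T x + cadjoint T y" for x y
    by (rule cinner_ext) (simp add: adj cinner_add_right)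
  show "cadjoint T (c *\<^sub>C x) = c *\<^sub>C cadjoint T x" for c x
    by (rule cinner_ext) (simp add: adj cinner_scaleC_right)
  show "norm (cadjoint T y) \<le> onorm T * norm y" for y
  proof -
    have "(norm (cadjoint T y))\<^sup>2 = Re (cinner (T (cadjoint T y)) y)"
      by (simp add: adj[symmetric] Re_cinner_self)
    also have "\<dots> \<le> norm (T (cadjoint T y)) * norm y"
      by (rule Re_cinner_le)
    also have "\<dots> \<le> onorm T * norm (cadjoint T y) * norm y"
      by (intro mult_right_mono bounded_clinear_onorm T) simp
    finally have "norm (cadjoint T y) * norm (cadjoint T y) \<le> norm (cadjoint T y) * (onorm T * norm y)"
      by (simp add: power2_eq_square mult_ac)
    then show ?thesis
      using bounded_clinear_onorm_nonneg[OF T]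
      by (cases "cadjoint T y = 0") simp_all
  qed
qed

section \<open>Lax-Milgram and the abstract coupling equation\<close>

lemma coercive_surj:
  fixes T :: "'a::chilbert_space \<Rightarrow> 'a"
  assumes T: "bounded_clinear T" and \<delta>: "\<delta> > 0"
    and coercive: "\<And>x. \<delta> * (norm x)\<^sup>2 \<le> Re (cinner (T x) x)"
  shows "\<exists>x. T x = y"
proof -
  \<comment> \<open>The maximum with \<open>\<delta>\<close> keeps \<open>b\<close> positive and
    ensures \<open>\<delta> \<le> b\<close>, so that the square root defining \<open>c\<close> has a
    nonnegative argument.\<close>
  define b where "b = max \<delta> (onorm T)"
  have b: "b > 0" "\<delta> \<le> b"
    using \<delta> by (auto simp: b_def)
  define t where "t = \<delta> / b\<^sup>2"
  have t: "t > 0"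
    using \<delta> b by (simp add: t_def)
  \<comment> \<open>\<open>x \<mapsto> x - t (T x - y)\<close> is a contraction: its squared Lipschitz constant is
    \<open>1 - 2 t \<delta> + t\<^sup>2 b\<^sup>2\<close>, minimal at this \<open>t\<close>.\<close>
  define c where "c = sqrt (1 - \<delta>\<^sup>2 / b\<^sup>2)"
  have q: "0 \<le> 1 - \<delta>\<^sup>2 / b\<^sup>2" "1 - \<delta>\<^sup>2 / b\<^sup>2 < 1"
    using \<delta> b by (simp_all add: power_mono)
  have "norm (x - t *\<^sub>R T x) \<le> c * norm x" for x
  proof -
    have "(norm (T x))\<^sup>2 \<le> (b * norm x)\<^sup>2"
    proof (rule power_mono)
      have "norm (T x) \<le> onorm T * norm x"
        by (rule bounded_clinear_onorm[OF T])
      also have "\<dots> \<le> b * norm x"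
        by (intro mult_right_mono) (auto simp: b_def)
      finally show "norm (T x) \<le> b * norm x" .
    qed simp
    then have "t\<^sup>2 * (norm (T x))\<^sup>2 \<le> t\<^sup>2 * (b * norm x)\<^sup>2"
      by (rule mult_left_mono) simp
    moreover have "2 * t * (\<delta> * (norm x)\<^sup>2) \<le> 2 * t * Re (cinner (T x) x)"
      using coercive t by (intro mult_left_mono) auto
    moreover have "(norm (x - t *\<^sub>R T x))\<^sup>2
        = (norm x)\<^sup>2 - 2 * t * Re (cinner (T x) x) + t\<^sup>2 * (norm (T x))\<^sup>2"
      by (simp add: norm_diff_sq cinner_scaleR_right Re_cinner_commute[of x] power_mult_distrib)
    ultimately have "(norm (x - t *\<^sub>R T x))\<^sup>2
        \<le> (norm x)\<^sup>2 - 2 * t * (\<delta> * (norm x)\<^sup>2) + t\<^sup>2 * (b * norm x)\<^sup>2"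
      by linarith
    also have "\<dots> = (1 - \<delta>\<^sup>2 / b\<^sup>2) * (norm x)\<^sup>2"
      using b(1) by (simp add: t_def field_simps power2_eq_square)
    also have "\<dots> = (c * norm x)\<^sup>2"
      using q by (simp add: c_def power_mult_distrib)
    finally show ?thesis
      by (rule power2_le_imp_le) (use q in \<open>simp add: c_def\<close>)
  qed
  moreover have "(x - t *\<^sub>R (T x - y)) - (z - t *\<^sub>R (T z - y)) = (x - z) - t *\<^sub>R T (x - z)" for x z
    by (simp add: bounded_clinear_diff[OF T] algebra_simps)
  ultimately have "\<forall>x z. dist (x - t *\<^sub>R (T x - y)) (z - t *\<^sub>R (T z - y)) \<le> c * dist x z"
    unfolding dist_norm by metis
  then have "\<exists>!x. x - t *\<^sub>R (T x - y) = x"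
    by (intro banach_fix_type[of c]) (use q in \<open>simp_all add: c_def\<close>)
  with t show ?thesis by auto
qed

lemma coercive_lower_bound:
  assumes "\<delta> * (norm x)\<^sup>2 \<le> Re (cinner y x)"
  shows "\<delta> * norm x \<le> norm y"
proof (cases "x = 0")
  case False
  have "\<delta> * norm x * norm x \<le> norm y * norm x"
    using assms Re_cinner_le[of y x] by (simp add: power2_eq_square)
  then show ?thesis using False by simp
qed simp

text \<open>Substituting \<open>v = P w\<close> turns \<open>w + S (P w) = f\<close> into the coercive equation
  \<open>P\<^sup>-\<^sup>1 v + S v = f\<close>.\<close>

lemma id_plus_accretive_coercive_inverse:
  fixes S P :: "'a::chilbert_space \<Rightarrow> 'a"
  assumes S: "bounded_clinear S" and accretive: "\<And>x. 0 \<le> Re (cinner (S x) x)"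
    and P: "bounded_clinear P" and \<delta>: "\<delta> > 0"
    and coercive: "\<And>x. \<delta> * (norm x)\<^sup>2 \<le> Re (cinner (P x) x)"
  obtains W where "bounded_clinear W" "\<And>f. W f + S (P (W f)) = f"
proof -
  note P_lower = coercive_lower_bound[OF coercive]
  have P_inj: "x = y" if "P x = P y" for x y
  proof -
    have "\<delta> * norm (x - y) \<le> norm (P (x - y))"
      by (rule P_lower)
    with that \<delta> show ?thesis
      by (simp add: bounded_clinear_diff[OF P] mult_le_0_iff)
  qed
  have "\<exists>R. \<forall>y. P (R y) = y"
    using coercive_surj[OF P \<delta> coercive] by metis
  then obtain R where R: "\<And>y. P (R y) = y" by blast
  have R_bdd: "bounded_clinear R"
  proof (rule bounded_clinearI)
    show "R (x + y) = R x + R y" for x y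
      by (rule P_inj) (simp add: R bounded_clinear_add[OF P])
    show "R (c *\<^sub>C x) = c *\<^sub>C R x" for c x
      by (rule P_inj) (simp add: R bounded_clinear_scaleC[OF P])
    show "norm (R x) \<le> (1 / \<delta>) * norm x" for x
      using P_lower[of "R x"] \<delta> by (simp add: R field_simps)
  qed
  define p where "p = max 1 (onorm P)"
  have p: "p > 0" by (simp add: p_def)
  \<comment> \<open>From \<open>v = P (R v)\<close> follows
    \<open>norm v \<le> p * norm (R v)\<close>, so coercivity of \<open>P\<close> at
    \<open>R v\<close> becomes coercivity of the inverse \<open>R\<close> with this
    constant.\<close>
  define \<epsilon> where "\<epsilon> = \<delta> / p\<^sup>2"
  have \<epsilon>: "\<epsilon> > 0" using \<delta> p by (simp add: \<epsilon>_def)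
  have RS: "bounded_clinear (\<lambda>v. R v + S v)"
    using R_bdd S by (rule bounded_clinear_sum)
  have RS_coercive: "\<epsilon> * (norm v)\<^sup>2 \<le> Re (cinner (R v + S v) v)" for v
  proof -
    have "norm v \<le> p * norm (R v)"
      using bounded_clinear_onorm[OF P, of "R v"]
        mult_right_mono[of "onorm P" p "norm (R v)"] by (simp add: R p_def)
    then have "\<epsilon> * (norm v)\<^sup>2 \<le> \<epsilon> * (p * norm (R v))\<^sup>2"
      using \<epsilon> by (intro mult_left_mono power_mono) auto
    also have "\<dots> = \<delta> * (norm (R v))\<^sup>2"
      using p by (simp add: \<epsilon>_def power_mult_distrib)
    also have "\<dots> \<le> Re (cinner (P (R v)) (R v))"
      by (rule coercive)
    also have "\<dots> = Re (cinner (R v) v)"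
      by (simp add: R Re_cinner_commute)
    finally show ?thesis
      using accretive[of v] by (simp add: cinner_add_left)
  qed
  note RS_lower = coercive_lower_bound[OF RS_coercive]
  have RS_inj: "x = y" if "R x + S x = R y + S y" for x y
  proof -
    have "\<epsilon> * norm (x - y) \<le> norm (R (x - y) + S (x - y))"
      by (rule RS_lower)
    also have "R (x - y) + S (x - y) = 0"
      using that by (simp add: bounded_clinear_diff[OF R_bdd] bounded_clinear_diff[OF S] algebra_simps)
    finally show ?thesis
      using \<epsilon> by (simp add: mult_le_0_iff)
  qed
  have "\<exists>V. \<forall>y. R (V y) + S (V y) = y"
    using coercive_surj[OF RS \<epsilon> RS_coercive] by metis
  then obtain V where V: "\<And>y. R (V y) + S (V y) = y" by blast
  have V_bdd: "bounded_clinear V"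
  proof (rule bounded_clinearI)
    show "V (x + y) = V x + V y" for x y
    proof (rule RS_inj)
      have "R (V x + V y) + S (V x + V y) = (R (V x) + S (V x)) + (R (V y) + S (V y))"
        by (simp add: bounded_clinear_add[OF R_bdd] bounded_clinear_add[OF S])
      then show "R (V (x + y)) + S (V (x + y)) = R (V x + V y) + S (V x + V y)"
        by (simp add: V)
    qed
    show "V (c *\<^sub>C x) = c *\<^sub>C V x" for c x
      by (rule RS_inj) (simp add: V bounded_clinear_scaleC[OF R_bdd]
          bounded_clinear_scaleC[OF S] scaleC_add_right[symmetric])
    show "norm (V x) \<le> (1 / \<epsilon>) * norm x" for x
      using RS_lower[of "V x"] \<epsilon> by (simp add: V field_simps)
  qed
  show thesis
  proof (rule that)
    show "bounded_clinear (\<lambda>f. R (V f))"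
      using R_bdd V_bdd by (rule bounded_clinear_compose)
    show "R (V f) + S (P (R (V f))) = f" for f
      by (simp add: R V)
  qed
qed

section \<open>Resolvents of dissipative operators\<close>

lemma
  assumes "clinear_on D A"
  shows clinear_on_zero_mem: "0 \<in> D"
    and clinear_on_add_mem: "x \<in> D \<Longrightarrow> y \<in> D \<Longrightarrow> x + y \<in> D"
    and clinear_on_scaleC_mem: "x \<in> D \<Longrightarrow> c *\<^sub>C x \<in> D"
    and clinear_on_add: "x \<in> D \<Longrightarrow> y \<in> D \<Longrightarrow> A (x + y) = A x + A y"
    and clinear_on_scaleC: "x \<in> D \<Longrightarrow> A (c *\<^sub>C x) = c *\<^sub>C A x"
  using assms by (auto simp: clinear_on_def)

lemma
  assumes A: "clinear_on D A"
  shows clinear_on_diff_mem: "x \<in> D \<Longrightarrow> y \<in> D \<Longrightarrow> x - y \<in> D"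
    and clinear_on_diff: "x \<in> D \<Longrightarrow> y \<in> D \<Longrightarrow> A (x - y) = A x - A y"
    and clinear_on_zero: "A 0 = 0"
proof -
  have m: "- x \<in> D \<and> A (- x) = - A x" if "x \<in> D" for x
    using clinear_on_scaleC_mem[OF A that, of "-1"] clinear_on_scaleC[OF A that, of "-1"]
    by (simp add: scaleC_minus_left)
  then show "x \<in> D \<Longrightarrow> y \<in> D \<Longrightarrow> x - y \<in> D" "x \<in> D \<Longrightarrow> y \<in> D \<Longrightarrow> A (x - y) = A x - A y"
    using clinear_on_add_mem[OF A, of x "- y"] clinear_on_add[OF A, of x "- y"] m[of y] by auto
  show "A 0 = 0"
    using clinear_on_scaleC[OF A clinear_on_zero_mem[OF A], of 0] by simp
qed

lemma clinear_on_csubspace: "clinear_on D A \<Longrightarrow> csubspace D"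
  by (simp add: clinear_on_def csubspace_def)

lemma
  assumes "z \<in> resolvent_set D A"
  shows resolvent_mem: "resolvent D A z y \<in> D"
    and resolvent_right_inverse: "z *\<^sub>C resolvent D A z y - A (resolvent D A z y) = y"
    and resolvent_eqI: "x \<in> D \<Longrightarrow> z *\<^sub>C x - A x = y \<Longrightarrow> resolvent D A z y = x"
    and resolvent_bounded_clinear: "bounded_clinear (resolvent D A z)"
proof -
  have bij: "bij_betw (\<lambda>x. z *\<^sub>C x - A x) D UNIV"
    using assms by (simp add: resolvent_set_def)
  then have im: "(\<lambda>x. z *\<^sub>C x - A x) ` D = UNIV" and inj: "inj_on (\<lambda>x. z *\<^sub>C x - A x) D"
    by (auto simp: bij_betw_def)
  show "resolvent D A z y \<in> D"
    unfolding resolvent_def by (rule inv_into_into) (simp add: im)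
  show "z *\<^sub>C resolvent D A z y - A (resolvent D A z y) = y"
    unfolding resolvent_def using f_inv_into_f[of y "\<lambda>x. z *\<^sub>C x - A x" D] im by simp
  show "x \<in> D \<Longrightarrow> z *\<^sub>C x - A x = y \<Longrightarrow> resolvent D A z y = x"
    unfolding resolvent_def using inv_into_f_f[OF inj, of x] by simp
  show "bounded_clinear (resolvent D A z)"
    using assms by (simp add: resolvent_set_def)
qed

lemma
  assumes A: "clinear_on D A"
    and surj: "\<And>y. \<exists>x\<in>D. z *\<^sub>C x - A x = y"
    and lower: "\<And>x. x \<in> D \<Longrightarrow> norm x \<le> c * norm (z *\<^sub>C x - A x)"
  shows resolvent_setI: "z \<in> resolvent_set D A"
    and resolvent_norm_le: "norm (resolvent D A z y) \<le> c * norm y"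
proof -
  let ?f = "\<lambda>x. z *\<^sub>C x - A x" and ?R = "resolvent D A z"
  have f_add: "?f (x + y) = ?f x + ?f y" if "x \<in> D" "y \<in> D" for x y
    using that by (simp add: clinear_on_add[OF A] scaleC_add_right)
  have f_scale: "?f (k *\<^sub>C x) = k *\<^sub>C ?f x" if "x \<in> D" for x k
    using that by (simp add: clinear_on_scaleC[OF A] scaleC_diff_right scaleC_scaleC mult.commute)
  have inj: "inj_on ?f D"
  proof (rule inj_onI)
    fix x y assume xy: "x \<in> D" "y \<in> D" and eq: "?f x = ?f y"
    have "?f (x - y) = ?f x - ?f y"
      using xy by (simp add: clinear_on_diff[OF A] scaleC_diff_right)
    with eq lower[OF clinear_on_diff_mem[OF A xy]] show "x = y"
      by simp
  qed
  have im: "?f ` D = UNIV"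
    using surj by (auto simp: image_iff) metis
  have R: "?R y \<in> D" "?f (?R y) = y" for y
    unfolding resolvent_def
    using inv_into_into[of y ?f D] f_inv_into_f[of y ?f D] im by auto
  show *: "norm (?R y) \<le> c * norm y" for y
    using lower[OF R(1)[of y]] by (simp add: R)
  have "bounded_clinear ?R"
  proof (rule bounded_clinearI[OF _ _ *])
    show "?R (x + y) = ?R x + ?R y" for x y
      by (rule inj_onD[OF inj]) (simp_all only: f_add R clinear_on_add_mem[OF A])
    show "?R (k *\<^sub>C x) = k *\<^sub>C ?R x" for k x
      by (rule inj_onD[OF inj]) (simp_all only: f_scale R clinear_on_scaleC_mem[OF A])
  qed
  then show "z \<in> resolvent_set D A"
    using inj im by (simp add: resolvent_set_def bij_betw_def)
qed

text \<open>The equation for \<open>w\<close> is the fixed-point equation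
  \<open>x = R (y - (w - z) x)\<close>, a contraction when \<open>w\<close> is close to
  \<open>z\<close>. Surjectivity is all that is extracted; in each use a lower bound at
  \<open>w\<close> supplies injectivity and boundedness.\<close>

lemma resolvent_perturbation_surj:
  fixes A :: "'a::chilbert_space \<Rightarrow> 'a"
  assumes z: "z \<in> resolvent_set D A"
    and bound: "\<And>y. norm (resolvent D A z y) \<le> c * norm y"
    and c: "0 \<le> c" and near: "cmod (w - z) * c < 1"
  shows "\<exists>x\<in>D. w *\<^sub>C x - A x = y"
proof -
  let ?R = "resolvent D A z"
  let ?g = "\<lambda>x. ?R (y - (w - z) *\<^sub>C x)"
  have "dist (?g x) (?g x') \<le> (cmod (w - z) * c) * dist x x'" for x x'
  proof -
    have "?g x - ?g x' = ?R ((w - z) *\<^sub>C (x' - x))"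
      by (simp add: bounded_clinear_diff[OF resolvent_bounded_clinear[OF z], symmetric]
          scaleC_diff_right)
    then have "dist (?g x) (?g x') \<le> c * norm ((w - z) *\<^sub>C (x' - x))"
      using bound by (simp add: dist_norm)
    then show ?thesis
      by (simp add: norm_scaleC dist_norm norm_minus_commute mult_ac)
  qed
  then have "\<exists>!x. ?g x = x"
    by (intro banach_fix_type[of "cmod (w - z) * c"]) (use near c in auto)
  then obtain x where x: "?g x = x" by blast
  have "x \<in> D"
    using resolvent_mem[OF z] x by metis
  moreover have "z *\<^sub>C x - A x = y - (w - z) *\<^sub>C x"
    using resolvent_right_inverse[OF z, of "y - (w - z) *\<^sub>C x"] x by simp
  then have "w *\<^sub>C x - A x = y"
    by (simp add: scaleC_diff_left algebra_simps)
  ultimately show ?thesis by blast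
qed

section \<open>Lower bounds, the right half-plane and its boundary\<close>

definition dissipative :: "'a::complex_inner set \<Rightarrow> ('a \<Rightarrow> 'a) \<Rightarrow> bool" where
  "dissipative D A \<longleftrightarrow> (\<forall>x\<in>D. Re (cinner (A x) x) \<le> 0)"

lemma dissipative_lower_bound:
  assumes "dissipative D A" "x \<in> D"
  shows "Re z * norm x \<le> norm (z *\<^sub>C x - A x)"
proof (rule coercive_lower_bound)
  have "Re (cinner (A x) x) \<le> 0"
    using assms by (simp add: dissipative_def)
  then show "Re z * (norm x)\<^sup>2 \<le> Re (cinner (z *\<^sub>C x - A x) x)"
    by (simp add: cinner_diff_left cinner_scaleC_left cinner_self)
qed

lemma
  assumes A: "clinear_on D A" and diss: "dissipative D A" and z: "Re z > 0"
    and surj: "\<And>y. \<exists>x\<in>D. z *\<^sub>C x - A x = y"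
  shows dissipative_resolvent_setI: "z \<in> resolvent_set D A"
    and dissipative_resolvent_norm_le: "norm (resolvent D A z y) \<le> 1 / Re z * norm y"
proof -
  have lower: "norm x \<le> 1 / Re z * norm (z *\<^sub>C x - A x)" if "x \<in> D" for x
    using dissipative_lower_bound[OF diss that, of z] z by (simp add: field_simps)
  show "z \<in> resolvent_set D A"
    using A surj lower by (rule resolvent_setI)
  show "norm (resolvent D A z y) \<le> 1 / Re z * norm y"
    using A surj lower by (rule resolvent_norm_le)
qed

text \<open>The hypothesis speaks of large real \<open>l\<close> because that is what a truncated
  Laplace transform provides for a semigroup. The resolvent bound \<open>1 / l\<close> at such a
  point gives a perturbation disc of radius \<open>l\<close>, touching the imaginary axis, so a
  single step reaches \<open>z\<close>.\<close>

lemma dissipative_right_half_plane: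
  fixes A :: "'a::chilbert_space \<Rightarrow> 'a"
  assumes A: "clinear_on D A" and diss: "dissipative D A" and z: "Re z > 0"
    and surj: "\<And>l y. l \<ge> l0 \<Longrightarrow> \<exists>x\<in>D. complex_of_real l *\<^sub>C x - A x = y"
  shows "z \<in> resolvent_set D A"
proof -
  \<comment> \<open>The discs \<open>\<bar>z - l\<bar> < l\<close> around real points \<open>l\<close> exhaust the right half-plane.\<close>
  define l where "l = max 1 (max l0 ((cmod z)\<^sup>2 / Re z))"
  have l: "l \<ge> l0" "l > 0" "(cmod z)\<^sup>2 / Re z \<le> l"
    by (auto simp: l_def)
  have "(cmod z)\<^sup>2 < 2 * l * Re z"
  proof -
    have "(cmod z)\<^sup>2 \<le> l * Re z"
      using l(3) z by (simp add: field_simps)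
    also have "\<dots> < 2 * l * Re z"
      using l(2) z by simp
    finally show ?thesis .
  qed
  then have "(cmod (z - complex_of_real l))\<^sup>2 < l\<^sup>2"
    by (simp add: cmod_power2 power2_diff algebra_simps)
  then have near: "cmod (z - complex_of_real l) < l"
    using l(2) by (simp add: power_less_imp_less_base)
  have Rel: "Re (complex_of_real l) > 0"
    using l by simp
  note surj_l = surj[OF l(1)]
  show ?thesis
  proof (rule dissipative_resolvent_setI[OF A diss z])
    show "\<exists>x\<in>D. z *\<^sub>C x - A x = y" for y
    proof (rule resolvent_perturbation_surj)
      show "complex_of_real l \<in> resolvent_set D A"
        by (rule dissipative_resolvent_setI[OF A diss Rel surj_l])
      show "norm (resolvent D A (complex_of_real l) y) \<le> (1 / l) * norm y" for y
        using dissipative_resolvent_norm_le[OF A diss Rel surj_l] by simp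
      show "0 \<le> 1 / l" "cmod (z - complex_of_real l) * (1 / l) < 1"
        using l(2) near by simp_all
    qed
  qed
qed

text \<open>The dissipative bound \<open>1 / Re z\<close> degenerates at the imaginary axis. The
  lower bound at \<open>z\<close> itself persists at nearby points with a slightly worse constant,
  which gives a perturbation disc around \<open>z + \<epsilon>\<close> large enough to contain
  \<open>z\<close>.\<close>

lemma resolvent_set_of_lower_bound:
  fixes A :: "'a::chilbert_space \<Rightarrow> 'a"
  assumes A: "clinear_on D A" and c: "c > 0"
    and right: "\<And>\<epsilon>. \<epsilon> > 0 \<Longrightarrow> z + complex_of_real \<epsilon> \<in> resolvent_set D A"
    and lower: "\<And>x. x \<in> D \<Longrightarrow> norm x \<le> c * norm (z *\<^sub>C x - A x)"
  shows "z \<in> resolvent_set D A"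
proof (rule resolvent_setI[OF A _ lower])
  \<comment> \<open>With this value \<open>norm x \<le> c * (norm v + \<epsilon> * norm x)\<close>
    yields the constant \<open>4 * c / 3\<close>, below \<open>2 * c\<close>, and then
    \<open>\<epsilon> * (2 * c) = 1 / 2 < 1\<close>.\<close>
  define \<epsilon> where "\<epsilon> = 1 / (4 * c)"
  have \<epsilon>: "\<epsilon> > 0" using c by (simp add: \<epsilon>_def)
  define w where "w = z + complex_of_real \<epsilon>"
  have w: "w \<in> resolvent_set D A"
    unfolding w_def by (rule right[OF \<epsilon>])
  show "\<exists>x\<in>D. z *\<^sub>C x - A x = y" for y
  proof (rule resolvent_perturbation_surj[OF w])
    show "norm (resolvent D A w v) \<le> (2 * c) * norm v" for v
    proof -
      define x where "x = resolvent D A w v"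
      have "z *\<^sub>C x - A x = v - complex_of_real \<epsilon> *\<^sub>C x"
        using resolvent_right_inverse[OF w, of v]
        by (simp add: x_def w_def scaleC_add_left algebra_simps)
      then have "norm (z *\<^sub>C x - A x) \<le> norm v + \<epsilon> * norm x"
        using norm_triangle_ineq4[of v "complex_of_real \<epsilon> *\<^sub>C x"] \<epsilon> by (simp add: norm_scaleC)
      then have "norm x \<le> c * (norm v + \<epsilon> * norm x)"
        using lower[of x] resolvent_mem[OF w, of v] c
        by (metis x_def mult_left_mono order_trans less_imp_le)
      then have "3 * norm x \<le> 4 * (c * norm v)"
        using c by (simp add: \<epsilon>_def field_simps)
      moreover have "0 \<le> c * norm v"
        using c by simp
      ultimately show ?thesis
        unfolding x_def[symmetric] mult.assoc by linarith
    qed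
    show "0 \<le> 2 * c" "cmod (z - w) * (2 * c) < 1"
      using c by (simp_all add: w_def \<epsilon>_def norm_divide norm_mult)
  qed
qed

section \<open>Generators of strongly continuous semigroups\<close>

lemma
  assumes "C0_semigroup T"
  shows C0_semigroup_bounded_clinear: "0 \<le> t \<Longrightarrow> bounded_clinear (T t)"
    and C0_semigroup_0: "T 0 x = x"
    and C0_semigroup_add: "0 \<le> s \<Longrightarrow> 0 \<le> t \<Longrightarrow> T (s + t) x = T s (T t x)"
    and C0_semigroup_tendsto: "((\<lambda>t. T t x) \<longlongrightarrow> x) (at_right 0)"
  using assms by (auto simp: C0_semigroup_def)

lemma C0_semigroup_near_0:
  assumes T: "C0_semigroup T" and e: "e > 0"
  obtains b where "b > 0" "\<And>t. 0 \<le> t \<Longrightarrow> t < b \<Longrightarrow> norm (T t x - x) < e"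
proof -
  have "\<forall>\<^sub>F t in at_right 0. dist (T t x) x < e"
    using C0_semigroup_tendsto[OF T] e by (rule tendstoD)
  then obtain b where b: "b > 0" "\<And>t. 0 < t \<Longrightarrow> t < b \<Longrightarrow> dist (T t x) x < e"
    by (auto simp: eventually_at_right_field)
  show thesis
  proof (rule that[OF b(1)])
    fix t :: real assume "0 \<le> t" "t < b"
    with b(2)[of t] e show "norm (T t x - x) < e"
      by (cases "t = 0") (auto simp: C0_semigroup_0[OF T] dist_norm)
  qed
qed

text \<open>Strong continuity bounds each orbit near 0, with an interval and a bound that depend on
  the vector. The closed sets \<open>C n\<close> tie both to one index and cover the space, so by
  Baire one of them contains a ball, where both are uniform.\<close>

lemma C0_semigroup_locally_bounded:
  fixes T :: "real \<Rightarrow> 'a::chilbert_space \<Rightarrow> 'a"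
  assumes T: "C0_semigroup T"
  obtains d M where "d > 0" "M \<ge> 1" "\<And>t x. 0 \<le> t \<Longrightarrow> t \<le> d \<Longrightarrow> norm (T t x) \<le> M * norm x"
proof -
  define C where "C n = (\<Inter>t\<in>{0..1 / real (Suc n)}. {x. norm (T t x) \<le> real (Suc n)})" for n
  have closed: "closed (C n)" for n
    unfolding C_def
  proof (intro closed_INT ballI closed_Collect_le continuous_on_norm continuous_on_const)
    fix t assume "t \<in> {0..1 / real (Suc n)}"
    then have "bounded_linear (T t)"
      using C0_semigroup_bounded_clinear[OF T] bounded_clinear_bounded_linear by auto
    then show "continuous_on UNIV (T t)"
      by (rule linear_continuous_on)
  qed
  have "x \<in> (\<Union>n. C n)" for x
  proof -
    obtain b where b: "b > 0" "\<And>t. 0 \<le> t \<Longrightarrow> t < b \<Longrightarrow> norm (T t x - x) < 1"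
      using C0_semigroup_near_0[OF T zero_less_one, where x = x] by blast
    obtain n where n: "max (1 / b) (norm x + 1) < real n"
      using reals_Archimedean2 by blast
    have "1 / real (Suc n) < b"
      using n b(1) by (simp add: field_simps)
    have "norm (T t x) \<le> real (Suc n)" if "0 \<le> t" "t \<le> 1 / real (Suc n)" for t
      using b(2)[of t] that \<open>1 / real (Suc n) < b\<close> n norm_triangle_ineq2[of "T t x" x] by simp
    then have "x \<in> C n"
      by (simp add: C_def)
    then show ?thesis by blast
  qed
  then have "interior (\<Union>(range C)) \<noteq> {}"
    by (metis UNIV_eq_I UNIV_not_empty interior_UNIV)
  moreover have "interior (\<Union>(range C)) = {}" if "\<And>n. interior (C n) = {}"
    using Baire_category_alt[of euclidean "range C"] completely_metrizable_space_euclidean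
      that closed by auto
  ultimately obtain n a where "a \<in> interior (C n)"
    by blast
  then obtain e where e: "e > 0" "cball a e \<subseteq> C n"
    by (auto simp: mem_interior_cball)
  define d where "d = 1 / real (Suc n)"
  define M where "M = max 1 (2 * real (Suc n) / e)"
  show thesis
  proof (rule that)
    show "d > 0" "M \<ge> 1"
      by (auto simp: d_def M_def)
    fix t x assume t: "0 \<le> t" "t \<le> d"
    interpret Tt: bounded_linear "T t"
      using C0_semigroup_bounded_clinear[OF T t(1)] by (rule bounded_clinear_bounded_linear)
    show "norm (T t x) \<le> M * norm x"
    proof (cases "x = 0")
      case False
      \<comment> \<open>Scaled to length \<open>e\<close>, the vector leads from the centre
        \<open>a\<close> to another point of the ball; the difference of two vectors with images
        bounded by \<open>Suc n\<close> explains the \<open>2 * real (Suc n) / e\<close> in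
        \<open>M\<close>.\<close>
      define k where "k = e / norm x"
      have k: "k > 0" using False e by (simp add: k_def)
      have "a + k *\<^sub>R x \<in> C n" "a \<in> C n"
        using False e by (auto simp: k_def dist_norm intro!: subsetD[OF e(2)])
      then have "norm (T t (a + k *\<^sub>R x)) \<le> real (Suc n)" "norm (T t a) \<le> real (Suc n)"
        using t by (auto simp: C_def d_def)
      then have "norm (T t (a + k *\<^sub>R x) - T t a) \<le> 2 * real (Suc n)"
        using order_trans[OF norm_triangle_ineq4 add_mono] by (metis mult_2)
      moreover have "T t (a + k *\<^sub>R x) - T t a = k *\<^sub>R T t x"
        by (simp add: Tt.add Tt.scaleR)
      ultimately have "k * norm (T t x) \<le> 2 * real (Suc n)"
        using k by simp
      then have "norm (T t x) \<le> 2 * real (Suc n) / e * norm x"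
        using False e by (simp add: k_def field_simps)
      also have "\<dots> \<le> M * norm x"
        by (intro mult_right_mono) (auto simp: M_def)
      finally show ?thesis .
    qed (simp add: Tt.zero)
  qed
qed

text \<open>Since \<open>T t x - T s x = T s (T (t - s) x - x)\<close>, the local bound carries
  continuity at 0 to every time. The threshold \<open>b\<close> does not depend on \<open>s\<close>,
  so exchanging the two times also gives continuity from the left.\<close>

lemma C0_semigroup_continuous_on:
  assumes T: "C0_semigroup T"
    and M: "M \<ge> 1" "\<And>t x. 0 \<le> t \<Longrightarrow> t \<le> d \<Longrightarrow> norm (T t x) \<le> M * norm x"
  shows "continuous_on {0..d} (\<lambda>t. T t x)"
  unfolding continuous_on_iff
proof (intro ballI allI impI)
  fix s e :: real assume s: "s \<in> {0..d}" and e: "e > 0"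
  obtain b where b: "b > 0" "\<And>t. 0 \<le> t \<Longrightarrow> t < b \<Longrightarrow> norm (T t x - x) < e / M"
    using C0_semigroup_near_0[OF T, of "e / M" x] e M(1) by auto
  have *: "norm (T t x - T s x) < e" if "0 \<le> s" "s \<le> t" "t \<le> d" "t < s + b" for s t
  proof -
    have "T t x = T s (T (t - s) x)"
      using C0_semigroup_add[OF T, of s "t - s" x] that by simp
    then have "T t x - T s x = T s (T (t - s) x - x)"
      using bounded_clinear_diff[OF C0_semigroup_bounded_clinear[OF T that(1)]] by simp
    then have "norm (T t x - T s x) \<le> M * norm (T (t - s) x - x)"
      using M(2)[of s] that by simp
    also have "\<dots> < M * (e / M)"
      using b(2)[of "t - s"] that M(1) by (intro mult_strict_left_mono) auto
    finally show ?thesis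
      using M(1) by simp
  qed
  have "dist (T t x) (T s x) < e" if "t \<in> {0..d}" "dist t s < b" for t
    using *[of s t] *[of t s] that s
    by (cases "s \<le> t") (auto simp: dist_norm norm_minus_commute)
  with b(1) show "\<exists>b>0. \<forall>t\<in>{0..d}. dist t s < b \<longrightarrow> dist (T t x) (T s x) < e"
    by blast
qed

lemma has_vector_derivative_at_right_0:
  assumes "(g has_vector_derivative y) (at 0 within {0..c})" "c > 0"
  shows "((\<lambda>h. (g h - g 0) /\<^sub>R h) \<longlongrightarrow> y) (at_right 0)"
proof -
  have "at_right 0 = at 0 within {0..c}"
    using assms(2) by (simp add: at_within_Icc_at_right)
  moreover have "((\<lambda>h. (1 / \<bar>h\<bar>) *\<^sub>R (g h - (g 0 + h *\<^sub>R y))) \<longlongrightarrow> 0) (at 0 within {0..c})"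
    using assms(1) by (simp add: has_vector_derivative_def has_derivative_within)
  ultimately have "((\<lambda>h. (1 / \<bar>h\<bar>) *\<^sub>R (g h - (g 0 + h *\<^sub>R y)) + y) \<longlongrightarrow> 0 + y) (at_right 0)"
    by (intro tendsto_intros) simp
  moreover have "\<forall>\<^sub>F h in at_right 0. (1 / \<bar>h\<bar>) *\<^sub>R (g h - (g 0 + h *\<^sub>R y)) + y = (g h - g 0) /\<^sub>R h"
    unfolding eventually_at_right_field
    by (intro exI[of _ 1]) (auto simp: algebra_simps inverse_eq_divide)
  ultimately show ?thesis
    by (simp add: tendsto_cong)
qed

text \<open>The truncated Laplace transform \<open>V = \<integral>\<^sub>0\<^sup>t e\<^sup>-\<^sup>l\<^sup>s T(s)x ds\<close> is a preimage of
  \<open>x - e\<^sup>-\<^sup>l\<^sup>t T(t)x\<close> under \<open>l - A\<close>.\<close>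

lemma generator_truncated_Laplace:
  fixes T :: "real \<Rightarrow> 'a::chilbert_space \<Rightarrow> 'a"
  assumes T: "C0_semigroup T" and gen: "is_generator T D A"
    and t: "t > 0" and cont: "continuous_on {0..2 * t} (\<lambda>s. T s x)"
  shows "\<exists>v\<in>D. l *\<^sub>R v - A v = x - exp (- l * t) *\<^sub>R T t x"
proof -
  define f where "f s = exp (- l * s) *\<^sub>R T s x" for s
  define F where "F u = integral {0..u} f" for u
  have f_cont: "continuous_on {0..2 * t} f"
    unfolding f_def by (intro continuous_intros cont)
  have F_deriv: "(F has_vector_derivative f u) (at u within S)" if "u \<in> {0..2 * t}" "S \<subseteq> {0..2 * t}" for u S
    unfolding F_def
    using integral_has_vector_derivative[OF f_cont that(1)] that(2)
    by (rule has_vector_derivative_within_subset)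
  have F_shift_deriv: "((\<lambda>s. F (s + h)) has_vector_derivative f (u + h)) (at u within S)"
    if "\<And>s. s \<in> S \<Longrightarrow> s + h \<in> {0..2 * t}" "u \<in> S" for u h S
  proof -
    have "((\<lambda>s. s + h) has_vector_derivative 1) (at u within S)"
      by (auto intro!: derivative_eq_intros)
    moreover have "(F has_vector_derivative f (u + h)) (at (u + h) within (\<lambda>s. s + h) ` S)"
      using that by (intro F_deriv) auto
    ultimately have "((F \<circ> (\<lambda>s. s + h)) has_vector_derivative (1 *\<^sub>R f (u + h))) (at u within S)"
      by (rule vector_diff_chain_within)
    then show ?thesis by (simp add: o_def)
  qed
  have f_integrable: "f integrable_on {0..t}"
    by (rule integrable_continuous_real[OF continuous_on_subset[OF f_cont]]) (use t in auto)
  \<comment> \<open>\<open>g h\<close> is \<open>T h (F t)\<close> in closed form: shifting the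
    integration variable by \<open>h\<close> moves the window to \<open>[h, h + t]\<close> and
    leaves the exponential factor. The shifted window is the reason for continuity up to
    \<open>2 * t\<close>.\<close>
  define g where "g h = exp (l * h) *\<^sub>R (F (h + t) - F h)" for h
  have TF: "T h (F t) = g h" if h: "h \<in> {0..t}" for h
  proof -
    have bl: "bounded_linear (T h)"
      using h C0_semigroup_bounded_clinear[OF T] bounded_clinear_bounded_linear by auto
    have "((\<lambda>s. f (s + h)) has_integral (F (t + h) - F (0 + h))) {0..t}"
      using t h by (intro fundamental_theorem_of_calculus F_shift_deriv) auto
    then have "((\<lambda>s. exp (l * h) *\<^sub>R f (s + h)) has_integral g h) {0..t}"
      unfolding g_def by (simp add: has_integral_cmul add.commute)
    moreover have "T h (f s) = exp (l * h) *\<^sub>R f (s + h)" if "s \<in> {0..t}" for s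
    proof -
      have "T h (f s) = exp (- l * s) *\<^sub>R T (h + s) x"
        using that h C0_semigroup_add[OF T, of h s x]
        by (simp add: f_def linear_simps(5)[OF bl])
      also have "exp (- l * s) = exp (l * h) * exp (- l * (s + h))"
        by (simp add: exp_add[symmetric] algebra_simps)
      finally show ?thesis
        by (simp add: f_def add.commute)
    qed
    ultimately have "((T h \<circ> f) has_integral g h) {0..t}"
      by (subst has_integral_cong[of _ _ "\<lambda>s. exp (l * h) *\<^sub>R f (s + h)"]) auto
    moreover have "((T h \<circ> f) has_integral T h (F t)) {0..t}"
      unfolding F_def using f_integrable bl
      by (intro has_integral_linear integrable_integral)
    ultimately show ?thesis
      by (rule has_integral_unique[symmetric])
  qed
  have "(g has_vector_derivative (l *\<^sub>R F t + (f t - f 0))) (at 0 within {0..t})"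
  proof -
    have "((\<lambda>h. exp (l * h)) has_field_derivative l) (at 0 within {0..t})"
      by (auto intro!: derivative_eq_intros)
    moreover have "((\<lambda>h. F (h + t) - F h) has_vector_derivative (f (0 + t) - f 0)) (at 0 within {0..t})"
      using t by (intro derivative_intros F_shift_deriv F_deriv) auto
    ultimately have "(g has_vector_derivative
        (exp (l * 0) *\<^sub>R (f (0 + t) - f 0) + l *\<^sub>R (F (0 + t) - F 0))) (at 0 within {0..t})"
      unfolding g_def by (rule has_vector_derivative_scaleR)
    then show ?thesis
      by (simp add: F_def add.commute)
  qed
  from has_vector_derivative_at_right_0[OF this t]
  have "((\<lambda>h. (g h - g 0) /\<^sub>R h) \<longlongrightarrow> l *\<^sub>R F t + (f t - f 0)) (at_right 0)" .
  moreover have "\<forall>\<^sub>F h in at_right 0. (g h - g 0) /\<^sub>R h = (T h (F t) - F t) /\<^sub>R h"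
    unfolding eventually_at_right_field using t TF
    by (intro exI[of _ t]) (auto simp: g_def F_def)
  ultimately have lim: "((\<lambda>h. (T h (F t) - F t) /\<^sub>R h) \<longlongrightarrow> l *\<^sub>R F t + (f t - f 0)) (at_right 0)"
    by (simp add: tendsto_cong)
  have mem: "F t \<in> D"
    using gen lim by (auto simp: is_generator_def)
  then have "((\<lambda>h. (T h (F t) - F t) /\<^sub>R h) \<longlongrightarrow> A (F t)) (at_right 0)"
    using gen by (auto simp: is_generator_def)
  then have "A (F t) = l *\<^sub>R F t + (f t - f 0)"
    using lim by (rule tendsto_unique[OF trivial_limit_at_right_real])
  then have "l *\<^sub>R F t - A (F t) = x - exp (- l * t) *\<^sub>R T t x"
    by (simp add: f_def C0_semigroup_0[OF T])
  with mem show ?thesis by blast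
qed

text \<open>The truncated Laplace transform solves the equation for right-hand sides
  \<open>x - q T(t) x\<close> with \<open>q = exp (- l * t)\<close>. For large \<open>l\<close> the
  subtracted operator has norm at most 1/2, so every \<open>y\<close> has this form by Lax-Milgram.
  A bound of the semigroup on one short interval suffices.\<close>

lemma generates_C0_semigroup_surj:
  fixes A :: "'a::chilbert_space \<Rightarrow> 'a"
  assumes "generates_C0_semigroup D A"
  obtains l0 where "\<And>l y. l \<ge> l0 \<Longrightarrow> \<exists>x\<in>D. complex_of_real l *\<^sub>C x - A x = y"
proof -
  obtain T where T: "C0_semigroup T" and gen: "is_generator T D A"
    using assms by (auto simp: generates_C0_semigroup_def)
  obtain d M where d: "d > 0" and M: "M \<ge> 1"
      "\<And>t x. 0 \<le> t \<Longrightarrow> t \<le> d \<Longrightarrow> norm (T t x) \<le> M * norm x"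
    using C0_semigroup_locally_bounded[OF T] by blast
  define t where "t = d / 2"
  have t: "t > 0" "d = 2 * t" using d by (simp_all add: t_def)
  show thesis
  proof (rule that)
    fix l :: real and y :: 'a assume l: "ln (2 * M) / t \<le> l"
    define q where "q = exp (- l * t)"
    have "ln (2 * M) \<le> l * t"
      using l t by (simp add: field_simps)
    then have "q \<le> exp (- ln (2 * M))"
      by (simp add: q_def)
    also have "\<dots> = 1 / (2 * M)"
      using M(1) by (simp add: exp_minus inverse_eq_divide)
    finally have q: "q * M \<le> 1 / 2"
      using M(1) by (simp add: field_simps)
    define B where "B x = x - q *\<^sub>R T t x" for x
    have qT: "norm (q *\<^sub>R T t x) \<le> 1 / 2 * norm x" for x
    proof -
      have "norm (q *\<^sub>R T t x) \<le> q * (M * norm x)"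
        using M(2)[of t x] t by (auto simp: q_def)
      also have "\<dots> \<le> 1 / 2 * norm x"
        using mult_right_mono[OF q, of "norm x"] by (simp add: mult.assoc)
      finally show ?thesis .
    qed
    have Tt: "bounded_clinear (T t)"
      using C0_semigroup_bounded_clinear[OF T] t by simp
    have "bounded_clinear B"
    proof (rule bounded_clinearI)
      show "B (x + y) = B x + B y" for x y
        by (simp add: B_def bounded_clinear_add[OF Tt] scaleR_add_right)
      show "B (c *\<^sub>C x) = c *\<^sub>C B x" for c x
        by (simp add: B_def bounded_clinear_scaleC[OF Tt] scaleR_scaleC scaleC_scaleC
            scaleC_diff_right mult.commute)
      show "norm (B x) \<le> 2 * norm x" for x
        using norm_triangle_ineq4[of x "q *\<^sub>R T t x"] qT[of x] norm_ge_zero[of x]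
        unfolding B_def by linarith
    qed
    moreover have "1 / 2 * (norm x)\<^sup>2 \<le> Re (cinner (B x) x)" for x
    proof -
      have "Re (cinner (q *\<^sub>R T t x) x) \<le> norm (q *\<^sub>R T t x) * norm x"
        by (rule Re_cinner_le)
      also have "\<dots> \<le> 1 / 2 * norm x * norm x"
        by (intro mult_right_mono qT) simp
      finally show ?thesis
        by (simp add: B_def cinner_diff_left Re_cinner_self power2_eq_square)
    qed
    ultimately obtain x where x: "B x = y"
      using coercive_surj[of B "1 / 2"] by auto
    have "continuous_on {0..2 * t} (\<lambda>s. T s x)"
      using C0_semigroup_continuous_on[OF T M] unfolding t(2) .
    from generator_truncated_Laplace[OF T gen t(1) this, of l]
    show "\<exists>v\<in>D. complex_of_real l *\<^sub>C v - A v = y"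
      using x by (simp add: B_def q_def scaleR_scaleC)
  qed
qed

lemma dissipative_generator_resolvent_set:
  fixes A :: "'a::chilbert_space \<Rightarrow> 'a"
  assumes "clinear_on D A" "dissipative D A" "generates_C0_semigroup D A" "Re z > 0"
  shows "z \<in> resolvent_set D A"
  using generates_C0_semigroup_surj[OF assms(3)] dissipative_right_half_plane[OF assms(1,2,4)]
  by metis

section \<open>The Lumer--Phillips theorem\<close>

lemma csubspace_closure:
  assumes "csubspace M"
  shows "csubspace (closure M)"
  unfolding csubspace_def
proof (intro conjI ballI allI)
  show "0 \<in> closure M"
    using assms closure_subset by (auto simp: csubspace_def)
  fix x assume "x \<in> closure M"
  then obtain a where a: "\<And>n. a n \<in> M" "a \<longlonglongrightarrow> x"
    by (auto simp: closure_sequential)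
  show "c *\<^sub>C x \<in> closure M" for c
  proof -
    have "(\<lambda>n. c *\<^sub>C a n) \<longlonglongrightarrow> c *\<^sub>C x"
      by (rule bounded_linear.tendsto[OF bounded_clinear_bounded_linear[OF bounded_clinear_scaleC_id] a(2)])
    with a(1) assms show ?thesis
      unfolding closure_sequential csubspace_def by (intro exI[of _ "\<lambda>n. c *\<^sub>C a n"]) blast
  qed
  fix y assume "y \<in> closure M"
  then obtain b where b: "\<And>n. b n \<in> M" "b \<longlonglongrightarrow> y"
    by (auto simp: closure_sequential)
  have "(\<lambda>n. a n + b n) \<longlonglongrightarrow> x + y"
    using a(2) b(2) by (rule tendsto_add)
  with a(1) b(1) assms show "x + y \<in> closure M"
    unfolding closure_sequential csubspace_def by (intro exI[of _ "\<lambda>n. a n + b n"]) blast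
qed

lemma Re_cinner_scaleR_left: "Re (cinner (r *\<^sub>R x) y) = r * Re (cinner x y)"
  by (simp add: cinner_scaleR_left)

locale m_dissipative =
  fixes D :: "'a::chilbert_space set" and A :: "'a \<Rightarrow> 'a"
  assumes linear: "clinear_on D A" and dissip: "dissipative D A"
    and surj: "\<And>l y. l > 0 \<Longrightarrow> \<exists>x\<in>D. complex_of_real l *\<^sub>C x - A x = y"
begin

text \<open>The backward Euler step \<open>(1 - h A)^-1\<close>, written through the resolvent at
  \<open>1 / h\<close> so that the resolvent bounds apply.\<close>

definition euler :: "real \<Rightarrow> 'a \<Rightarrow> 'a" where
  "euler h y = complex_of_real (1 / h) *\<^sub>C resolvent D A (complex_of_real (1 / h)) y"

lemmas D_scaleC = clinear_on_scaleC_mem[OF linear]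
lemmas D_diff = clinear_on_diff_mem[OF linear]
lemmas A_scaleC = clinear_on_scaleC[OF linear]
lemmas A_diff = clinear_on_diff[OF linear]

lemma D_scaleR: "x \<in> D \<Longrightarrow> r *\<^sub>R x \<in> D"
  by (simp add: scaleR_scaleC D_scaleC)

lemma A_scaleR: "x \<in> D \<Longrightarrow> A (r *\<^sub>R x) = r *\<^sub>R A x"
  by (simp add: scaleR_scaleC A_scaleC)

lemma resolvent_set: "l > 0 \<Longrightarrow> complex_of_real l \<in> resolvent_set D A"
  using dissipative_resolvent_setI[OF linear dissip, of "complex_of_real l"] surj by simp

context
  fixes h :: real
  assumes h: "h > 0"
begin

lemma euler_resolvent_set: "complex_of_real (1 / h) \<in> resolvent_set D A"
  using h by (intro resolvent_set) simp

lemma euler_mem: "euler h y \<in> D"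
  unfolding euler_def by (intro D_scaleC resolvent_mem euler_resolvent_set)

lemma euler_eq: "euler h y - h *\<^sub>R A (euler h y) = y"
proof -
  let ?z = "complex_of_real (1 / h)"
  let ?x = "resolvent D A ?z y"
  have "h *\<^sub>R A (euler h y) = A ?x"
    using h by (simp add: euler_def A_scaleC resolvent_mem[OF euler_resolvent_set]
        scaleR_scaleC scaleC_scaleC del: of_real_divide) simp
  then show ?thesis
    using resolvent_right_inverse[OF euler_resolvent_set, of y] by (simp add: euler_def)
qed

lemma euler_eqI:
  assumes "x \<in> D" "x - h *\<^sub>R A x = y"
  shows "euler h y = x"
proof -
  let ?z = "complex_of_real (1 / h)"
  have "resolvent D A ?z y = h *\<^sub>R x"
  proof (rule resolvent_eqI[OF euler_resolvent_set])
    show "h *\<^sub>R x \<in> D"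
      using assms by (simp add: D_scaleR)
    have "?z *\<^sub>C h *\<^sub>R x = x"
      using h by (simp add: scaleR_scaleC scaleC_scaleC)
    then show "?z *\<^sub>C h *\<^sub>R x - A (h *\<^sub>R x) = y"
      using assms by (simp only: A_scaleR)
  qed
  then show ?thesis
    using h by (simp add: euler_def scaleR_scaleC scaleC_scaleC)
qed

lemma bounded_clinear_euler: "bounded_clinear (euler h)"
  using bounded_clinear_compose[OF bounded_clinear_scaleC_id
      resolvent_bounded_clinear[OF euler_resolvent_set]]
  by (simp add: euler_def[abs_def])

lemmas euler_add = bounded_clinear_add[OF bounded_clinear_euler]
  and euler_diff = bounded_clinear_diff[OF bounded_clinear_euler]

lemma euler_scaleR: "euler h (r *\<^sub>R x) = r *\<^sub>R euler h x"
  by (simp add: scaleR_scaleC bounded_clinear_scaleC[OF bounded_clinear_euler])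

lemma euler_norm_le: "norm (euler h y) \<le> norm y"
proof -
  have "norm (resolvent D A (complex_of_real (1 / h)) y) \<le> 1 / (1 / h) * norm y"
    using dissipative_resolvent_norm_le[OF linear dissip, of "complex_of_real (1 / h)" y]
      surj[of "1 / h"] h by simp
  then show ?thesis
    using h by (simp add: euler_def norm_scaleC norm_divide field_simps)
qed

text \<open>Solving the Euler equation for \<open>A u\<close> exhibits it as a multiple of
  \<open>u - x\<close>, hence as an element of \<open>D\<close>. Applying \<open>A\<close> again is
  then legitimate and shows that \<open>A u\<close> solves the Euler equation with datum
  \<open>A x\<close>.\<close>

lemma A_euler:
  assumes x: "x \<in> D"
  shows "A (euler h x) = euler h (A x)"
proof -
  let ?u = "euler h x"
  have "?u - x = h *\<^sub>R A ?u"
    using euler_eq[of x] by (simp add: algebra_simps)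
  then have Au: "A ?u = (1 / h) *\<^sub>R (?u - x)"
    using h by simp
  have AAu: "A (A ?u) = (1 / h) *\<^sub>R (A ?u - A x)"
    by (subst Au) (simp add: A_scaleR D_diff A_diff euler_mem x)
  have "euler h (A x) = A ?u"
  proof (rule euler_eqI)
    show "A ?u \<in> D"
      unfolding Au by (intro D_scaleR D_diff euler_mem x)
    show "A ?u - h *\<^sub>R A (A ?u) = A x"
      using h unfolding AAu by simp
  qed
  then show ?thesis by simp
qed

lemma euler_minus_id:
  assumes "x \<in> D"
  shows "euler h x - x = h *\<^sub>R euler h (A x)"
  using euler_eq[of x] A_euler[OF assms] by (simp add: algebra_simps)

lemma euler_near:
  assumes "x \<in> D"
  shows "norm (euler h x - x) \<le> h * norm (A x)"
  using euler_norm_le[of "A x"] h by (simp add: euler_minus_id[OF assms])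

lemma euler_pow_props:
  shows "bounded_clinear (euler h ^^ m)" and "norm ((euler h ^^ m) x) \<le> norm x"
    and "x \<in> D \<Longrightarrow> (euler h ^^ m) x \<in> D"
    and "x \<in> D \<Longrightarrow> A ((euler h ^^ m) x) = (euler h ^^ m) (A x)"
    and "x \<in> D \<Longrightarrow> norm ((euler h ^^ m) x - x) \<le> real m * h * norm (A x)"
proof (induction m)
  case 0
  {
    case 1 show ?case by (simp add: bounded_clinear_id id_def)
  }
next
  case (Suc m)
  {
    case 1 show ?case
      using bounded_clinear_compose[OF bounded_clinear_euler Suc(1)] by (simp add: o_def)
  next
    case 2 show ?case
      using euler_norm_le[of "(euler h ^^ m) x"] Suc(2) by simp
  next
    case 3 then show ?case by (simp add: euler_mem)
  next
    case 4 then show ?case using Suc by (simp add: A_euler)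
  next
    case 5
    have "(euler h ^^ Suc m) x - x = euler h ((euler h ^^ m) x - x) + (euler h x - x)"
      by (simp add: euler_diff)
    then have "norm ((euler h ^^ Suc m) x - x)
        \<le> norm (euler h ((euler h ^^ m) x - x)) + norm (euler h x - x)"
      by (metis norm_triangle_ineq)
    also have "\<dots> \<le> real m * h * norm (A x) + h * norm (A x)"
      using order_trans[OF euler_norm_le Suc(5)[OF 5]] euler_near[OF 5] by (rule add_mono)
    finally show ?case by (simp add: algebra_simps)
  }
qed auto

text \<open>Telescoping writes the increment as \<open>h\<close> times a sum of
  \<open>(euler h ^^ j) (A x)\<close>, so the error is governed by how far these are from
  \<open>A x\<close>. As \<open>A x\<close> may lie outside \<open>D\<close>, it is compared through
  an auxiliary \<open>z\<close> in \<open>D\<close>, at the price of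
  \<open>2 * norm (A x - z)\<close>.\<close>

lemma euler_pow_first_order:
  assumes x: "x \<in> D" and z: "z \<in> D"
  shows "norm ((euler h ^^ m) x - x - (real m * h) *\<^sub>R A x)
    \<le> real m * h * (real m * h * norm (A z) + 2 * norm (A x - z))"
proof -
  define c where "c = real m * h * norm (A z) + 2 * norm (A x - z)"
  have near: "norm ((euler h ^^ j) (A x) - A x) \<le> c" if "j \<le> m" for j
  proof -
    let ?S = "euler h ^^ j"
    have "?S (A x) - A x = ?S (A x - z) + (?S z - z) + (z - A x)"
      by (simp add: bounded_clinear_diff[OF euler_pow_props(1)])
    then have "norm (?S (A x) - A x) \<le> norm (?S (A x - z)) + norm (?S z - z) + norm (A x - z)"
      by (metis norm_triangle_ineq norm_triangle_mono norm_minus_commute order_refl)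
    also have "\<dots> \<le> norm (A x - z) + real j * h * norm (A z) + norm (A x - z)"
      by (intro add_mono euler_pow_props z order_refl)
    also have "\<dots> \<le> c"
      using h that by (simp add: c_def mult_right_mono)
    finally show ?thesis .
  qed
  have "norm ((euler h ^^ j) x - x - (real j * h) *\<^sub>R A x) \<le> real j * h * c" if "j \<le> m" for j
    using that
  proof (induction j)
    case (Suc j)
    let ?S = "euler h ^^ j"
    have "(euler h ^^ Suc j) x - ?S x = ?S (euler h x - x)"
      by (simp add: bounded_clinear_diff[OF euler_pow_props(1)] funpow_swap1)
    also have "\<dots> = h *\<^sub>R (euler h ^^ Suc j) (A x)"
      by (simp add: euler_minus_id[OF x] scaleR_scaleC bounded_clinear_scaleC[OF euler_pow_props(1)]
          funpow_swap1)
    finally have "(euler h ^^ Suc j) x - x - (real (Suc j) * h) *\<^sub>R A x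
        = (?S x - x - (real j * h) *\<^sub>R A x) + h *\<^sub>R ((euler h ^^ Suc j) (A x) - A x)"
      by (simp add: algebra_simps)
    then have "norm ((euler h ^^ Suc j) x - x - (real (Suc j) * h) *\<^sub>R A x)
        \<le> norm (?S x - x - (real j * h) *\<^sub>R A x) + norm (h *\<^sub>R ((euler h ^^ Suc j) (A x) - A x))"
      by (metis norm_triangle_ineq)
    also have "norm (h *\<^sub>R ((euler h ^^ Suc j) (A x) - A x)) = h * norm ((euler h ^^ Suc j) (A x) - A x)"
      using h by simp
    also have "norm (?S x - x - (real j * h) *\<^sub>R A x) + h * norm ((euler h ^^ Suc j) (A x) - A x)
        \<le> real j * h * c + h * c"
      using Suc near[of "Suc j"] h by (intro add_mono mult_left_mono) auto
    finally show ?case by (simp add: algebra_simps)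
  qed simp
  from this[of m] show ?thesis by (simp add: c_def)
qed

end

section \<open>Step halving and dense domains\<close>

lemma euler_commute:
  assumes "h > 0" "k > 0"
  shows "euler h (euler k x) = euler k (euler h x)"
proof -
  let ?u = "euler k x"
  have "euler k (euler h x) = euler h ?u"
  proof (rule euler_eqI[OF assms(2) euler_mem[OF assms(1)]])
    have "euler h ?u - k *\<^sub>R A (euler h ?u) = euler h (?u - k *\<^sub>R A ?u)"
      by (simp add: A_euler[OF assms(1) euler_mem[OF assms(2)]] euler_diff[OF assms(1)]
          euler_scaleR[OF assms(1)])
    then show "euler h ?u - k *\<^sub>R A (euler h ?u) = euler h x"
      by (simp add: euler_eq[OF assms(2)])
  qed
  then show ?thesis by simp
qed

text \<open>The step-halving error comes from
  \<open>(1 - h A / 2)\<^sup>2 = (1 - h A) + h\<^sup>2 A\<^sup>2 / 4\<close>.\<close>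

lemma euler_halve:
  assumes h: "h > 0" and x: "x \<in> D" "A x \<in> D"
  shows "norm (euler h x - euler (h / 2) (euler (h / 2) x)) \<le> h\<^sup>2 / 4 * norm (A (A x))"
proof -
  define k where "k = h / 2"
  have k: "k > 0" using h by (simp add: k_def)
  define e where "e = (h\<^sup>2 / 4) *\<^sub>R A (A x)"
  \<comment> \<open>Two half steps lead from \<open>(x - h A x) + e\<close> to \<open>x\<close>, and
    \<open>u\<close> is the point between them; one full step leads from \<open>x - h A x\<close> to
    \<open>x\<close>.\<close>
  define u where "u = x - k *\<^sub>R A x"
  have u: "u \<in> D"
    using x by (simp add: u_def D_diff D_scaleR)
  have "u - k *\<^sub>R A u = (x - h *\<^sub>R A x) + e"
  proof -
    have "h *\<^sub>R A x = k *\<^sub>R A x + k *\<^sub>R A x"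
      by (simp add: k_def flip: scaleR_left_distrib)
    moreover have "e = k *\<^sub>R k *\<^sub>R A (A x)"
      by (simp add: e_def k_def power2_eq_square)
    moreover have "A u = A x - k *\<^sub>R A (A x)"
      using x by (simp add: u_def A_diff D_scaleR A_scaleR)
    ultimately show ?thesis
      by (simp add: u_def scaleR_diff_right)
  qed
  then have "euler k ((x - h *\<^sub>R A x) + e) = u"
    using u by (intro euler_eqI[OF k])
  moreover have "euler k u = x"
    using x by (intro euler_eqI[OF k]) (auto simp: u_def)
  ultimately have "x = euler k (euler k (x - h *\<^sub>R A x)) + euler k (euler k e)"
    by (metis euler_add[OF k])
  then have "euler h x = euler h (euler k (euler k (x - h *\<^sub>R A x))) + euler h (euler k (euler k e))"
    by (metis euler_add[OF h])
  also have "euler h (euler k (euler k (x - h *\<^sub>R A x))) = euler k (euler k (euler h (x - h *\<^sub>R A x)))"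
    by (simp only: euler_commute[OF h k])
  also have "euler h (x - h *\<^sub>R A x) = x"
    using x by (intro euler_eqI[OF h]) auto
  finally have "euler h x - euler k (euler k x) = euler h (euler k (euler k e))"
    by simp
  moreover have "norm (euler h (euler k (euler k e))) \<le> norm e"
    using euler_norm_le[OF h] euler_norm_le[OF k] order_trans by meson
  ultimately show ?thesis
    by (simp add: e_def k_def)
qed

text \<open>The local errors of order \<open>h^2\<close> merely add up, because all steps are
  contractions. They stay of equal size because \<open>A\<close> commutes with the powers, which
  bounds \<open>A (A y)\<close> along the trajectory by its initial value.\<close>

lemma euler_pow_halve:
  assumes h: "h > 0" and x: "x \<in> D" "A x \<in> D"
  shows "norm ((euler h ^^ m) x - (euler (h / 2) ^^ (2 * m)) x) \<le> real m * (h\<^sup>2 / 4 * norm (A (A x)))"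
proof (induction m)
  case (Suc m)
  define k where "k = h / 2"
  have k: "k > 0" using h by (simp add: k_def)
  let ?y = "(euler h ^^ m) x" and ?y' = "(euler k ^^ (2 * m)) x"
  have y: "?y \<in> D" "A ?y \<in> D" "A (A ?y) = (euler h ^^ m) (A (A x))"
    using x by (simp_all add: euler_pow_props[OF h])
  have "norm (euler h ?y - euler k (euler k ?y)) \<le> h\<^sup>2 / 4 * norm (A (A ?y))"
    unfolding k_def by (rule euler_halve[OF h y(1,2)])
  also have "\<dots> \<le> h\<^sup>2 / 4 * norm (A (A x))"
    unfolding y(3) by (intro mult_left_mono euler_pow_props(2)[OF h]) simp
  finally have "norm (euler h ?y - euler k (euler k ?y)) \<le> h\<^sup>2 / 4 * norm (A (A x))" .
  moreover have "norm (euler k (euler k (?y - ?y'))) \<le> real m * (h\<^sup>2 / 4 * norm (A (A x)))"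
    using Suc euler_norm_le[OF k] order_trans unfolding k_def[symmetric] by meson
  moreover have "(euler h ^^ Suc m) x - (euler k ^^ (2 * Suc m)) x
      = (euler h ?y - euler k (euler k ?y)) + euler k (euler k (?y - ?y'))"
    by (simp add: euler_diff[OF k])
  ultimately have "norm ((euler h ^^ Suc m) x - (euler k ^^ (2 * Suc m)) x)
      \<le> h\<^sup>2 / 4 * norm (A (A x)) + real m * (h\<^sup>2 / 4 * norm (A (A x)))"
    by (metis norm_triangle_mono)
  then show ?case
    by (simp add: k_def algebra_simps)
qed simp

text \<open>A vector \<open>z\<close> orthogonal to the domain is tested against
  \<open>x = (1 - A)^-1 z\<close>, itself in the domain: orthogonality gives
  \<open>norm x ^ 2 = Re (cinner (A x) x)\<close>, which dissipativity makes nonpositive.\<close>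

lemma dense: "closure D = UNIV"
proof (rule ccontr)
  assume ne: "closure D \<noteq> UNIV"
  obtain z where z: "z \<noteq> 0" "\<And>m. m \<in> closure D \<Longrightarrow> cinner m z = 0"
    by (rule csubspace_orthogonal_vector[OF csubspace_closure[OF clinear_on_csubspace[OF linear]]
          closed_closure ne]) blast
  define x where "x = euler 1 z"
  have x: "x \<in> D" "x - A x = z"
    using euler_mem[of 1 z] euler_eq[of 1 z] by (auto simp: x_def)
  have "cinner x (x - A x) = 0"
    using z(2)[of x] x closure_subset by auto
  then have "(norm x)\<^sup>2 = Re (cinner (A x) x)"
    by (simp add: cinner_diff_right flip: Re_cinner_self)
      (metis Re_cinner_commute)
  also have "\<dots> \<le> 0"
    using dissip x(1) by (simp add: dissipative_def)
  finally have "x = 0" by simp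
  with x(2) z(1) clinear_on_zero[OF linear] show False by simp
qed

lemma dense_approx:
  assumes "e > 0"
  obtains y where "y \<in> D" "norm (x - y) < e"
proof -
  have "x \<in> closure D" by (simp add: dense)
  then show thesis
    using assms that by (auto simp: closure_approachable dist_norm norm_minus_commute)
qed

text \<open>One short Euler step maps \<open>D\<close> into the domain of the square of
  \<open>A\<close> and moves a point of \<open>D\<close> only by a multiple of the step.\<close>

lemma dense_approx2:
  assumes e: "e > 0"
  obtains y where "y \<in> D" "A y \<in> D" "norm (x - y) < e"
proof -
  obtain y where y: "y \<in> D" "norm (x - y) < e / 2"
    using dense_approx[of "e / 2" x] e by auto
  define h where "h = e / (2 * (norm (A y) + 1))"
  have p: "norm (A y) + 1 > 0"
    using norm_ge_zero[of "A y"] by linarith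
  then have h: "h > 0"
    using e by (simp add: h_def)
  have "norm (euler h y - y) \<le> h * norm (A y)"
    by (rule euler_near[OF h y(1)])
  also have "\<dots> \<le> h * (norm (A y) + 1)"
    using h by simp
  also have "\<dots> = e / 2"
    using p by (simp add: h_def del: distrib_left_numeral)
  finally have "norm (x - euler h y) < e"
    using y(2) norm_triangle_ineq[of "x - y" "y - euler h y"] by (simp add: norm_minus_commute)
  then show thesis
    using y(1) by (intro that[of "euler h y"]) (simp_all add: A_euler[OF h] euler_mem[OF h])
qed

text \<open>Dyadic steps make each refinement a comparison of one step with two half steps. Rounding
  the number of steps down puts all times on a common grid, so that concatenating two approximations
  costs at most one step.\<close>

definition approx :: "nat \<Rightarrow> real \<Rightarrow> 'a \<Rightarrow> 'a" where
  "approx k t = euler ((1/2)^k) ^^ nat \<lfloor>t * 2^k\<rfloor>"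

definition flow :: "real \<Rightarrow> 'a \<Rightarrow> 'a" where
  "flow t x = lim (\<lambda>k. approx k t x)"

lemma step_pos: "(1/2 :: real)^k > 0"
  by simp

lemma bounded_clinear_approx: "bounded_clinear (approx k t)"
  unfolding approx_def by (rule euler_pow_props(1)[OF step_pos])

lemma approx_norm_le: "norm (approx k t x) \<le> norm x"
  unfolding approx_def by (rule euler_pow_props(2)[OF step_pos])

lemmas approx_diff = bounded_clinear_diff[OF bounded_clinear_approx]

lemma steps_bounds:
  assumes "t \<ge> 0"
  shows "real (nat \<lfloor>t * 2^k\<rfloor>) * (1/2)^k \<le> t" "t - (1/2)^k \<le> real (nat \<lfloor>t * 2^k\<rfloor>) * (1/2)^k"
proof -
  have "0 \<le> t * 2^k" using assms by simp
  then have "real (nat \<lfloor>t * 2^k\<rfloor>) \<le> t * 2^k" "t * 2^k - 1 \<le> real (nat \<lfloor>t * 2^k\<rfloor>)"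
    by linarith+
  then have "real (nat \<lfloor>t * 2^k\<rfloor>) * (1/2)^k \<le> t * 2^k * (1/2)^k"
    "(t * 2^k - 1) * (1/2)^k \<le> real (nat \<lfloor>t * 2^k\<rfloor>) * (1/2)^k"
    by (auto intro!: mult_right_mono)
  then show "real (nat \<lfloor>t * 2^k\<rfloor>) * (1/2)^k \<le> t" "t - (1/2)^k \<le> real (nat \<lfloor>t * 2^k\<rfloor>) * (1/2)^k"
    by (simp_all add: power_one_over left_diff_distrib diff_divide_distrib)
qed

text \<open>Absorbs the rounding: doubling a number or adding two numbers before taking the floor
  gains at most one step.\<close>

lemma euler_pow_one_more:
  assumes h: "h > 0" and x: "x \<in> D" and n: "n = m \<or> n = Suc m"
  shows "norm ((euler h ^^ m) x - (euler h ^^ n) x) \<le> h * norm (A x)"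
proof (cases "n = m")
  case False
  with n have "(euler h ^^ m) x - (euler h ^^ n) x = (euler h ^^ m) (x - euler h x)"
    by (simp add: bounded_clinear_diff[OF euler_pow_props(1)[OF h]] funpow_swap1)
  then have "norm ((euler h ^^ m) x - (euler h ^^ n) x) \<le> norm (x - euler h x)"
    using euler_pow_props(2)[OF h] by metis
  also have "\<dots> \<le> h * norm (A x)"
    using euler_near[OF h x] by (simp add: norm_minus_commute)
  finally show ?thesis .
qed (use h in simp)

lemma approx_Suc:
  assumes t: "t \<ge> 0" and x: "x \<in> D" "A x \<in> D"
  shows "norm (approx (Suc k) t x - approx k t x) \<le> (1/2)^k * (t * norm (A (A x)) + norm (A x))"
proof -
  define h :: real where "h = (1/2)^k"
  have h: "h > 0" by (simp add: h_def)
  define m where "m = nat \<lfloor>t * 2^k\<rfloor>"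
  define n where "n = nat \<lfloor>t * 2^(Suc k)\<rfloor>"
  have "0 \<le> t * 2^k" using t by simp
  moreover have "t * 2 ^ Suc k = 2 * (t * 2^k)" by simp
  ultimately have n: "n = 2 * m \<or> n = Suc (2 * m)"
    unfolding n_def m_def by linarith
  have "approx (Suc k) t x - approx k t x = - (((euler h ^^ m) x - (euler (h / 2) ^^ (2 * m)) x)
      + ((euler (h / 2) ^^ (2 * m)) x - (euler (h / 2) ^^ n) x))"
    by (simp add: approx_def h_def n_def m_def)
  then have "norm (approx (Suc k) t x - approx k t x)
      \<le> norm ((euler h ^^ m) x - (euler (h / 2) ^^ (2 * m)) x)
      + norm ((euler (h / 2) ^^ (2 * m)) x - (euler (h / 2) ^^ n) x)"
    by (metis norm_minus_cancel norm_triangle_ineq)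
  also have "\<dots> \<le> real m * (h\<^sup>2 / 4 * norm (A (A x))) + h / 2 * norm (A x)"
    using h by (intro add_mono euler_pow_halve euler_pow_one_more x n) auto
  also have "\<dots> = (real m * h) * (h / 4 * norm (A (A x))) + h / 2 * norm (A x)"
    by (simp add: power2_eq_square)
  also have "\<dots> \<le> t * (h / 4 * norm (A (A x))) + h / 2 * norm (A x)"
    using steps_bounds(1)[OF t, of k] h
    by (intro add_mono mult_right_mono) (auto simp: m_def h_def)
  also have "\<dots> = h * (t * norm (A (A x)) / 4 + norm (A x) / 2)"
    by (simp add: algebra_simps)
  also have "\<dots> \<le> h * (t * norm (A (A x)) + norm (A x))"
    using h t by (intro mult_left_mono add_mono) (auto simp: mult_nonneg_nonneg)
  finally show ?thesis by (simp add: h_def)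
qed

text \<open>On the domain of the square of \<open>A\<close> the refinement errors are summable,
  being geometric in \<open>k\<close>. Uniform contractivity extends the Cauchy property from this
  dense set to all vectors.\<close>

lemma approx_convergent:
  assumes t: "t \<ge> 0"
  shows "(\<lambda>k. approx k t x) \<longlonglongrightarrow> flow t x"
proof -
  have core: "Cauchy (\<lambda>k. approx k t y)" if y: "y \<in> D" "A y \<in> D" for y
  proof -
    have "summable (\<lambda>k. (1/2)^k * (t * norm (A (A y)) + norm (A y)))"
      by (intro summable_mult2 summable_geometric) simp
    then have "summable (\<lambda>k. approx (Suc k) t y - approx k t y)"
      using approx_Suc[OF t y] by (rule summable_comparison_test'[where N = 0])
    then have "convergent (\<lambda>n. \<Sum>k<n. approx (Suc k) t y - approx k t y)"
      by (simp add: summable_iff_convergent)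
    then have "convergent (\<lambda>n. approx n t y - approx 0 t y)"
      unfolding sum_lessThan_telescope[of "\<lambda>k. approx k t y"] .
    then have "convergent (\<lambda>n. approx n t y - approx 0 t y + approx 0 t y)"
      by (intro convergent_add convergent_const)
    then show ?thesis
      by (simp add: convergent_Cauchy)
  qed
  have "Cauchy (\<lambda>k. approx k t x)"
  proof (rule metric_CauchyI)
    fix e :: real assume e: "e > 0"
    obtain y where y: "y \<in> D" "A y \<in> D" "norm (x - y) < e / 3"
      using dense_approx2[of "e / 3" x] e by auto
    obtain N where N: "\<And>m n. m \<ge> N \<Longrightarrow> n \<ge> N \<Longrightarrow> dist (approx m t y) (approx n t y) < e / 3"
      using metric_CauchyD[OF core[OF y(1,2)], of "e / 3"] e by auto
    have near: "dist (approx k t x) (approx k t y) < e / 3" for k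
      using approx_norm_le[of k t "x - y"] y(3) by (simp add: dist_norm approx_diff)
    have "dist (approx m t x) (approx n t x) < e" if "m \<ge> N" "n \<ge> N" for m n
      using near[of m] near[of n] N[OF that]
        dist_triangle[of "approx m t x" "approx n t x" "approx m t y"]
        dist_triangle[of "approx m t y" "approx n t x" "approx n t y"]
      by (simp add: dist_commute)
    then show "\<exists>N. \<forall>m\<ge>N. \<forall>n\<ge>N. dist (approx m t x) (approx n t x) < e"
      by blast
  qed
  then show ?thesis
    unfolding flow_def by (simp add: Cauchy_convergent_iff convergent_LIMSEQ_iff)
qed

section \<open>The limit flow and its generator\<close>

lemma flow_norm_le:
  assumes "t \<ge> 0"
  shows "norm (flow t x) \<le> norm x"
  by (rule LIMSEQ_le_const2[OF tendsto_norm[OF approx_convergent[OF assms]]])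
    (auto intro: approx_norm_le)

lemma bounded_clinear_flow:
  assumes t: "t \<ge> 0"
  shows "bounded_clinear (flow t)"
proof (rule bounded_clinearI)
  note lim = approx_convergent[OF t]
  show "flow t (x + y) = flow t x + flow t y" for x y
    using tendsto_add[OF lim[of x] lim[of y]] lim[of "x + y"]
    by (simp add: bounded_clinear_add[OF bounded_clinear_approx] LIMSEQ_unique)
  show "flow t (c *\<^sub>C x) = c *\<^sub>C flow t x" for c x
    using bounded_linear.tendsto[OF bounded_clinear_bounded_linear[OF bounded_clinear_scaleC_id]
        lim[of x], of c] lim[of "c *\<^sub>C x"]
    by (simp add: bounded_clinear_scaleC[OF bounded_clinear_approx] LIMSEQ_unique)
  show "norm (flow t x) \<le> 1 * norm x" for x
    using flow_norm_le[OF t] by simp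
qed

lemmas flow_diff = bounded_clinear_diff[OF bounded_clinear_flow]

lemma approx_add:
  assumes "s \<ge> 0" "t \<ge> 0" and x: "x \<in> D"
  shows "norm (approx k s (approx k t x) - approx k (s + t) x) \<le> (1/2)^k * norm (A x)"
proof -
  define a where "a = s * 2^k"
  define b where "b = t * 2^k"
  have ab: "0 \<le> a" "0 \<le> b" "(s + t) * 2^k = a + b"
    using assms by (simp_all add: a_def b_def algebra_simps)
  then have n: "nat \<lfloor>(s + t) * 2^k\<rfloor> = nat \<lfloor>a\<rfloor> + nat \<lfloor>b\<rfloor> \<or> nat \<lfloor>(s + t) * 2^k\<rfloor> = Suc (nat \<lfloor>a\<rfloor> + nat \<lfloor>b\<rfloor>)"
    unfolding ab(3) by linarith
  have "approx k s (approx k t x) = (euler ((1/2)^k) ^^ (nat \<lfloor>a\<rfloor> + nat \<lfloor>b\<rfloor>)) x"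
    by (simp add: approx_def a_def b_def funpow_add)
  then show ?thesis
    using euler_pow_one_more[OF step_pos x n] by (simp add: approx_def)
qed

text \<open>On \<open>D\<close> the semigroup law holds for the approximations up to one grid step,
  which vanishes in the limit; density and contractivity give the rest.\<close>

lemma flow_add:
  assumes s: "s \<ge> 0" and t: "t \<ge> 0"
  shows "flow (s + t) x = flow s (flow t x)"
proof -
  have core: "flow (s + t) y = flow s (flow t y)" if y: "y \<in> D" for y
  proof (rule LIMSEQ_unique)
    show "(\<lambda>k. approx k (s + t) y) \<longlonglongrightarrow> flow (s + t) y"
      using s t by (intro approx_convergent) simp
    have "(\<lambda>k. approx k s (approx k t y - flow t y)) \<longlonglongrightarrow> 0"
    proof (rule Lim_null_comparison)
      show "\<forall>\<^sub>F k in sequentially. norm (approx k s (approx k t y - flow t y)) \<le> norm (approx k t y - flow t y)"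
        by (intro always_eventually allI approx_norm_le)
      show "(\<lambda>k. norm (approx k t y - flow t y)) \<longlonglongrightarrow> 0"
        using approx_convergent[OF t] by (simp add: tendsto_norm_zero LIM_zero)
    qed
    from tendsto_add[OF this approx_convergent[OF s, of "flow t y"]]
    have "(\<lambda>k. approx k s (approx k t y)) \<longlonglongrightarrow> flow s (flow t y)"
      by (simp add: approx_diff)
    moreover have "(\<lambda>k. approx k s (approx k t y) - approx k (s + t) y) \<longlonglongrightarrow> 0"
    proof (rule Lim_null_comparison)
      show "\<forall>\<^sub>F k in sequentially. norm (approx k s (approx k t y) - approx k (s + t) y) \<le> (1/2)^k * norm (A y)"
        by (intro always_eventually allI approx_add s t y)
      show "(\<lambda>k. (1/2)^k * norm (A y)) \<longlonglongrightarrow> 0"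
        by (intro tendsto_mult_left_zero LIMSEQ_realpow_zero) auto
    qed
    ultimately show "(\<lambda>k. approx k (s + t) y) \<longlonglongrightarrow> flow s (flow t y)"
      using tendsto_diff by fastforce
  qed
  have "norm (flow (s + t) x - flow s (flow t x)) \<le> e" if e: "e > 0" for e
  proof -
    obtain y where y: "y \<in> D" "norm (x - y) < e / 2"
      using dense_approx[of "e / 2" x] e by auto
    have st: "s + t \<ge> 0" using s t by simp
    have "flow (s + t) x - flow s (flow t x) = flow (s + t) (x - y) - flow s (flow t (x - y))"
      by (simp add: flow_diff[OF st] flow_diff[OF s] flow_diff[OF t] core[OF y(1)])
    then have "norm (flow (s + t) x - flow s (flow t x))
        \<le> norm (flow (s + t) (x - y)) + norm (flow s (flow t (x - y)))"
      by (metis norm_triangle_ineq4)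
    also have "\<dots> \<le> norm (x - y) + norm (x - y)"
      by (intro add_mono flow_norm_le st order_trans[OF flow_norm_le[OF s] flow_norm_le[OF t]])
    also have "\<dots> \<le> e" using y(2) by simp
    finally show ?thesis .
  qed
  then have "norm (flow (s + t) x - flow s (flow t x)) \<le> 0"
    by (rule field_le_epsilon) simp
  then show ?thesis by simp
qed

lemma flow_near:
  assumes t: "t \<ge> 0" and x: "x \<in> D"
  shows "norm (flow t x - x) \<le> t * norm (A x)"
proof (rule LIMSEQ_le_const2)
  show "(\<lambda>k. norm (approx k t x - x)) \<longlonglongrightarrow> norm (flow t x - x)"
    by (intro tendsto_intros approx_convergent t)
  have "norm (approx k t x - x) \<le> t * norm (A x)" for k
  proof -
    have "norm (approx k t x - x) \<le> real (nat \<lfloor>t * 2^k\<rfloor>) * (1/2)^k * norm (A x)"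
      unfolding approx_def by (rule euler_pow_props(5)[OF step_pos x])
    also have "\<dots> \<le> t * norm (A x)"
      by (intro mult_right_mono steps_bounds t) simp
    finally show ?thesis .
  qed
  then show "\<exists>N. \<forall>n\<ge>N. norm (approx n t x - x) \<le> t * norm (A x)"
    by blast
qed

lemma flow_first_order:
  assumes t: "t \<ge> 0" and x: "x \<in> D" and z: "z \<in> D"
  shows "norm (flow t x - x - t *\<^sub>R A x) \<le> t * (t * norm (A z) + 2 * norm (A x - z))"
proof (rule LIMSEQ_le)
  define \<tau> where "\<tau> k = real (nat \<lfloor>t * 2^k\<rfloor>) * (1/2)^k" for k
  have "(\<lambda>k. (1/2 :: real)^k) \<longlonglongrightarrow> 0"
    by (intro LIMSEQ_realpow_zero) auto
  then have "(\<lambda>k. t - (1/2)^k) \<longlonglongrightarrow> t - 0"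
    by (intro tendsto_diff tendsto_const)
  then have \<tau>: "\<tau> \<longlonglongrightarrow> t"
    by (intro real_tendsto_sandwich[OF _ _ _ tendsto_const, of "\<lambda>k. t - (1/2)^k" \<tau>])
      (use steps_bounds[OF t] in \<open>auto simp: \<tau>_def\<close>)
  show "(\<lambda>k. norm (approx k t x - x - \<tau> k *\<^sub>R A x)) \<longlonglongrightarrow> norm (flow t x - x - t *\<^sub>R A x)"
    by (intro tendsto_intros approx_convergent t \<tau>)
  show "(\<lambda>k. \<tau> k * (\<tau> k * norm (A z) + 2 * norm (A x - z)))
      \<longlonglongrightarrow> t * (t * norm (A z) + 2 * norm (A x - z))"
    by (intro tendsto_intros \<tau>)
  show "\<exists>N. \<forall>k\<ge>N. norm (approx k t x - x - \<tau> k *\<^sub>R A x)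
      \<le> \<tau> k * (\<tau> k * norm (A z) + 2 * norm (A x - z))"
    unfolding approx_def \<tau>_def using euler_pow_first_order[OF step_pos x z] by blast
qed

lemma flow_tendsto_0: "((\<lambda>t. flow t x) \<longlongrightarrow> x) (at_right 0)"
proof (rule tendstoI)
  fix e :: real assume e: "e > 0"
  obtain y where y: "y \<in> D" "norm (x - y) < e / 3"
    using dense_approx[of "e / 3" x] e by auto
  define b where "b = e / (3 * (norm (A y) + 1))"
  have p: "norm (A y) + 1 > 0"
    using norm_ge_zero[of "A y"] by linarith
  then have b: "b > 0" using e by (simp add: b_def)
  have "dist (flow t x) x < e" if t: "0 < t" "t < b" for t
  proof -
    have t0: "t \<ge> 0" using t by simp
    have "t * norm (A y) \<le> b * (norm (A y) + 1)"
      using t by (intro mult_mono) auto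
    also have "\<dots> = e / 3" using p by (simp add: b_def del: distrib_left_numeral)
    finally have "norm (flow t y - y) \<le> e / 3"
      using flow_near[OF t0 y(1)] by linarith
    moreover have "norm (flow t (x - y)) \<le> norm (x - y)"
      by (rule flow_norm_le[OF t0])
    moreover have "flow t x - x = flow t (x - y) + (flow t y - y) - (x - y)"
      by (simp add: flow_diff[OF t0])
    then have "norm (flow t x - x) \<le> norm (flow t (x - y)) + norm (flow t y - y) + norm (x - y)"
      by (metis norm_triangle_ineq4 norm_triangle_ineq add_right_mono order_trans)
    ultimately show ?thesis
      using y(2) by (simp add: dist_norm)
  qed
  with b show "\<forall>\<^sub>F t in at_right 0. dist (flow t x) x < e"
    by (auto simp: eventually_at_right_field)
qed

lemma C0_semigroup_flow: "C0_semigroup flow"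
  unfolding C0_semigroup_def
proof (intro conjI allI impI)
  show "bounded_clinear (flow t)" if "0 \<le> t" for t
    using that by (rule bounded_clinear_flow)
  show "flow 0 = id"
    by (rule ext) (simp add: flow_def approx_def)
  show "flow (s + t) = flow s \<circ> flow t" if "0 \<le> s" "0 \<le> t" for s t
    using flow_add[OF that] by (simp add: fun_eq_iff)
qed (rule flow_tendsto_0)

lemma flow_derivative:
  assumes x: "x \<in> D"
  shows "((\<lambda>t. (flow t x - x) /\<^sub>R t) \<longlongrightarrow> A x) (at_right 0)"
proof (rule tendstoI)
  fix e :: real assume e: "e > 0"
  \<comment> \<open>The order of choice matters: \<open>z\<close> makes the second error term small,
    and only then is \<open>t\<close> made small relative to \<open>norm (A z)\<close>, which may be
    large.\<close>
  obtain z where z: "z \<in> D" "norm (A x - z) < e / 4"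
    using dense_approx[of "e / 4" "A x"] e by auto
  define b where "b = e / (2 * (norm (A z) + 1))"
  have p: "norm (A z) + 1 > 0"
    using norm_ge_zero[of "A z"] by linarith
  then have b: "b > 0" using e by (simp add: b_def)
  have "dist ((flow t x - x) /\<^sub>R t) (A x) < e" if t: "0 < t" "t < b" for t
  proof -
    have "t * norm (A z) \<le> b * (norm (A z) + 1)"
      using t by (intro mult_mono) auto
    also have "\<dots> = e / 2" using p by (simp add: b_def del: distrib_left_numeral)
    finally have "t * norm (A z) + 2 * norm (A x - z) < e"
      using z(2) by linarith
    then have "t * (t * norm (A z) + 2 * norm (A x - z)) < t * e"
      using t(1) by (rule mult_strict_left_mono)
    define w where "w = flow t x - x - t *\<^sub>R A x"
    have "norm w \<le> t * (t * norm (A z) + 2 * norm (A x - z))"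
      unfolding w_def using t(1) by (intro flow_first_order x z(1)) simp
    also note \<open>t * (t * norm (A z) + 2 * norm (A x - z)) < t * e\<close>
    finally have "norm w < t * e" .
    moreover have "(flow t x - x) /\<^sub>R t - A x = w /\<^sub>R t"
      using t(1) by (simp add: w_def scaleR_diff_right)
    ultimately show ?thesis
      using t(1) by (simp add: dist_norm field_simps)
  qed
  with b show "\<forall>\<^sub>F t in at_right 0. dist ((flow t x - x) /\<^sub>R t) (A x) < e"
    by (auto simp: eventually_at_right_field)
qed

text \<open>The generator of the flow is a dissipative extension of \<open>A\<close>, and an m-dissipative
  operator has no proper dissipative extension.\<close>

lemma is_generator_flow: "is_generator flow D A"
proof -
  have "x \<in> D" if y: "((\<lambda>t. (flow t x - x) /\<^sub>R t) \<longlongrightarrow> y) (at_right 0)" for x y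
  proof -
    \<comment> \<open>\<open>x'\<close> in \<open>D\<close> has the same image under
      \<open>1 - A\<close> as \<open>x\<close> has under one minus the generator. Hence the orbit of
      \<open>w = x - x'\<close> has derivative \<open>w\<close> at 0, which contractivity allows
      only for \<open>w = 0\<close>.\<close>
    define x' where "x' = euler 1 (x - y)"
    have x': "x' \<in> D" "x' - A x' = x - y"
      using euler_mem[of 1 "x - y"] euler_eq[of 1 "x - y"] by (auto simp: x'_def)
    define w where "w = x - x'"
    have w: "y - A x' = w"
      using x'(2) by (simp add: w_def algebra_simps)
    have "((\<lambda>t. (flow t x - x) /\<^sub>R t - (flow t x' - x') /\<^sub>R t) \<longlongrightarrow> y - A x') (at_right 0)"
      by (intro tendsto_diff y flow_derivative x')
    moreover have "\<forall>\<^sub>F t in at_right 0. (flow t x - x) /\<^sub>R t - (flow t x' - x') /\<^sub>R t = (flow t w - w) /\<^sub>R t"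
      unfolding eventually_at_right_field
      by (intro exI[of _ 1]) (auto simp: w_def flow_diff algebra_simps)
    ultimately have "((\<lambda>t. (flow t w - w) /\<^sub>R t) \<longlongrightarrow> w) (at_right 0)"
      unfolding w by (rule Lim_transform_eventually)
    then have "((\<lambda>t. Re (cinner ((flow t w - w) /\<^sub>R t) w)) \<longlongrightarrow> Re (cinner w w)) (at_right 0)"
      by (intro tendsto_Re bounded_linear.tendsto[OF
            bounded_bilinear.bounded_linear_left[OF bounded_bilinear_cinner]])
    moreover have "\<forall>\<^sub>F t in at_right 0. Re (cinner ((flow t w - w) /\<^sub>R t) w) \<le> 0"
      unfolding eventually_at_right_field
    proof (intro exI[of _ 1] conjI allI impI)
      fix t :: real assume "0 < t" "t < 1"
      have "Re (cinner (flow t w) w) \<le> norm (flow t w) * norm w"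
        by (rule Re_cinner_le)
      also have "\<dots> \<le> norm w * norm w"
        using \<open>0 < t\<close> by (intro mult_right_mono flow_norm_le) auto
      finally have "Re (cinner (flow t w - w) w) \<le> 0"
        by (simp add: cinner_diff_left Re_cinner_self power2_eq_square)
      then show "Re (cinner ((flow t w - w) /\<^sub>R t) w) \<le> 0"
        using \<open>0 < t\<close> unfolding Re_cinner_scaleR_left by (simp add: mult_nonneg_nonpos)
    qed simp
    ultimately have "Re (cinner w w) \<le> 0"
      by (rule tendsto_upperbound) simp
    then have "w = 0"
      by (simp add: Re_cinner_self)
    with x'(1) show ?thesis by (simp add: w_def)
  qed
  then show ?thesis
    unfolding is_generator_def using flow_derivative by blast
qed

theorem generates_contraction_semigroup: "generates_contraction_semigroup D A"
  unfolding generates_contraction_semigroup_def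
  using C0_semigroup_flow is_generator_flow flow_norm_le
  by (intro exI[of _ flow]) (auto intro!: onorm_bound)

end

section \<open>Boundary nodes and their transfer functions\<close>

lemma norm_le_graph_norm: "norm x \<le> graph_norm L x"
  and norm_image_le_graph_norm: "norm (L x) \<le> graph_norm L x"
  and graph_norm_le: "graph_norm L x \<le> norm x + norm (L x)"
  unfolding graph_norm_def
  by (auto intro!: real_le_rsqrt sqrt_sum_squares_le_sum)

lemma clinear_on_Ker_on:
  assumes L: "clinear_on D L" and G: "clinear_on D G"
  shows "clinear_on (Ker_on D G) L"
  using assms clinear_on_zero[OF G] unfolding clinear_on_def Ker_on_def by auto

text \<open>The data from which the solution operator H(z) is built at a resolvent point. They are
  separated from passivity and from \<open>K\<close> so that the feedback operator \<open>G0\<close>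
  can share the construction.\<close>

locale boundary_lift =
  fixes D :: "'x::chilbert_space set" and G :: "'x \<Rightarrow> 'u::chilbert_space" and L :: "'x \<Rightarrow> 'x"
    and Gr :: "'u \<Rightarrow> 'x" and c :: real
  assumes L_linear: "clinear_on D L" and G_linear: "clinear_on D G"
    and Gr_mem: "Gr u \<in> D"
    and Gr_bound: "graph_norm L (Gr u) \<le> c * norm u" and G_Gr: "G (Gr u) = u"
begin

context
  fixes z :: complex
  assumes z: "z \<in> resolvent_set (Ker_on D G) L"
begin

abbreviation "R \<equiv> resolvent (Ker_on D G) L z"
abbreviation "H \<equiv> transfer_H D G L z"

lemma R_mem: "R y \<in> D" and G_R: "G (R y) = 0" and R_eq: "z *\<^sub>C R y - L (R y) = y"
  using resolvent_mem[OF z, of y] resolvent_right_inverse[OF z] by (auto simp: Ker_on_def)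

lemma R_eqI: "x \<in> D \<Longrightarrow> G x = 0 \<Longrightarrow> z *\<^sub>C x - L x = y \<Longrightarrow> R y = x"
  using resolvent_eqI[OF z] by (simp add: Ker_on_def)

lemmas R_bounded_clinear = resolvent_bounded_clinear[OF z]

text \<open>The right inverse attains the boundary value, and the resolvent removes the residual it
  leaves in the equation without changing that value. Two solutions differ by an element of the
  kernel of \<open>G\<close> on which \<open>z - L\<close> vanishes.\<close>

lemma transfer_H_solution:
  defines "x u \<equiv> Gr u - R (z *\<^sub>C Gr u - L (Gr u))"
  shows "H u = x u" and "H u \<in> D" and "z *\<^sub>C H u - L (H u) = 0" and "G (H u) = u"
proof -
  let ?y = "z *\<^sub>C Gr u - L (Gr u)"
  have x: "x u \<in> D"
    unfolding x_def by (intro clinear_on_diff_mem[OF L_linear] Gr_mem R_mem)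
  have eq: "z *\<^sub>C x u - L (x u) = 0"
  proof -
    have "L (x u) = L (Gr u) - L (R ?y)"
      unfolding x_def by (intro clinear_on_diff[OF L_linear] Gr_mem R_mem)
    then have "z *\<^sub>C x u - L (x u) = ?y - (z *\<^sub>C R ?y - L (R ?y))"
      by (simp add: x_def scaleC_diff_right)
    then show ?thesis by (simp only: R_eq diff_self)
  qed
  have G: "G (x u) = u"
    unfolding x_def by (subst clinear_on_diff[OF G_linear Gr_mem R_mem]) (simp add: G_R G_Gr)
  show *: "H u = x u"
    unfolding transfer_H_def
  proof (rule the_equality)
    show "x u \<in> D \<and> z *\<^sub>C x u - L (x u) = 0 \<and> G (x u) = u"
      using x eq G by blast
    fix x' assume x': "x' \<in> D \<and> z *\<^sub>C x' - L x' = 0 \<and> G x' = u"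
    then have "R 0 = x' - x u"
      using x eq G
      by (intro R_eqI) (auto simp: clinear_on_diff_mem[OF L_linear] clinear_on_diff[OF G_linear]
          clinear_on_diff[OF L_linear] scaleC_diff_right)
    then show "x' = x u"
      using bounded_clinear_0[OF R_bounded_clinear] by simp
  qed
  show "H u \<in> D" "z *\<^sub>C H u - L (H u) = 0" "G (H u) = u"
    unfolding * by fact+
qed

lemmas H_mem = transfer_H_solution(2) and H_eq = transfer_H_solution(3)
  and G_H = transfer_H_solution(4)

lemma L_H: "L (H u) = z *\<^sub>C H u"
  using H_eq[of u] by simp

text \<open>Subtracting the homogeneous solution with the same boundary value leaves an element of
  the kernel of \<open>G\<close>, where the resolvent applies.\<close>

lemma decomposition:
  assumes x: "x \<in> D" and y: "z *\<^sub>C x - L x = y"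
  shows "x = H (G x) + R y"
proof -
  have "R y = x - H (G x)"
    using x y by (intro R_eqI)
      (auto simp: clinear_on_diff_mem[OF L_linear] clinear_on_diff[OF G_linear]
          clinear_on_diff[OF L_linear] scaleC_diff_right H_mem G_H L_H)
  then show ?thesis by simp
qed

lemma H_eqI:
  assumes "x \<in> D" "z *\<^sub>C x - L x = 0" "G x = u"
  shows "H u = x"
  using decomposition[OF assms(1,2)] assms(3) bounded_clinear_0[OF R_bounded_clinear] by simp

lemma H_bounded_clinear: "bounded_clinear H"
proof (rule bounded_clinearI)
  show "H (u + v) = H u + H v" for u v
    by (rule H_eqI) (simp_all add: clinear_on_add_mem[OF L_linear] H_mem G_H L_H
        clinear_on_add[OF L_linear] clinear_on_add[OF G_linear] scaleC_add_right)
  show "H (a *\<^sub>C u) = a *\<^sub>C H u" for a u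
    by (rule H_eqI) (simp_all add: clinear_on_scaleC_mem[OF L_linear] H_mem G_H L_H
        clinear_on_scaleC[OF L_linear] clinear_on_scaleC[OF G_linear] scaleC_scaleC mult.commute)
  let ?r = "onorm R"
  show "norm (H u) \<le> (c + ?r * (cmod z * c + c)) * norm u" for u
  proof -
    have g: "norm (Gr u) \<le> c * norm u" "norm (L (Gr u)) \<le> c * norm u"
      using norm_le_graph_norm[of "Gr u" L] norm_image_le_graph_norm[of L "Gr u"] Gr_bound[of u]
      by linarith+
    have "norm (z *\<^sub>C Gr u - L (Gr u)) \<le> norm (z *\<^sub>C Gr u) + norm (L (Gr u))"
      by (rule norm_triangle_ineq4)
    also have "\<dots> \<le> cmod z * (c * norm u) + c * norm u"
      unfolding norm_scaleC by (intro add_mono mult_left_mono g) simp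
    finally have "norm (R (z *\<^sub>C Gr u - L (Gr u))) \<le> ?r * (cmod z * (c * norm u) + c * norm u)"
      by (intro order_trans[OF bounded_clinear_onorm[OF R_bounded_clinear]] mult_left_mono
          bounded_clinear_onorm_nonneg[OF R_bounded_clinear])
    then have "norm (H u) \<le> c * norm u + ?r * (cmod z * (c * norm u) + c * norm u)"
      unfolding transfer_H_solution(1) using g(1) norm_triangle_ineq4 order_trans add_mono by meson
    then show ?thesis by (simp add: algebra_simps)
  qed
qed

end

end

locale passive_node =
  fixes D :: "'x::chilbert_space set" and G :: "'x \<Rightarrow> 'u::chilbert_space" and L :: "'x \<Rightarrow> 'x"
    and K :: "'x \<Rightarrow> 'u"
  assumes node: "boundary_node D G L K" and imp_passive: "impedance_passive D G L K"
begin

lemma K_linear: "clinear_on D K"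
  using node by (simp add: boundary_node_def)

text \<open>A boundary node only asserts that a right inverse exists; fixing a choice provides the
  terms needed for the sublocale.\<close>

definition Gr :: "'u \<Rightarrow> 'x" where
  "Gr = (SOME Gr. range Gr \<subseteq> D \<and>
        (\<exists>c. \<forall>u. graph_norm L (Gr u) \<le> c * norm u) \<and> (\<forall>u. G (Gr u) = u))"

definition cr :: real where
  "cr = (SOME c. \<forall>u. graph_norm L (Gr u) \<le> c * norm u)"

sublocale boundary_lift D G L Gr cr
proof -
  have "\<exists>Gr. range Gr \<subseteq> D \<and>
        (\<exists>c. \<forall>u. graph_norm L (Gr u) \<le> c * norm u) \<and> (\<forall>u. G (Gr u) = u)"
    using node by (auto simp: boundary_node_def)
  then have Gr: "range Gr \<subseteq> D \<and>
        (\<exists>c. \<forall>u. graph_norm L (Gr u) \<le> c * norm u) \<and> (\<forall>u. G (Gr u) = u)"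
    unfolding Gr_def by (rule someI_ex)
  then have "\<exists>c. \<forall>u. graph_norm L (Gr u) \<le> c * norm u" by blast
  then have cr: "\<forall>u. graph_norm L (Gr u) \<le> cr * norm u"
    unfolding cr_def by (rule someI_ex)
  show "boundary_lift D G L Gr cr"
    using Gr cr node by unfold_locales (auto simp: boundary_node_def)
qed

text \<open>The boundary term of the passivity inequality vanishes on the kernel of
  \<open>G\<close>, so the restriction is dissipative as well as a generator.\<close>

lemma right_half_plane: "Re z > 0 \<Longrightarrow> z \<in> resolvent_set (Ker_on D G) L"
proof (rule dissipative_generator_resolvent_set)
  show "clinear_on (Ker_on D G) L"
    using L_linear G_linear by (rule clinear_on_Ker_on)
  show "dissipative (Ker_on D G) L"
    using imp_passive by (auto simp: dissipative_def impedance_passive_def Ker_on_def)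
  show "generates_C0_semigroup (Ker_on D G) L"
    using node by (simp add: boundary_node_def)
qed

abbreviation P :: "complex \<Rightarrow> 'u \<Rightarrow> 'u" where
  "P \<equiv> transfer_P D G L K"

lemma K_H: "K (transfer_H D G L z u) = P z u"
  by (simp add: transfer_P_def)

lemma K_decomposition:
  assumes z: "z \<in> resolvent_set (Ker_on D G) L" and x: "x \<in> D" "z *\<^sub>C x - L x = y"
  shows "K x = P z (G x) + K (R z y)"
proof -
  have "K (H z (G x) + R z y) = P z (G x) + K (R z y)"
    by (simp add: clinear_on_add[OF K_linear] H_mem[OF z] R_mem[OF z] K_H)
  then show ?thesis
    using decomposition[OF z x] by simp
qed

lemma P_bounded_clinear:
  assumes z: "z \<in> resolvent_set (Ker_on D G) L"
  shows "bounded_clinear (P z)"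
proof -
  obtain k where k: "\<And>x. x \<in> D \<Longrightarrow> norm (K x) \<le> k * graph_norm L x"
    using node by (auto simp: boundary_node_def)
  let ?h = "onorm (H z)"
  note Hb = H_bounded_clinear[OF z]
  show ?thesis
  proof (rule bounded_clinearI)
    show "P z (u + v) = P z u + P z v" for u v
      by (simp add: transfer_P_def bounded_clinear_add[OF Hb] clinear_on_add[OF K_linear] H_mem[OF z])
    show "P z (a *\<^sub>C u) = a *\<^sub>C P z u" for a u
      by (simp add: transfer_P_def bounded_clinear_scaleC[OF Hb] clinear_on_scaleC[OF K_linear] H_mem[OF z])
    show "norm (P z u) \<le> \<bar>k\<bar> * (1 + cmod z) * ?h * norm u" for u
    proof -
      have g: "0 \<le> graph_norm L (H z u)"
        by (simp add: graph_norm_def)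
      have "norm (P z u) \<le> k * graph_norm L (H z u)"
        unfolding transfer_P_def by (rule k[OF H_mem[OF z]])
      also have "\<dots> \<le> \<bar>k\<bar> * graph_norm L (H z u)"
        using g by (intro mult_right_mono) auto
      also have "\<dots> \<le> \<bar>k\<bar> * ((1 + cmod z) * norm (H z u))"
        using graph_norm_le[of L "H z u"]
        by (intro mult_left_mono) (simp_all add: L_H[OF z] norm_scaleC algebra_simps)
      also have "\<dots> \<le> \<bar>k\<bar> * ((1 + cmod z) * (?h * norm u))"
        by (intro mult_left_mono bounded_clinear_onorm[OF Hb]) auto
      finally show ?thesis by (simp add: mult.assoc)
    qed
  qed
qed

text \<open>Passivity at the solution \<open>H z u\<close>, where \<open>L\<close> acts as
  \<open>z\<close>. It makes P accretive and also bounds the square of H by P, which is the source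
  of the square roots below.\<close>

lemma P_accretive:
  assumes z: "z \<in> resolvent_set (Ker_on D G) L"
  shows "Re z * (norm (H z u))\<^sup>2 \<le> Re (cinner (P z u) u)"
proof -
  have "Re (cinner (L (H z u)) (H z u)) \<le> Re (cinner (G (H z u)) (K (H z u)))"
    using imp_passive H_mem[OF z] by (simp add: impedance_passive_def)
  then show ?thesis
    by (simp add: L_H[OF z] G_H[OF z] K_H cinner_scaleC_left cinner_self Re_cinner_commute)
qed

text \<open>Boundedness of \<open>G\<close> in the graph norm controls \<open>u = G H(z) u\<close> by \<open>H(z) u\<close>, because
  \<open>L\<close> acts on the range of \<open>H(z)\<close> as multiplication by \<open>z\<close>.\<close>

lemma P_coercive:
  assumes z: "Re z > 0"
  obtains \<delta> where "\<delta> > 0" "\<And>u. \<delta> * (norm u)\<^sup>2 \<le> Re (cinner (P z u) u)"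
proof -
  note zr = right_half_plane[OF z]
  obtain g where g: "\<And>x. x \<in> D \<Longrightarrow> norm (G x) \<le> g * graph_norm L x"
    using node by (auto simp: boundary_node_def)
  define b where "b = (\<bar>g\<bar> + 1) * (1 + cmod z)"
  have b: "b > 0"
    unfolding b_def by (intro mult_pos_pos) (auto simp: add_pos_nonneg)
  have u_le: "norm u \<le> b * norm (H z u)" for u
  proof -
    have "norm u \<le> g * graph_norm L (H z u)"
      using g[OF H_mem[OF zr], of u] by (simp add: G_H[OF zr])
    also have "\<dots> \<le> (\<bar>g\<bar> + 1) * graph_norm L (H z u)"
      by (intro mult_right_mono) (auto simp: graph_norm_def)
    also have "\<dots> \<le> (\<bar>g\<bar> + 1) * ((1 + cmod z) * norm (H z u))"
      using graph_norm_le[of L "H z u"]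
      by (intro mult_left_mono) (simp_all add: L_H[OF zr] norm_scaleC algebra_simps)
    finally show ?thesis by (simp add: b_def mult.assoc)
  qed
  show thesis
  proof (rule that)
    show "Re z / b\<^sup>2 > 0" using z b by simp
    fix u
    have "(norm u)\<^sup>2 \<le> (b * norm (H z u))\<^sup>2"
      by (intro power_mono u_le) simp
    then have "Re z / b\<^sup>2 * (norm u)\<^sup>2 \<le> Re z / b\<^sup>2 * (b * norm (H z u))\<^sup>2"
      using z b by (intro mult_left_mono) auto
    also have "\<dots> = Re z * (norm (H z u))\<^sup>2"
      using b by (simp add: power_mult_distrib)
    also have "\<dots> \<le> Re (cinner (P z u) u)"
      by (rule P_accretive[OF zr])
    finally show "Re z / b\<^sup>2 * (norm u)\<^sup>2 \<le> Re (cinner (P z u) u)" .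
  qed
qed

section \<open>Bounds at real part one and their shift to the imaginary axis\<close>

context
  fixes w :: complex and p :: real
  assumes w: "Re w = 1" and p: "p \<ge> 1" "onorm (P w) \<le> p"
begin

lemma wr: "w \<in> resolvent_set (Ker_on D G) L"
  using w by (intro right_half_plane) simp

lemma norm_P_le: "norm (P w u) \<le> p * norm u"
  using P_bounded_clinear[OF wr] p(2) by (rule bounded_clinear_norm_le)

lemma Re_P_le: "Re (cinner (P w u) u) \<le> p * (norm u)\<^sup>2"
proof -
  have "Re (cinner (P w u) u) \<le> norm (P w u) * norm u"
    by (rule Re_cinner_le)
  also have "\<dots> \<le> p * norm u * norm u"
    by (intro mult_right_mono norm_P_le) simp
  finally show ?thesis by (simp add: power2_eq_square)
qed

lemma norm_H_le: "norm (H w u) \<le> sqrt p * norm u"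
proof (rule power2_le_imp_le)
  show "(norm (H w u))\<^sup>2 \<le> (sqrt p * norm u)\<^sup>2"
    using P_accretive[OF wr, of u] Re_P_le[of u] w p by (simp add: power_mult_distrib)
qed (use p in simp)

text \<open>Passivity for \<open>x = R(w) y + H(w) u\<close> with the optimal choice \<open>u = - K R(w) y / (2 p)\<close>.\<close>

lemma norm_K_R_le: "norm (K (R w y)) \<le> sqrt p * norm y"
proof (rule power2_le_imp_le)
  define k where "k = K (R w y)"
  define u where "u = (- 1 / (2 * p)) *\<^sub>R k"
  define x where "x = H w u + R w y"
  have x: "x \<in> D" "G x = u" "K x = P w u + k" "L x = w *\<^sub>C x - y"
  proof -
    show "x \<in> D"
      unfolding x_def by (intro clinear_on_add_mem[OF L_linear] H_mem R_mem wr)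
    show "G x = u"
      unfolding x_def by (subst clinear_on_add[OF G_linear H_mem[OF wr] R_mem[OF wr]])
        (simp add: G_H[OF wr] G_R[OF wr])
    show "K x = P w u + k"
      unfolding x_def by (subst clinear_on_add[OF K_linear H_mem[OF wr] R_mem[OF wr]])
        (simp add: K_H k_def)
    have "L x = L (H w u) + L (R w y)"
      unfolding x_def by (rule clinear_on_add[OF L_linear H_mem[OF wr] R_mem[OF wr]])
    also have "L (R w y) = w *\<^sub>C R w y - y"
      using R_eq[OF wr, of y] by (simp add: algebra_simps)
    finally show "L x = w *\<^sub>C x - y"
      by (simp add: x_def L_H[OF wr] scaleC_add_right)
  qed
  have "Re (cinner (L x) x) \<le> Re (cinner (G x) (K x))"
    using imp_passive x(1) by (simp add: impedance_passive_def)
  \<comment> \<open>\<open>Re w = 1\<close> puts the full square of \<open>norm x\<close> on the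
    left; Young's inequality for \<open>cinner y x\<close> uses exactly that amount, so
    \<open>x\<close> drops out.\<close>
  then have "(norm x)\<^sup>2 - Re (cinner y x) \<le> Re (cinner u (P w u)) + Re (cinner u k)"
    unfolding x(2-4) by (simp add: cinner_diff_left cinner_scaleC_left cinner_self w cinner_add_right)
  moreover have "Re (cinner y x) \<le> (norm x)\<^sup>2 + (norm y)\<^sup>2 / 4"
  proof -
    have "0 \<le> (norm x - norm y / 2)\<^sup>2" by simp
    then show ?thesis
      using Re_cinner_le[of y x] by (simp add: power2_diff power_divide mult.commute)
  qed
  moreover have "Re (cinner u (P w u)) \<le> p * (norm u)\<^sup>2"
    using Re_P_le[of u] by (simp add: Re_cinner_commute)
  ultimately have "- Re (cinner u k) \<le> p * (norm u)\<^sup>2 + (norm y)\<^sup>2 / 4"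
    by linarith
  moreover have "Re (cinner u k) = - (norm k)\<^sup>2 / (2 * p)"
    unfolding u_def Re_cinner_scaleR_left Re_cinner_self by simp
  moreover have "p * (norm u)\<^sup>2 = (norm k)\<^sup>2 / (4 * p)"
    using p by (simp add: u_def power_divide power_mult_distrib power2_eq_square)
  ultimately have "(norm k)\<^sup>2 / (2 * p) \<le> (norm k)\<^sup>2 / (4 * p) + (norm y)\<^sup>2 / 4"
    by simp
  then have "(norm k)\<^sup>2 \<le> p * (norm y)\<^sup>2"
    using p by (simp add: field_simps)
  then show "(norm (K (R w y)))\<^sup>2 \<le> (sqrt p * norm y)\<^sup>2"
    using p by (simp add: k_def power_mult_distrib)
qed (use p in simp)

context
  fixes z :: complex and m :: real
  assumes z: "z \<in> resolvent_set (Ker_on D G) L" and zw: "w = 1 + z"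
    and m: "\<And>y. norm (R z y) \<le> m * norm y"
begin

lemma norm_add_R_le: "norm (y + R z y) \<le> (1 + m) * norm y"
  using norm_triangle_ineq[of y "R z y"] m[of y] by (simp add: algebra_simps)

text \<open>Resolvent identity with \<open>w - z = 1\<close>:
  \<open>R(z) y = R(w) (y + R(z) y)\<close>.\<close>

lemma norm_K_R_shift_le: "norm (K (R z y)) \<le> sqrt p * (1 + m) * norm y"
proof -
  have "R w (y + R z y) = R z y"
    using R_eq[OF z, of y]
    by (intro R_eqI[OF wr] R_mem[OF z] G_R[OF z])
      (simp add: zw scaleC_add_left algebra_simps)
  then have "norm (K (R z y)) \<le> sqrt p * norm (y + R z y)"
    using norm_K_R_le[of "y + R z y"] by simp
  also have "\<dots> \<le> sqrt p * ((1 + m) * norm y)"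
    using p by (intro mult_left_mono norm_add_R_le) simp
  finally show ?thesis by (simp add: mult.assoc)
qed

text \<open>As \<open>w - z = 1\<close>, the solution at \<open>w\<close> solves the equation at
  \<open>z\<close> up to the right-hand side \<open>- H w u\<close>, and the resolvent corrects
  this.\<close>

lemma H_shift: "H z u = H w u + R z (H w u)"
proof -
  have "z *\<^sub>C H w u - L (H w u) = - H w u"
    unfolding L_H[OF wr] by (simp add: zw scaleC_add_left)
  from decomposition[OF z H_mem[OF wr] this] show ?thesis
    by (simp add: G_H[OF wr] bounded_clinear_minus[OF R_bounded_clinear[OF z]] algebra_simps)
qed

lemma norm_H_shift_le:
  assumes "m \<ge> 0"
  shows "norm (H z u) \<le> sqrt p * (1 + m) * norm u"
proof -
  have "norm (H z u) \<le> (1 + m) * norm (H w u)"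
    unfolding H_shift by (rule norm_add_R_le)
  also have "\<dots> \<le> (1 + m) * (sqrt p * norm u)"
    using assms by (intro mult_left_mono norm_H_le) simp
  finally show ?thesis by (simp add: mult_ac)
qed

text \<open>In \<open>P(z) = P(w) + K R(z) H(w)\<close> the factors \<open>K R(z)\<close> and
  \<open>H(w)\<close> contribute one \<open>sqrt p\<close> each, so the total stays linear in
  \<open>p\<close>.\<close>

lemma norm_P_shift_le:
  assumes "m \<ge> 0"
  shows "norm (P z u) \<le> p * (2 + m) * norm u"
proof -
  have "P z u = P w u + K (R z (H w u))"
    by (simp add: transfer_P_def H_shift clinear_on_add[OF K_linear] H_mem[OF wr] R_mem[OF z])
  then have "norm (P z u) \<le> norm (P w u) + norm (K (R z (H w u)))"
    by (simp add: norm_triangle_ineq)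
  also have "\<dots> \<le> p * norm u + sqrt p * (1 + m) * (sqrt p * norm u)"
    using p assms
    by (intro add_mono norm_P_le order_trans[OF norm_K_R_shift_le] mult_left_mono norm_H_le) auto
  also have "\<dots> = p * norm u + (sqrt p * sqrt p) * (1 + m) * norm u"
    by (simp only: mult_ac)
  also have "\<dots> = p * (2 + m) * norm u"
    using p by (simp add: algebra_simps)
  finally show ?thesis .
qed

end

end

end

section \<open>The coupled system\<close>

text \<open>Here \<open>a\<close>, \<open>b\<close>, \<open>v\<close> are to be the norms of x1, x2
  and u, \<open>y\<close> that of the right-hand side, and \<open>\<alpha>\<close> the product of
  N0, M2 and 1 plus the norm of P2 at \<open>1 + is\<close>. The bounds for \<open>a\<close> and
  \<open>v\<close> refer to each other, and the proof absorbs half of \<open>a\<close>.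
  \<open>C\<close> is chosen before all these quantities, which makes the final constant independent
  of s.\<close>

lemma coupled_estimate:
  fixes A1 A2 k :: real
  assumes nonneg: "0 \<le> A1" "0 \<le> A2" "0 \<le> k"
  obtains C where "C > 0"
    "\<And>a b v y \<alpha> \<eta> m. \<lbrakk>0 \<le> a; 0 \<le> v; 0 \<le> y; 0 \<le> \<alpha>; 0 < \<eta>; 0 \<le> m;
        a \<le> A1 * (\<alpha> * v) + A2 * (\<alpha> * y) + m * y;
        \<eta> * v\<^sup>2 \<le> a * y + k * \<alpha> * v * y;
        b \<le> k * (\<alpha> * v + \<alpha> * y);
        \<eta> \<le> k * \<alpha>\<rbrakk> \<Longrightarrow> a + b \<le> C * (m + \<alpha>\<^sup>2 / \<eta>) * y"
proof -
  \<comment> \<open>Small enough for \<open>A1 * t \<le> 1 / 2\<close>, so that the part of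
    \<open>a\<close> returning through \<open>v\<close> is absorbed.\<close>
  define t where "t = 1 / (2 * (A1 + 1))"
  \<comment> \<open>Chosen so that \<open>(t * a + c * (B * y))^2\<close> dominates
    \<open>2 * a * (B * y) + (k * (B * y))^2\<close>: \<open>t * c = 1 + t * k \<ge> 1\<close>
    covers the mixed term, and \<open>c \<ge> k\<close> the square.\<close>
  define c where "c = 1 / t + k"
  define Ca where "Ca = 2 * (A1 * c + A2 * k + 1)"
  define C where "C = Ca + k * (t * Ca + c + k)"
  have t: "0 < t" "A1 * t \<le> 1 / 2"
    using nonneg by (auto simp: t_def field_simps)
  have c: "0 \<le> c" using t nonneg by (simp add: c_def)
  have Ca: "Ca > 0"
    using nonneg c by (simp add: Ca_def add_nonneg_pos)
  have C: "C > 0"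
    using Ca nonneg t c by (simp add: C_def add_pos_nonneg)
  show thesis
  proof (rule that[OF C])
    fix a b v y \<alpha> \<eta> m :: real
    assume pos: "0 \<le> a" "0 \<le> v" "0 \<le> y" "0 \<le> \<alpha>" "0 < \<eta>" "0 \<le> m"
      and a: "a \<le> A1 * (\<alpha> * v) + A2 * (\<alpha> * y) + m * y"
      and v: "\<eta> * v\<^sup>2 \<le> a * y + k * \<alpha> * v * y"
      and b: "b \<le> k * (\<alpha> * v + \<alpha> * y)"
      and \<eta>: "\<eta> \<le> k * \<alpha>"
    define B where "B = \<alpha>\<^sup>2 / \<eta>"
    have B: "0 \<le> B" using pos by (simp add: B_def)
    \<comment> \<open>The upper bound on \<open>\<eta>\<close> lets a term linear in
      \<open>\<alpha>\<close> be absorbed by the quadratic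
      \<open>B = \<alpha>^2 / \<eta>\<close>.\<close>
    have \<alpha>y: "\<alpha> * y \<le> k * (B * y)"
    proof -
      have "\<eta> * \<alpha> \<le> k * \<alpha> * \<alpha>"
        using \<eta> pos by (intro mult_right_mono) auto
      then have "\<alpha> \<le> k * B"
        using pos by (simp add: B_def field_simps power2_eq_square)
      then have "\<alpha> * y \<le> k * B * y"
        using pos by (intro mult_right_mono) auto
      then show ?thesis by (simp add: mult.assoc)
    qed
    have \<alpha>v: "\<alpha> * v \<le> t * a + c * (B * y)"
    proof (rule power2_le_imp_le)
      \<comment> \<open>Young's inequality, weighted so that half of \<open>\<eta> * v^2\<close> can
        be moved to the left; multiplying by \<open>B\<close> then turns that side into
        \<open>(\<alpha> * v)^2\<close>.\<close>
      have "k * \<alpha> * v * y \<le> \<eta> * v\<^sup>2 / 2 + (k * \<alpha> * y)\<^sup>2 / (2 * \<eta>)"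
      proof -
        have "0 \<le> (\<eta> * v - k * \<alpha> * y)\<^sup>2" by simp
        then have "2 * \<eta> * (k * \<alpha> * v * y) \<le> \<eta> * (\<eta> * v\<^sup>2) + (k * \<alpha> * y)\<^sup>2"
          by (simp add: power2_diff power_mult_distrib power2_eq_square algebra_simps)
        then show ?thesis using pos by (simp add: field_simps power2_eq_square)
      qed
      with v have "\<eta> * v\<^sup>2 \<le> 2 * a * y + (k * \<alpha> * y)\<^sup>2 / \<eta>"
        by (simp add: field_simps)
      then have "B * (\<eta> * v\<^sup>2) \<le> B * (2 * a * y + (k * \<alpha> * y)\<^sup>2 / \<eta>)"
        using B by (rule mult_left_mono)
      moreover have "B * (\<eta> * v\<^sup>2) = (\<alpha> * v)\<^sup>2"
        using pos by (simp add: B_def power_mult_distrib)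
      moreover have "B * (2 * a * y + (k * \<alpha> * y)\<^sup>2 / \<eta>) = 2 * (a * (B * y)) + (k * (B * y))\<^sup>2"
        using pos by (simp add: B_def field_simps power2_eq_square)
      ultimately have "(\<alpha> * v)\<^sup>2 \<le> 2 * (a * (B * y)) + (k * (B * y))\<^sup>2"
        by simp
      also have "\<dots> \<le> (t * a + c * (B * y))\<^sup>2"
      proof -
        have By: "0 \<le> B * y" using B pos by simp
        have "(t * a + c * (B * y))\<^sup>2
            = (t * a)\<^sup>2 + 2 * (1 + t * k) * (a * (B * y)) + (c * (B * y))\<^sup>2"
          using t by (simp add: c_def power2_sum field_simps power2_eq_square)
        moreover have "2 * (a * (B * y)) \<le> 2 * (1 + t * k) * (a * (B * y))"
          using t nonneg pos By by (simp add: mult_right_mono)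
        moreover have "(k * (B * y))\<^sup>2 \<le> (c * (B * y))\<^sup>2"
          using t nonneg By by (intro power_mono mult_right_mono) (auto simp: c_def)
        ultimately show ?thesis
          using zero_le_power2[of "t * a"] by linarith
      qed
      finally show "(\<alpha> * v)\<^sup>2 \<le> (t * a + c * (B * y))\<^sup>2" .
    qed (use t c pos B in simp)
    define F where "F = (m + B) * y"
    have F: "B * y \<le> F" "m * y \<le> F" "0 \<le> F"
      using pos B by (auto simp: F_def mult_right_mono)
    have aF: "a \<le> Ca * F"
    proof -
      have "A1 * (\<alpha> * v) \<le> A1 * (t * a + c * F)"
        using \<alpha>v mult_left_mono[OF F(1) c] nonneg by (intro mult_left_mono) auto
      moreover have "A1 * (t * a + c * F) \<le> a / 2 + A1 * c * F"
        using mult_right_mono[OF t(2) pos(1)] by (simp add: algebra_simps)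
      moreover have "A2 * (\<alpha> * y) \<le> A2 * (k * F)"
        using \<alpha>y mult_left_mono[OF F(1) nonneg(3)] nonneg by (intro mult_left_mono) auto
      ultimately have "a \<le> a / 2 + A1 * c * F + A2 * (k * F) + F"
        using a F(2) by linarith
      then show ?thesis by (simp add: Ca_def algebra_simps)
    qed
    have "b \<le> k * ((t * Ca + c + k) * F)"
    proof -
      have "\<alpha> * v \<le> t * (Ca * F) + c * F"
        using \<alpha>v mult_left_mono[OF aF, of t] mult_left_mono[OF F(1) c] t by linarith
      moreover have "\<alpha> * y \<le> k * F"
        using \<alpha>y mult_left_mono[OF F(1) nonneg(3)] by linarith
      ultimately have "\<alpha> * v + \<alpha> * y \<le> (t * Ca + c + k) * F"
        by (simp add: algebra_simps)
      then show ?thesis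
        using b nonneg(3) mult_left_mono order_trans by meson
    qed
    with aF have "a + b \<le> C * F"
      by (simp add: C_def algebra_simps)
    then show "a + b \<le> C * (m + \<alpha>\<^sup>2 / \<eta>) * y"
      by (simp add: F_def B_def mult.assoc)
  qed
qed

locale coupled_nodes =
  n1: passive_node D1 G1 L1 K1 + n2: passive_node D2 G2 L2 K2
  for D1 :: "'x1::chilbert_space set" and D2 :: "'x2::chilbert_space set"
    and G1 K1 :: "'x1 \<Rightarrow> 'u1::chilbert_space" and L1 :: "'x1 \<Rightarrow> 'x1"
    and G2 K2 :: "'x2 \<Rightarrow> 'u2::chilbert_space" and L2 :: "'x2 \<Rightarrow> 'x2" +
  fixes J :: "'u1 \<Rightarrow> 'u2"
  assumes J: "bounded_clinear J"
begin

definition DA :: "('x1 \<times> 'x2) set" where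
  "DA = {(x1, x2). x1 \<in> D1 \<and> x2 \<in> D2 \<and> G1 x1 = cadjoint J (K2 x2) \<and> G2 x2 = - J (K1 x1)}"

definition A :: "'x1 \<times> 'x2 \<Rightarrow> 'x1 \<times> 'x2" where
  "A = (\<lambda>(x1, x2). (L1 x1, L2 x2))"

lemma Jt: "bounded_clinear (cadjoint J)"
  using J by (rule bounded_clinear_cadjoint)

lemma A_linear: "clinear_on DA A"
  unfolding clinear_on_def DA_def A_def
  by (auto simp: zero_prod_def scaleC_prod_def
      clinear_on_zero_mem[OF n1.L_linear] clinear_on_zero_mem[OF n2.L_linear]
      clinear_on_zero[OF n1.G_linear] clinear_on_zero[OF n2.G_linear]
      clinear_on_zero[OF n1.K_linear] clinear_on_zero[OF n2.K_linear]
      clinear_on_add_mem[OF n1.L_linear] clinear_on_add_mem[OF n2.L_linear]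
      clinear_on_scaleC_mem[OF n1.L_linear] clinear_on_scaleC_mem[OF n2.L_linear]
      clinear_on_add[OF n1.L_linear] clinear_on_add[OF n2.L_linear]
      clinear_on_add[OF n1.G_linear] clinear_on_add[OF n2.G_linear]
      clinear_on_add[OF n1.K_linear] clinear_on_add[OF n2.K_linear]
      clinear_on_scaleC[OF n1.L_linear] clinear_on_scaleC[OF n2.L_linear]
      clinear_on_scaleC[OF n1.G_linear] clinear_on_scaleC[OF n2.G_linear]
      clinear_on_scaleC[OF n1.K_linear] clinear_on_scaleC[OF n2.K_linear]
      bounded_clinear_0[OF J] bounded_clinear_0[OF Jt]
      bounded_clinear_add[OF J] bounded_clinear_add[OF Jt]
      bounded_clinear_scaleC[OF J] bounded_clinear_scaleC[OF Jt] scaleC_minus_right)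

lemma Re_cinner_cadjoint: "Re (cinner (cadjoint J v) u) = Re (cinner v (J u))"
  by (metis cinner_cadjoint[OF J] Re_cinner_commute)

text \<open>The interconnection preserves power: what the coupling feeds into the first node it
  takes from the second. Added to passivity of the second node this gives dissipativity; by itself
  it later bounds the boundary value u.\<close>

lemma Re_L1_le:
  assumes "(x1, x2) \<in> DA"
  shows "Re (cinner (L1 x1) x1) \<le> - Re (cinner (K2 x2) (G2 x2))"
proof -
  have "Re (cinner (L1 x1) x1) \<le> Re (cinner (G1 x1) (K1 x1))"
    using assms n1.imp_passive by (auto simp: DA_def impedance_passive_def)
  also have "\<dots> = - Re (cinner (K2 x2) (G2 x2))"
    using assms by (simp add: DA_def Re_cinner_cadjoint cinner_minus_right)
  finally show ?thesis .
qed

lemma A_dissipative: "dissipative DA A"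
  unfolding dissipative_def
proof
  fix x assume "x \<in> DA"
  then obtain x1 x2 where x: "x = (x1, x2)" "(x1, x2) \<in> DA"
    by (cases x) auto
  have "Re (cinner (L2 x2) x2) \<le> Re (cinner (G2 x2) (K2 x2))"
    using x n2.imp_passive by (auto simp: DA_def impedance_passive_def)
  with Re_L1_le[OF x(2)] show "Re (cinner (A x) x) \<le> 0"
    by (simp add: x(1) A_def cinner_prod_def Re_cinner_commute)
qed

text \<open>With \<open>x_i = H_i u_i + R_i y_i\<close>, eliminating \<open>u1\<close> leaves
  \<open>u2 + S P2 u2 = - S k2 - J k1\<close>, where S = J P1 J^*. A kernel of
  \<open>cadjoint J\<close> can destroy coercivity of \<open>S\<close>, so that of \<open>P2\<close>
  is used.\<close>

lemma A_surj:
  assumes l: "l > 0"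
  shows "\<exists>x\<in>DA. complex_of_real l *\<^sub>C x - A x = y"
proof -
  define z where "z = complex_of_real l"
  have Rez: "Re z > 0" using l by (simp add: z_def)
  note z1 = n1.right_half_plane[OF Rez] and z2 = n2.right_half_plane[OF Rez]
  note P1 = n1.P_bounded_clinear[OF z1] and P2 = n2.P_bounded_clinear[OF z2]
  define k1 where "k1 = K1 (n1.R z (fst y))"
  define k2 where "k2 = K2 (n2.R z (snd y))"
  define S where "S u = J (n1.P z (cadjoint J u))" for u
  have S: "bounded_clinear S"
    unfolding S_def
    by (rule bounded_clinear_compose[OF J bounded_clinear_compose[OF P1 Jt]])
  have S_accretive: "0 \<le> Re (cinner (S u) u)" for u
  proof -
    have "0 \<le> Re z * (norm (n1.H z (cadjoint J u)))\<^sup>2"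
      using Rez by simp
    also have "\<dots> \<le> Re (cinner (n1.P z (cadjoint J u)) (cadjoint J u))"
      by (rule n1.P_accretive[OF z1])
    also have "\<dots> = Re (cinner (S u) u)"
      by (simp add: S_def cinner_cadjoint[OF J])
    finally show ?thesis .
  qed
  obtain \<delta> where \<delta>: "\<delta> > 0" "\<And>u. \<delta> * (norm u)\<^sup>2 \<le> Re (cinner (n2.P z u) u)"
    using n2.P_coercive[OF Rez] by blast
  obtain W where W: "bounded_clinear W" "\<And>f. W f + S (n2.P z (W f)) = f"
    using id_plus_accretive_coercive_inverse[OF S S_accretive P2 \<delta>] by blast
  define u2 where "u2 = W (- S k2 - J k1)"
  define u1 where "u1 = cadjoint J (n2.P z u2 + k2)"
  define x1 where "x1 = n1.H z u1 + n1.R z (fst y)"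
  define x2 where "x2 = n2.H z u2 + n2.R z (snd y)"
  have mem: "x1 \<in> D1" "x2 \<in> D2"
    unfolding x1_def x2_def
    by (intro clinear_on_add_mem[OF n1.L_linear] n1.H_mem[OF z1] n1.R_mem[OF z1]
        clinear_on_add_mem[OF n2.L_linear] n2.H_mem[OF z2] n2.R_mem[OF z2])+
  have G: "G1 x1 = u1" "G2 x2 = u2"
    unfolding x1_def x2_def
    by (simp_all add: clinear_on_add[OF n1.G_linear n1.H_mem[OF z1] n1.R_mem[OF z1]]
        clinear_on_add[OF n2.G_linear n2.H_mem[OF z2] n2.R_mem[OF z2]]
        n1.G_H[OF z1] n1.G_R[OF z1] n2.G_H[OF z2] n2.G_R[OF z2])
  have K: "K1 x1 = n1.P z u1 + k1" "K2 x2 = n2.P z u2 + k2"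
    unfolding x1_def x2_def
    by (simp_all add: clinear_on_add[OF n1.K_linear n1.H_mem[OF z1] n1.R_mem[OF z1]]
        clinear_on_add[OF n2.K_linear n2.H_mem[OF z2] n2.R_mem[OF z2]]
        n1.K_H n2.K_H k1_def k2_def)
  have "z *\<^sub>C x1 - L1 x1 = (z *\<^sub>C n1.H z u1 - L1 (n1.H z u1)) + (z *\<^sub>C n1.R z (fst y) - L1 (n1.R z (fst y)))"
    by (simp add: x1_def clinear_on_add[OF n1.L_linear n1.H_mem[OF z1] n1.R_mem[OF z1]]
        scaleC_add_right)
  then have e1: "z *\<^sub>C x1 - L1 x1 = fst y"
    by (simp only: n1.H_eq[OF z1] n1.R_eq[OF z1] add_0_left)
  have "z *\<^sub>C x2 - L2 x2 = (z *\<^sub>C n2.H z u2 - L2 (n2.H z u2)) + (z *\<^sub>C n2.R z (snd y) - L2 (n2.R z (snd y)))"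
    by (simp add: x2_def clinear_on_add[OF n2.L_linear n2.H_mem[OF z2] n2.R_mem[OF z2]]
        scaleC_add_right)
  then have e2: "z *\<^sub>C x2 - L2 x2 = snd y"
    by (simp only: n2.H_eq[OF z2] n2.R_eq[OF z2] add_0_left)
  have "u2 = - J (K1 x1)"
  proof -
    have "J (n1.P z u1) = S (n2.P z u2) + S k2"
      by (simp add: u1_def S_def bounded_clinear_add[OF Jt] bounded_clinear_add[OF P1]
          bounded_clinear_add[OF J])
    moreover have "u2 + S (n2.P z u2) = - S k2 - J k1"
      unfolding u2_def by (rule W)
    ultimately show ?thesis
      by (simp add: K bounded_clinear_add[OF J] algebra_simps eq_neg_iff_add_eq_0)
  qed
  then have "(x1, x2) \<in> DA"
    using mem by (simp add: DA_def G K u1_def)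
  moreover have "z *\<^sub>C (x1, x2) - A (x1, x2) = y"
    using e1 e2 by (simp add: A_def scaleC_prod_def)
  ultimately show ?thesis
    unfolding z_def by blast
qed

sublocale m_dissipative DA A
  using A_linear A_dissipative A_surj by unfold_locales

lemma A_right_half_plane: "Re z > 0 \<Longrightarrow> z \<in> resolvent_set DA A"
  using A_linear A_dissipative by (rule dissipative_right_half_plane[where ?l0.0 = 1]) (auto intro: A_surj)

text \<open>On the range of H1(z) the modified boundary operator acts as \<open>1 + S P1(z)\<close>
  with S = J^*QJ accretive and P1(z) coercive. Inverting it and then applying H1(z) gives the right
  inverse.\<close>

lemma modified_boundary_lift:
  assumes Q: "bounded_clinear Q" and Q_nonneg: "op_ge Q (\<lambda>_. 0)"
  shows "\<exists>Gr c. boundary_lift D1 (\<lambda>x. G1 x + cadjoint J (Q (J (K1 x)))) L1 Gr c"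
proof -
  \<comment> \<open>A point of the right half-plane at which \<open>L1\<close> is the identity on
    solutions, so the graph norm is at most twice the norm.\<close>
  define z :: complex where "z = 1"
  have Rez: "Re z > 0" by (simp add: z_def)
  note z1 = n1.right_half_plane[OF Rez]
  note P1 = n1.P_bounded_clinear[OF z1] and H1 = n1.H_bounded_clinear[OF z1]
  define S where "S u = cadjoint J (Q (J u))" for u
  have S: "bounded_clinear S"
    unfolding S_def
    by (rule bounded_clinear_compose[OF Jt bounded_clinear_compose[OF Q J]])
  have S_accretive: "0 \<le> Re (cinner (S u) u)" for u
  proof -
    have "cinner (Q (J u)) (J u) \<in> \<real>\<^sub>\<ge>\<^sub>0"
      using Q_nonneg by (simp add: op_ge_def)
    then show ?thesis
      by (simp add: S_def Re_cinner_cadjoint complex_nonneg_Reals_iff)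
  qed
  obtain \<delta> where \<delta>: "\<delta> > 0" "\<And>u. \<delta> * (norm u)\<^sup>2 \<le> Re (cinner (n1.P z u) u)"
    using n1.P_coercive[OF Rez] by blast
  obtain W where W: "bounded_clinear W" "\<And>f. W f + S (n1.P z (W f)) = f"
    using id_plus_accretive_coercive_inverse[OF S S_accretive P1 \<delta>] by blast
  define Gr where "Gr f = n1.H z (W f)" for f
  have Gr: "bounded_clinear Gr"
    unfolding Gr_def by (rule bounded_clinear_compose[OF H1 W(1)])
  have "boundary_lift D1 (\<lambda>x. G1 x + S (K1 x)) L1 Gr (2 * onorm Gr)"
  proof
    show "clinear_on D1 L1" by (rule n1.L_linear)
    show "clinear_on D1 (\<lambda>x. G1 x + S (K1 x))"
      using n1.G_linear n1.K_linear unfolding clinear_on_def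
      by (simp add: bounded_clinear_add[OF S] bounded_clinear_scaleC[OF S] scaleC_add_right)
    show "Gr u \<in> D1" for u
      unfolding Gr_def by (rule n1.H_mem[OF z1])
    show "graph_norm L1 (Gr u) \<le> 2 * onorm Gr * norm u" for u
      using graph_norm_le[of L1 "Gr u"] bounded_clinear_onorm[OF Gr, of u] n1.L_H[OF z1, of "W u"]
      by (simp add: Gr_def z_def)
    show "G1 (Gr u) + S (K1 (Gr u)) = u" for u
      using W(2)[of u] by (simp add: Gr_def n1.G_H[OF z1] n1.K_H)
  qed
  then show ?thesis
    unfolding S_def by blast
qed

end

text \<open>A nonzero vector in the second boundary space ties \<open>\<eta>\<close> to
  \<open>P2\<close>. Over the zero space coercivity holds for every \<open>\<eta>\<close>, and a
  large \<open>\<eta>\<close> would make the second term of the bound negligible while the resolvent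
  of the second node remains in \<open>A\<close>.\<close>

theorem theorem3p1:
  fixes D1 :: "'x1::chilbert_space set" and D2 :: "'x2::chilbert_space set"
    and G1 K1 :: "'x1 \<Rightarrow> 'u1::chilbert_space" and L1 :: "'x1 \<Rightarrow> 'x1"
    and G2 K2 :: "'x2 \<Rightarrow> 'u2::chilbert_space" and L2 :: "'x2 \<Rightarrow> 'x2"
    and J :: "'u1 \<Rightarrow> 'u2" and Q :: "'u2 \<Rightarrow> 'u2"
    and G0 :: "'x1 \<Rightarrow> 'u1" and D0 :: "'x1 set" and DA2 :: "'x2 set"
    and H0 :: "complex \<Rightarrow> 'u1 \<Rightarrow> 'x1" and P2 :: "complex \<Rightarrow> 'u2 \<Rightarrow> 'u2"
    and E :: "real set" and N0 M0 M2 \<eta> :: "real \<Rightarrow> real" and r :: real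
    and DA :: "('x1 \<times> 'x2) set" and A :: "'x1 \<times> 'x2 \<Rightarrow> 'x1 \<times> 'x2"
    and \<mu> :: "real \<Rightarrow> real"
  defines "G0 \<equiv> (\<lambda>x. G1 x + cadjoint J (Q (J (K1 x))))"
    and "D0 \<equiv> Ker_on D1 G0"
    and "H0 \<equiv> transfer_H D1 G0 L1"
    and "DA2 \<equiv> Ker_on D2 G2"
    and "P2 \<equiv> transfer_P D2 G2 L2 K2"
    and "DA \<equiv> {(x1, x2). x1 \<in> D1 \<and> x2 \<in> D2 \<and>
                 G1 x1 = cadjoint J (K2 x2) \<and> G2 x2 = - J (K1 x1)}"
    and "A \<equiv> (\<lambda>(x1, x2). (L1 x1, L2 x2))"
    and "\<mu> \<equiv> (\<lambda>s. 1 + (onorm (P2 (1 + \<i> * complex_of_real s)))\<^sup>2)"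
  assumes node1: "boundary_node D1 G1 L1 K1" and passive1: "impedance_passive D1 G1 L1 K1"
    and node2: "boundary_node D2 G2 L2 K2" and passive2: "impedance_passive D2 G2 L2 K2"
    and U2_nontrivial: "\<exists>u :: 'u2. u \<noteq> 0"
    and J: "bounded_clinear J"
    and Q: "bounded_clinear Q" and Q_selfadjoint: "cadjoint Q = Q"
    and Q_nonneg: "op_ge Q (\<lambda>_. 0)"
    and E_nonempty: "E \<noteq> {}"
    and E_resolvent: "E \<subseteq> {s. \<i> * complex_of_real s \<in> resolvent_set D0 L1 \<inter> resolvent_set DA2 L2}"
    and r: "r > 0"
    and N0_range: "\<And>s. s \<in> E \<Longrightarrow> N0 s \<ge> r"
    and M0_range: "\<And>s. s \<in> E \<Longrightarrow> M0 s \<ge> r"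
    and M2_range: "\<And>s. s \<in> E \<Longrightarrow> M2 s \<ge> r"
    and H0_bound: "\<And>s. s \<in> E \<Longrightarrow> onorm (H0 (\<i> * complex_of_real s)) \<le> N0 s"
    and M0_bound: "\<And>s. s \<in> E \<Longrightarrow> onorm (resolvent D0 L1 (\<i> * complex_of_real s)) \<le> M0 s"
    and M2_bound: "\<And>s. s \<in> E \<Longrightarrow> onorm (resolvent DA2 L2 (\<i> * complex_of_real s)) \<le> M2 s"
    and \<eta>_pos: "\<And>s. s \<in> E \<Longrightarrow> \<eta> s > 0"
    and Re_P2: "\<And>s. s \<in> E \<Longrightarrow>
      op_ge (Re_op (P2 (\<i> * complex_of_real s))) (\<lambda>u. complex_of_real (\<eta> s) *\<^sub>C u)"
  shows "generates_contraction_semigroup DA A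
    \<and> (\<forall>s\<in>E. \<i> * complex_of_real s \<in> resolvent_set DA A)
    \<and> (\<exists>C>0. \<forall>s\<in>E. onorm (resolvent DA A (\<i> * complex_of_real s))
          \<le> C * (M0 s + (N0 s)\<^sup>2 * (M2 s)\<^sup>2 * (\<mu> s / \<eta> s)))"
proof -
  interpret c: coupled_nodes D1 D2 G1 K1 L1 G2 K2 L2 J
    by unfold_locales (fact node1 passive1 node2 passive2 J)+
  have DA_eq: "DA = c.DA" and A_eq: "A = c.A"
    by (simp_all add: DA_def A_def c.DA_def c.A_def)
  obtain Gr cr where "boundary_lift D1 G0 L1 Gr cr"
    using c.modified_boundary_lift[OF Q Q_nonneg] unfolding G0_def by blast
  then interpret n0: boundary_lift D1 G0 L1 Gr cr .
  define j where "j = onorm (cadjoint J)"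
  define q where "q = onorm Q"
  \<comment> \<open>For \<open>m \<ge> r\<close> this gives \<open>2 + m \<le> \<kappa> * m\<close>,
    so the shifts produced by the resolvent identity become multiples of \<open>m\<close>.\<close>
  define \<kappa> where "\<kappa> = 1 + 2 / r"
  \<comment> \<open>The summand 1 ensures \<open>p s \<ge> 1\<close>, hence
    \<open>sqrt (p s) \<le> p s\<close>, and costs only a factor 2 in passing from the square of
    \<open>p s\<close> to \<open>\<mu> s\<close>.\<close>
  define p where "p s = 1 + onorm (P2 (1 + \<i> * complex_of_real s))" for s
  define \<alpha> where "\<alpha> s = N0 s * M2 s * p s" for s
  have j: "0 \<le> j" and q: "0 \<le> q"
    unfolding j_def q_def by (intro bounded_clinear_onorm_nonneg c.Jt Q)+
  have \<kappa>: "\<kappa> \<ge> 1" using r by (simp add: \<kappa>_def)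
  obtain C where C: "C > 0" and estimate:
    "\<And>a b v y \<alpha> \<eta> m. \<lbrakk>0 \<le> a; 0 \<le> v; 0 \<le> y; 0 \<le> \<alpha>; 0 < \<eta>; 0 \<le> m;
        a \<le> j * (\<kappa> + q / r) * (\<alpha> * v) + j * \<kappa> * (\<alpha> * y) + m * y;
        \<eta> * v\<^sup>2 \<le> a * y + \<kappa> / r * \<alpha> * v * y;
        b \<le> \<kappa> / r * (\<alpha> * v + \<alpha> * y);
        \<eta> \<le> \<kappa> / r * \<alpha>\<rbrakk> \<Longrightarrow> a + b \<le> C * (m + \<alpha>\<^sup>2 / \<eta>) * y"
    using coupled_estimate[of "j * (\<kappa> + q / r)" "j * \<kappa>" "\<kappa> / r"] j q \<kappa> r by auto
  define F where "F s = C * (M0 s + (\<alpha> s)\<^sup>2 / \<eta> s)" for s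
  \<comment> \<open>The last two claims do not involve \<open>x\<close> although the block fixes it;
    they are used later with \<open>x = 0\<close>.\<close>
  have key: "norm x \<le> F s * norm ((\<i> * complex_of_real s) *\<^sub>C x - A x)" and F_pos: "F s > 0"
    and F_le: "F s \<le> 2 * C * (M0 s + (N0 s)\<^sup>2 * (M2 s)\<^sup>2 * (\<mu> s / \<eta> s))"
    if s: "s \<in> E" and x_mem: "x \<in> DA" for s x
  proof -
    define z where "z = \<i> * complex_of_real s"
    define w where "w = 1 + z"
    define m where "m = M2 s"
    define N where "N = N0 s"
    define P where "P = p s"
    have z0: "z \<in> resolvent_set (Ker_on D1 G0) L1" and z2: "z \<in> resolvent_set (Ker_on D2 G2) L2"
      using E_resolvent s by (auto simp: z_def D0_def DA2_def)
    have Rew: "Re w = 1" by (simp add: w_def z_def)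
    have wr: "w \<in> resolvent_set (Ker_on D2 G2) L2"
      by (rule c.n2.right_half_plane) (simp add: Rew)
    have onorm_P2: "0 \<le> onorm (P2 w)"
      unfolding P2_def by (intro bounded_clinear_onorm_nonneg c.n2.P_bounded_clinear wr)
    have P_eq: "P = 1 + onorm (P2 w)"
      by (simp add: P_def p_def w_def z_def)
    have P: "1 \<le> P" "onorm (c.n2.P w) \<le> P"
      using onorm_P2 by (simp_all add: P_eq P2_def)
    have pos: "r \<le> N" "r \<le> m" "0 < \<eta> s" "r \<le> M0 s"
      using N0_range[OF s] M0_range[OF s] M2_range[OF s] \<eta>_pos[OF s] by (simp_all add: N_def m_def)
    have pos': "0 < N" "0 < m" "0 < M0 s" "0 < P" using pos r P by auto
    have R2: "norm (c.n2.R z y) \<le> m * norm y" for y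
      using M2_bound[OF s] by (intro bounded_clinear_norm_le[OF c.n2.R_bounded_clinear[OF z2]])
        (simp add: DA2_def z_def m_def)
    have R0: "norm (n0.R z y) \<le> M0 s * norm y" for y
      using M0_bound[OF s] by (intro bounded_clinear_norm_le[OF n0.R_bounded_clinear[OF z0]])
        (simp add: D0_def z_def)
    have H0n: "norm (n0.H z y) \<le> N * norm y" for y
      using H0_bound[OF s, unfolded H0_def] by (intro bounded_clinear_norm_le[OF n0.H_bounded_clinear[OF z0]])
        (simp add: z_def N_def)
    have \<alpha>: "\<alpha> s = N * m * P" "0 < \<alpha> s"
      using pos' by (simp_all add: \<alpha>_def N_def m_def P_def)
    have sqrtP: "sqrt P \<le> P"
      using P(1) by (intro real_le_lsqrt) (auto simp: power2_eq_square)
    \<comment> \<open>The bounds for the second node lack the factor N0; \<open>N \<ge> r\<close>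
      supplies it, which is the origin of the coefficients \<open>\<kappa> / r\<close>.\<close>
    have mP: "m * P \<le> \<alpha> s / r"
    proof -
      have "r * (m * P) \<le> N * (m * P)"
        using pos pos' by (intro mult_right_mono) auto
      then show ?thesis
        using r by (simp add: \<alpha> field_simps)
    qed
    have m_le: "1 + m \<le> \<kappa> * m" "2 + m \<le> \<kappa> * m"
    proof -
      have "1 \<le> m / r" using pos r by simp
      moreover have "\<kappa> * m = m + 2 * (m / r)"
        by (simp add: \<kappa>_def algebra_simps)
      ultimately show "1 + m \<le> \<kappa> * m" "2 + m \<le> \<kappa> * m"
        by linarith+
    qed
    have sqrt_le: "sqrt P * (1 + m) \<le> \<kappa> * (m * P)"
    proof -
      have "sqrt P * (1 + m) \<le> P * (\<kappa> * m)"
        using sqrtP m_le pos' by (intro mult_mono) auto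
      then show ?thesis by (simp add: mult_ac)
    qed
    have P_le: "P * (2 + m) \<le> \<kappa> * (m * P)"
      using mult_left_mono[OF m_le(2), of P] pos' by (simp add: mult_ac)
    have \<kappa>mP: "\<kappa> * (m * P) \<le> \<kappa> / r * \<alpha> s"
      using mult_left_mono[OF mP, of \<kappa>] \<kappa> by simp
    have KR_le: "norm (K2 (c.n2.R z y)) \<le> \<kappa> * (m * P) * norm y" for y
      using order_trans[OF c.n2.norm_K_R_shift_le[OF Rew P z2 w_def R2] mult_right_mono[OF sqrt_le]]
      by simp
    have H2_le: "norm (c.n2.H z u) \<le> \<kappa> * (m * P) * norm u" for u
      using order_trans[OF c.n2.norm_H_shift_le[OF Rew P z2 w_def R2] mult_right_mono[OF sqrt_le]]
        pos' by simp
    have P2_le: "norm (c.n2.P z u) \<le> \<kappa> * (m * P) * norm u" for u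
      using order_trans[OF c.n2.norm_P_shift_le[OF Rew P z2 w_def R2] mult_right_mono[OF P_le]]
        pos' by simp
    have P2_ge: "\<eta> s * (norm u)\<^sup>2 \<le> Re (cinner (c.n2.P z u) u)" for u
    proof -
      have "cinner (Re_op (c.n2.P z) u - complex_of_real (\<eta> s) *\<^sub>C u) u \<in> \<real>\<^sub>\<ge>\<^sub>0"
        using Re_P2[OF s] by (simp add: op_ge_def P2_def z_def)
      then have "Re (cinner (complex_of_real (\<eta> s) *\<^sub>C u) u) \<le> Re (cinner (Re_op (c.n2.P z) u) u)"
        by (simp add: complex_nonneg_Reals_iff cinner_diff_left)
      also have "Re (cinner (Re_op (c.n2.P z) u) u)
          = 1 / 2 * (Re (cinner (c.n2.P z u) u) + Re (cinner (cadjoint (c.n2.P z) u) u))"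
        by (simp add: Re_op_def cinner_scaleC_left cinner_add_left)
      also have "Re (cinner (cadjoint (c.n2.P z) u) u) = Re (cinner (c.n2.P z u) u)"
        by (metis cinner_cadjoint[OF c.n2.P_bounded_clinear[OF z2]] Re_cinner_commute)
      finally show ?thesis
        by (simp add: cinner_scaleC_left cinner_self)
    qed
    \<comment> \<open>At a nonzero \<open>u\<close> the coercivity constant of P2 cannot exceed the
      bound on its norm.\<close>
    have \<eta>_le: "\<eta> s \<le> \<kappa> / r * \<alpha> s"
    proof -
      obtain u :: 'u2 where u: "u \<noteq> 0" using U2_nontrivial by blast
      have "\<eta> s * norm u \<le> norm (c.n2.P z u)"
        using P2_ge by (rule coercive_lower_bound)
      also have "\<dots> \<le> \<kappa> * (m * P) * norm u" by (rule P2_le)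
      finally show ?thesis using u \<kappa>mP by simp
    qed
    obtain x1 x2 where x: "x = (x1, x2)" by (cases x) auto
    have mem: "x1 \<in> D1" "x2 \<in> D2" "G1 x1 = cadjoint J (K2 x2)" "G2 x2 = - J (K1 x1)"
      using x_mem by (auto simp: x DA_def)
    define y1 where "y1 = z *\<^sub>C x1 - L1 x1"
    define y2 where "y2 = z *\<^sub>C x2 - L2 x2"
    define y where "y = norm (z *\<^sub>C x - A x)"
    have y: "norm y1 \<le> y" "norm y2 \<le> y"
    proof -
      have "z *\<^sub>C x - A x = (y1, y2)"
        by (simp add: x A_def scaleC_prod_def y1_def y2_def)
      then show "norm y1 \<le> y" "norm y2 \<le> y"
        by (simp_all add: y_def norm_fst_le[of y1 y2, simplified] norm_Pair)
    qed
    have y0: "0 \<le> y" by (simp add: y_def)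
    define u where "u = G2 x2"
    have K2: "K2 x2 = c.n2.P z u + K2 (c.n2.R z y2)"
      unfolding u_def by (rule c.n2.K_decomposition[OF z2 mem(2)]) (simp add: y2_def)
    have KR_y: "norm (K2 (c.n2.R z y2)) \<le> \<kappa> * (m * P) * y"
      using order_trans[OF KR_le mult_left_mono[OF y(2)]] \<kappa> pos' by simp
    have x1_le: "norm x1 \<le> j * (\<kappa> + q / r) * (\<alpha> s * norm u) + j * \<kappa> * (\<alpha> s * y) + M0 s * y"
    proof -
      have "x1 = n0.H z (G0 x1) + n0.R z y1"
        by (rule n0.decomposition[OF z0 mem(1)]) (simp add: y1_def)
      \<comment> \<open>The coupling condition reads \<open>J (K1 x1) = - u\<close>, which turns the
        feedback on x1 into a term in \<open>u\<close> alone.\<close>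
      also have "G0 x1 = cadjoint J (K2 x2 - Q u)"
        using mem(3,4) by (simp add: G0_def u_def bounded_clinear_minus[OF Q]
            bounded_clinear_add[OF c.Jt, symmetric])
      finally have "norm x1 \<le> norm (n0.H z (cadjoint J (K2 x2 - Q u))) + norm (n0.R z y1)"
        by (metis norm_triangle_ineq)
      also have "\<dots> \<le> N * (j * norm (K2 x2 - Q u)) + M0 s * y"
        unfolding j_def using pos' y(1)
        by (intro add_mono order_trans[OF H0n] order_trans[OF R0] mult_left_mono
            bounded_clinear_onorm[OF c.Jt]) auto
      also have "norm (K2 x2 - Q u) \<le> \<kappa> * (m * P) * norm u + \<kappa> * (m * P) * y + q * norm u"
        using norm_triangle_ineq4[of "K2 x2" "Q u"] norm_triangle_ineq[of "c.n2.P z u" "K2 (c.n2.R z y2)"]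
          P2_le[of u] KR_y bounded_clinear_onorm[OF Q, of u] unfolding K2 q_def by linarith
      \<comment> \<open>The term from \<open>Q\<close> lacks the factor \<open>m * P\<close>, which
        is at least \<open>r\<close>.\<close>
      also have "q * norm u \<le> q / r * (m * P) * norm u"
      proof -
        have "r * 1 \<le> m * P" using pos P r by (intro mult_mono) auto
        then have "1 \<le> m * P / r" using r by simp
        then have "q * norm u * 1 \<le> q * norm u * (m * P / r)"
          using q by (intro mult_left_mono) auto
        then show ?thesis by (simp add: mult_ac)
      qed
      finally have "norm x1 \<le> N * (j * (\<kappa> * (m * P) * norm u + \<kappa> * (m * P) * y
          + q / r * (m * P) * norm u)) + M0 s * y"
        using pos' j by (simp add: mult_left_mono)
      then show ?thesis
        by (simp add: \<alpha> algebra_simps)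
    qed
    have u_le: "\<eta> s * (norm u)\<^sup>2 \<le> norm x1 * y + \<kappa> / r * \<alpha> s * norm u * y"
    proof -
      \<comment> \<open>As \<open>z\<close> is purely imaginary, \<open>z x1\<close> contributes
        nothing to the real part.\<close>
      have "Re (cinner y1 x1) = - Re (cinner (L1 x1) x1)"
        by (simp add: y1_def cinner_diff_left cinner_scaleC_left cinner_self z_def)
      then have "Re (cinner (K2 x2) u) \<le> Re (cinner y1 x1)"
        using c.Re_L1_le[of x1 x2] x_mem by (simp add: DA_eq x u_def)
      also have "\<dots> \<le> norm x1 * y"
        using order_trans[OF Re_cinner_le mult_right_mono[OF y(1)]] by (simp add: mult.commute)
      finally have 1: "Re (cinner (K2 x2) u) \<le> norm x1 * y" .
      have "- Re (cinner (K2 (c.n2.R z y2)) u) \<le> norm (K2 (c.n2.R z y2)) * norm u"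
        using Re_cinner_le[of "- K2 (c.n2.R z y2)" u] by (simp add: cinner_minus_left)
      also have "\<dots> \<le> \<kappa> / r * \<alpha> s * y * norm u"
        by (intro mult_right_mono order_trans[OF KR_y] mult_right_mono \<kappa>mP y0) simp
      finally have 2: "- Re (cinner (K2 (c.n2.R z y2)) u) \<le> \<kappa> / r * \<alpha> s * y * norm u" .
      have "Re (cinner (c.n2.P z u) u) = Re (cinner (K2 x2) u) - Re (cinner (K2 (c.n2.R z y2)) u)"
        by (simp add: K2 cinner_add_left)
      with 1 2 P2_ge[of u] show ?thesis
        by (simp add: mult_ac)
    qed
    have x2_le: "norm x2 \<le> \<kappa> / r * (\<alpha> s * norm u + \<alpha> s * y)"
    proof -
      have "x2 = c.n2.H z u + c.n2.R z y2"
        unfolding u_def by (rule c.n2.decomposition[OF z2 mem(2)]) (simp add: y2_def)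
      then have "norm x2 \<le> norm (c.n2.H z u) + norm (c.n2.R z y2)"
        by (metis norm_triangle_ineq)
      also have "\<dots> \<le> \<kappa> / r * \<alpha> s * norm u + \<kappa> / r * \<alpha> s * y"
      proof (rule add_mono)
        show "norm (c.n2.H z u) \<le> \<kappa> / r * \<alpha> s * norm u"
          by (rule order_trans[OF H2_le mult_right_mono[OF \<kappa>mP]]) simp
        have "m * 1 \<le> m * P" using pos' P by (intro mult_left_mono) auto
        also have "1 * (m * P) \<le> \<kappa> * (m * P)" using \<kappa> pos' by (intro mult_right_mono) auto
        finally have "m \<le> \<kappa> / r * \<alpha> s" using \<kappa>mP by simp
        then show "norm (c.n2.R z y2) \<le> \<kappa> / r * \<alpha> s * y"
          using R2[of y2] y(2) y0 pos' by (meson mult_mono norm_ge_zero order_trans less_imp_le)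
      qed
      finally show ?thesis by (simp add: algebra_simps)
    qed
    have "norm x \<le> norm x1 + norm x2"
      unfolding x by (rule norm_Pair_le)
    also have "\<dots> \<le> C * (M0 s + (\<alpha> s)\<^sup>2 / \<eta> s) * y"
      by (rule estimate) (use x1_le u_le x2_le \<eta>_le y0 \<alpha> pos pos' in auto)
    finally show "norm x \<le> F s * norm ((\<i> * complex_of_real s) *\<^sub>C x - A x)"
      by (simp add: F_def y_def z_def)
    show "F s > 0"
      using C pos pos' by (simp add: F_def add_pos_nonneg)
    have "P\<^sup>2 \<le> 2 * \<mu> s"
    proof -
      \<comment> \<open>This is \<open>(1 + t)^2 \<le> 2 * (1 + t^2)\<close> for
        \<open>t = onorm (P2 w)\<close>.\<close>
      have "0 \<le> (1 - onorm (P2 w))\<^sup>2" by simp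
      then show ?thesis
        by (simp add: P_eq \<mu>_def w_def z_def power2_sum power2_diff)
    qed
    then have "(N * m)\<^sup>2 / \<eta> s * P\<^sup>2 \<le> (N * m)\<^sup>2 / \<eta> s * (2 * \<mu> s)"
      using pos by (intro mult_left_mono) auto
    then have "(\<alpha> s)\<^sup>2 / \<eta> s \<le> 2 * (N\<^sup>2 * m\<^sup>2 * (\<mu> s / \<eta> s))"
      by (simp add: \<alpha> power_mult_distrib mult_ac)
    then have "M0 s + (\<alpha> s)\<^sup>2 / \<eta> s \<le> 2 * (M0 s + N\<^sup>2 * m\<^sup>2 * (\<mu> s / \<eta> s))"
      using pos' unfolding distrib_left by linarith
    then show "F s \<le> 2 * C * (M0 s + (N0 s)\<^sup>2 * (M2 s)\<^sup>2 * (\<mu> s / \<eta> s))"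
      using C mult_left_mono[of _ _ C] by (simp add: F_def N_def m_def mult_ac)
  qed
  have DA_0: "0 \<in> DA"
    unfolding DA_eq by (rule clinear_on_zero_mem[OF c.A_linear])
  have res: "\<i> * complex_of_real s \<in> resolvent_set DA A" if s: "s \<in> E" for s
  proof (rule resolvent_set_of_lower_bound[OF _ F_pos[OF s DA_0]])
    show "clinear_on DA A"
      unfolding DA_eq A_eq by (rule c.A_linear)
    show "\<i> * complex_of_real s + complex_of_real \<epsilon> \<in> resolvent_set DA A" if "\<epsilon> > 0" for \<epsilon>
      unfolding DA_eq A_eq by (rule c.A_right_half_plane) (simp add: that)
  qed (rule key[OF s])
  have bound: "onorm (resolvent DA A (\<i> * complex_of_real s))
      \<le> 2 * C * (M0 s + (N0 s)\<^sup>2 * (M2 s)\<^sup>2 * (\<mu> s / \<eta> s))" if s: "s \<in> E" for s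
  proof -
    have "onorm (resolvent DA A (\<i> * complex_of_real s)) \<le> F s"
    proof (rule onorm_bound)
      show "0 \<le> F s" using F_pos[OF s DA_0] by simp
      show "norm (resolvent DA A (\<i> * complex_of_real s) y) \<le> F s * norm y" for y
        using key[OF s resolvent_mem[OF res[OF s], of y]]
        unfolding resolvent_right_inverse[OF res[OF s]] .
    qed
    with F_le[OF s DA_0] show ?thesis by linarith
  qed
  show ?thesis
  proof (intro conjI)
    show "generates_contraction_semigroup DA A"
      unfolding DA_eq A_eq by (rule c.generates_contraction_semigroup)
    show "\<forall>s\<in>E. \<i> * complex_of_real s \<in> resolvent_set DA A"
      using res by blast
    show "\<exists>C>0. \<forall>s\<in>E. onorm (resolvent DA A (\<i> * complex_of_real s))
        \<le> C * (M0 s + (N0 s)\<^sup>2 * (M2 s)\<^sup>2 * (\<mu> s / \<eta> s))"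
      using C bound by (intro exI[of _ "2 * C"]) auto
  qed
qed

end
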